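(* There is an absolute constant $c_0>0$ such that, with $\varepsilon=\varepsilon(n)=c_0/n^4$, the following holds. Suppose that for every $n$ there is a degree-$d(n)$, $q(n)$-query OV algorithm which, for every game with $n$ strategies per player and all payoffs in $[-1,1]$ and every degree-$d(n)$ pseudo-equilibrium of that game given to it as input, outputs an $\varepsilon$-NE of the game with probability at least $2/3$. Then there is a constant $c>0$ such that for all sufficiently large $n$, either $d(n)\ge cn$ or $q(n)\ge 2^{cn}$. The same conclusion holds for OV algorithms that use the partial verification oracle instead of the verification oracle.
   Context: A two-player game with $n$ strategies is a pair $(R,C)$ of matrices in $\mathbb{R}^{n\times n}$ (payoffs of the row and column player). Mixed strategies are elements of $\Delta_n=\{x\in[0,1]^n:\sum_i x_i=1\}$; $e_i$ denotes the $i$-th pure strategy. At $(x,y)\in\Delta_n\times\Delta_n$ the payoffs are $x^\top Ry$ and $x^\top Cy$. A profile $(x,y)$ is an $\varepsilon$-approximate Nash equilibrium ($\varepsilon$-NE) if $x^\top Ry\ge e_i^\top Ry-\varepsilon$ and $x^\top Cy\ge x^\top Ce_j-\varepsilon$ for all $i,j\in[n]$. A degree-$d$ pseudo-distribution on $\mathbb{R}^m$ is a finitely supported signed measure $\tilde\mu$ whose functional $\tilde{\mathbb E}[f]=\sum_{z}\tilde\mu(z)f(z)$ satisfies $\tilde{\mathbb E}[1]=1$ and $\tilde{\mathbb E}[q^2]\ge 0$ for all polynomials $q$ of degree $\le d/2$; it satisfies a constraint $h\ge 0$ if $\tilde{\mathbb E}[p^2h]\ge0$ for every polynomial $p$ with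 $\deg(p^2h)\le d$ (an equality $h=0$ means both $h\ge0$ and $-h\ge0$). A degree-$d$ pseudo-equilibrium of $(R,C)$ is a degree-$d$ pseudo-distribution over $(x,y)\in\mathbb{R}^{2n}$ satisfying $x_i\ge0$, $y_i\ge0$, $\sum_ix_i=1$, $\sum_iy_i=1$, $x^\top Ry-e_i^\top Ry\ge0$ and $x^\top Cy-x^\top Ce_j\ge0$ for all $i,j$. A degree-$d$, $q$-query OV algorithm (oblivious rounding with verification oracle) for computing $\varepsilon$-NE is a (possibly randomized, computationally unbounded) procedure whose only input is a degree-$d$ pseudo-equilibrium of the unknown input game $G$ (it does not see $G$), which may adaptively make at most $q$ queries to an oracle for $G$, and which outputs a strategy profile. The verification oracle takes a profile $(x,y)$ and answers whether it is an $\varepsilon$-NE of $G$. The partial verification oracle takes a single strategy of one player ($x$ for the row player or $y$ for the column player) and answers whether some $\varepsilon$-NE of $G$ has that strategy for that player. *)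

theory Defs
  imports
    "HOL-Probability.Probability"
    "HOL-Library.Poly_Mapping"
    "Jordan_Normal_Form.Matrix"
begin

(* Vectors and matrices are those of Jordan_Normal_Form, whose dimension is a natural number;
   the clashing names of HOL-Analysis are hidden. *)
hide_type (open) Finite_Cartesian_Product.vec
hide_const (open) Finite_Cartesian_Product.vec
unbundle no vec_syntax
unbundle no inner_syntax

section \<open>Bimatrix games and approximate equilibria\<close>

type_synonym game = "real mat \<times> real mat"
type_synonym profile = "real vec \<times> real vec"

definition is_game :: "nat \<Rightarrow> game \<Rightarrow> bool" where
  "is_game n G \<longleftrightarrow> fst G \<in> carrier_mat n n \<and> snd G \<in> carrier_mat n n"

definition payoffs_in_unit :: "nat \<Rightarrow> game \<Rightarrow> bool" where
  "payoffs_in_unit n G \<longleftrightarrow>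
     (\<forall>i<n. \<forall>j<n. fst G $$ (i, j) \<in> {-1..1} \<and> snd G $$ (i, j) \<in> {-1..1})"

definition mixed_strategies :: "nat \<Rightarrow> real vec set" where
  "mixed_strategies n = {x \<in> carrier_vec n. (\<forall>i<n. x $ i \<in> {0..1}) \<and> (\<Sum>i<n. x $ i) = 1}"

definition payoff :: "real mat \<Rightarrow> real vec \<Rightarrow> real vec \<Rightarrow> real" where
  "payoff M x y = x \<bullet> (M *\<^sub>v y)"

definition approx_NE :: "nat \<Rightarrow> real \<Rightarrow> game \<Rightarrow> profile \<Rightarrow> bool" where
  "approx_NE n \<epsilon> G s \<longleftrightarrow> (case (G, s) of ((R, C), (x, y)) \<Rightarrow>
     x \<in> mixed_strategies n \<and> y \<in> mixed_strategies n \<and>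
     (\<forall>i<n. payoff R x y \<ge> payoff R (unit_vec n i) y - \<epsilon>) \<and>
     (\<forall>j<n. payoff C x y \<ge> payoff C x (unit_vec n j) - \<epsilon>))"

section \<open>Polynomials in finitely many real variables\<close>

(* A polynomial maps each monomial (an exponent vector) to its coefficient;
   Poly_Mapping supplies the ring structure. *)
type_synonym real_mpoly = "(nat \<Rightarrow>\<^sub>0 nat) \<Rightarrow>\<^sub>0 real"

definition mpolys :: "nat \<Rightarrow> real_mpoly set" where
  "mpolys m = {p. \<forall>a\<in>Poly_Mapping.keys p. Poly_Mapping.keys a \<subseteq> {..<m}}"

definition mvar :: "nat \<Rightarrow> real_mpoly" where
  "mvar i = Poly_Mapping.single (Poly_Mapping.single i 1) 1"

definition mconst :: "real \<Rightarrow> real_mpoly" where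
  "mconst c = Poly_Mapping.single 0 c"

(* The zero polynomial gets degree 0. *)
definition total_degree :: "real_mpoly \<Rightarrow> nat" where
  "total_degree p =
     Max (insert 0 ((\<lambda>a. \<Sum>i\<in>Poly_Mapping.keys a. Poly_Mapping.lookup a i) ` Poly_Mapping.keys p))"

definition eval_mpoly :: "real vec \<Rightarrow> real_mpoly \<Rightarrow> real" where
  "eval_mpoly z p =
     (\<Sum>a\<in>Poly_Mapping.keys p. Poly_Mapping.lookup p a *
        (\<Prod>i\<in>Poly_Mapping.keys a. (z $ i) ^ Poly_Mapping.lookup a i))"

section \<open>Pseudo-distributions and pseudo-equilibria\<close>

(* A finitely supported signed measure, given by the masses of its atoms. *)
type_synonym signed_measure = "real vec \<Rightarrow>\<^sub>0 real"

definition pseudo_expectation :: "signed_measure \<Rightarrow> (real vec \<Rightarrow> real) \<Rightarrow> real" where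
  "pseudo_expectation \<mu> f = (\<Sum>z\<in>Poly_Mapping.keys \<mu>. Poly_Mapping.lookup \<mu> z * f z)"

definition pseudo_distribution :: "nat \<Rightarrow> nat \<Rightarrow> signed_measure \<Rightarrow> bool" where
  "pseudo_distribution m d \<mu> \<longleftrightarrow>
     Poly_Mapping.keys \<mu> \<subseteq> carrier_vec m \<and>
     pseudo_expectation \<mu> (\<lambda>z. 1) = 1 \<and>
     (\<forall>q\<in>mpolys m. real (total_degree q) \<le> real d / 2 \<longrightarrow>
        pseudo_expectation \<mu> (\<lambda>z. eval_mpoly z (q ^ 2)) \<ge> 0)"

definition satisfies_ge0 :: "nat \<Rightarrow> nat \<Rightarrow> signed_measure \<Rightarrow> real_mpoly \<Rightarrow> bool" where
  "satisfies_ge0 m d \<mu> h \<longleftrightarrow>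
     (\<forall>p\<in>mpolys m. total_degree (p ^ 2 * h) \<le> d \<longrightarrow>
        pseudo_expectation \<mu> (\<lambda>z. eval_mpoly z (p ^ 2 * h)) \<ge> 0)"

definition satisfies_eq0 :: "nat \<Rightarrow> nat \<Rightarrow> signed_measure \<Rightarrow> real_mpoly \<Rightarrow> bool" where
  "satisfies_eq0 m d \<mu> h \<longleftrightarrow> satisfies_ge0 m d \<mu> h \<and> satisfies_ge0 m d \<mu> (- h)"

(* In \<real>^(2n), variable i stands for x_i and variable n + i for y_i (i < n).
   row_gain n R i is x^T R y - e_i^T R y and col_gain n C j is x^T C y - x^T C e_j. *)
definition payoff_poly :: "nat \<Rightarrow> real mat \<Rightarrow> real_mpoly" where
  "payoff_poly n M = (\<Sum>k<n. \<Sum>l<n. mconst (M $$ (k, l)) * mvar k * mvar (n + l))"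

definition row_gain :: "nat \<Rightarrow> real mat \<Rightarrow> nat \<Rightarrow> real_mpoly" where
  "row_gain n R i = payoff_poly n R - (\<Sum>l<n. mconst (R $$ (i, l)) * mvar (n + l))"

definition col_gain :: "nat \<Rightarrow> real mat \<Rightarrow> nat \<Rightarrow> real_mpoly" where
  "col_gain n C j = payoff_poly n C - (\<Sum>k<n. mconst (C $$ (k, j)) * mvar k)"

definition pseudo_equilibrium :: "nat \<Rightarrow> nat \<Rightarrow> game \<Rightarrow> signed_measure \<Rightarrow> bool" where
  "pseudo_equilibrium n d G \<mu> \<longleftrightarrow>
     pseudo_distribution (2 * n) d \<mu> \<and>
     (\<forall>i<n. satisfies_ge0 (2 * n) d \<mu> (mvar i)) \<and>
     (\<forall>i<n. satisfies_ge0 (2 * n) d \<mu> (mvar (n + i))) \<and>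
     satisfies_eq0 (2 * n) d \<mu> ((\<Sum>i<n. mvar i) - 1) \<and>
     satisfies_eq0 (2 * n) d \<mu> ((\<Sum>i<n. mvar (n + i)) - 1) \<and>
     (\<forall>i<n. satisfies_ge0 (2 * n) d \<mu> (row_gain n (fst G) i)) \<and>
     (\<forall>j<n. satisfies_ge0 (2 * n) d \<mu> (col_gain n (snd G) j))"

section \<open>Oblivious rounding with a verification oracle\<close>

(* A deterministic adaptive query procedure: Query a t f asks a and continues with t if the
   answer is yes and with f if it is no. *)
datatype ('a, 'r) query_tree =
    Output 'r
  | Query 'a "('a, 'r) query_tree" "('a, 'r) query_tree"

primrec query_depth :: "('a, 'r) query_tree \<Rightarrow> nat" where
  "query_depth (Output r) = 0"
| "query_depth (Query a t f) = Suc (max (query_depth t) (query_depth f))"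

primrec run_tree :: "('a \<Rightarrow> bool) \<Rightarrow> ('a, 'r) query_tree \<Rightarrow> 'r" where
  "run_tree orc (Output r) = r"
| "run_tree orc (Query a t f) = (if orc a then run_tree orc t else run_tree orc f)"

definition verification_oracle :: "nat \<Rightarrow> real \<Rightarrow> game \<Rightarrow> profile \<Rightarrow> bool" where
  "verification_oracle n \<epsilon> G s \<longleftrightarrow> approx_NE n \<epsilon> G s"

datatype strategy = Row_Strategy "real vec" | Col_Strategy "real vec"

definition partial_verification_oracle :: "nat \<Rightarrow> real \<Rightarrow> game \<Rightarrow> strategy \<Rightarrow> bool" where
  "partial_verification_oracle n \<epsilon> G s \<longleftrightarrow> (case s of
       Row_Strategy x \<Rightarrow> \<exists>y. approx_NE n \<epsilon> G (x, y)
     | Col_Strategy y \<Rightarrow> \<exists>x. approx_NE n \<epsilon> G (x, y))"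

(* A randomized procedure is a probability measure on deterministic ones. The sigma-algebra is
   arbitrary, so every probability space of random seeds is covered (push it forward to the trees).
   The measure depends on the input pseudo-equilibrium only, never on the game. *)
type_synonym 'a ov_procedure = "signed_measure \<Rightarrow> ('a, profile) query_tree measure"

definition ov_algorithm :: "nat \<Rightarrow> nat \<Rightarrow> nat \<Rightarrow> 'a ov_procedure \<Rightarrow> bool" where
  "ov_algorithm n d q A \<longleftrightarrow>
     (\<forall>G \<mu>. is_game n G \<and> pseudo_equilibrium n d G \<mu> \<longrightarrow>
        prob_space (A \<mu>) \<and> (\<forall>T\<in>space (A \<mu>). query_depth T \<le> q))"

(* A non-measurable set has measure 0, so the bound includes measurability of the success event. *)
definition computes_NE ::
  "nat \<Rightarrow> nat \<Rightarrow> real \<Rightarrow> (game \<Rightarrow> 'a \<Rightarrow> bool) \<Rightarrow> 'a ov_procedure \<Rightarrow> bool" where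
  "computes_NE n d \<epsilon> orc A \<longleftrightarrow>
     (\<forall>G \<mu>. is_game n G \<and> payoffs_in_unit n G \<and> pseudo_equilibrium n d G \<mu> \<longrightarrow>
        measure (A \<mu>) {T \<in> space (A \<mu>). approx_NE n \<epsilon> G (run_tree (orc G) T)} \<ge> 2 / 3)"

end

(* Grigoriev's knapsack pseudo-distribution lives on the sign vectors of odd length m and pretends
   that the signs sum to 0.  It is planted in a game as follows.  The first 2m strategies of both
   players form m blocks of two: a matching-pennies term forces every block to have mass about 1/m,
   and a much weaker two-by-two coordination game inside each block has exactly three equilibria,
   with signed masses 1, -1 and -1/3.  Two further row strategies profit as soon as the signed masses
   do not cancel, so the row player is content only if the signs sum to 0.  The pseudo-distribution
   believes that they do; true equilibria cannot, as an odd number of values from {1, -1, -1/3} never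
   sums to 0, and hence they move to the remaining strategies.  There the players face matching
   pennies with weights in {1/2, 1}, whose equilibrium strategies reveal the weights, while the
   pseudo-distribution puts no mass there.  So exponentially many games share a pseudo-equilibrium,
   and a single strategy is part of an approximate equilibrium of at most one of them. *)

theory Submission
  imports Defs
begin

section \<open>Evaluation and degree of polynomials\<close>

text \<open>A coordination game always has a mixed equilibrium besides the pure ones, and this
  dictates the payoffs: in a symmetric game it would have signed mass 0, and blocks in that state
  could cancel the imbalance. The skewed payoffs move it to -1/3, so all three signed masses are odd
  multiples of 1/3. The constants follow from two competing errors. Matching pennies fixes the block
  masses up to a relative error of order \<open>coupling\<close>, which the signed sum inherits,
  while parity only guarantees an imbalance of order 1/m; so \<open>coupling\<close> is a small
  multiple of 1/m. Within a block, best responses are visible only at the scale of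
  \<open>coupling\<close>, and telling the three states apart takes an error of order 1/m^3 at that
  scale; so \<epsilon> is of order 1/m^4. On the support of the pseudo-distribution every gain is a
  nonnegative multiple of the square of a function of degree at most 1, plus a multiple of the sign
  sum. Its constraints thus reduce to two facts about moments on the cube: products with the sign
  sum have expectation 0 and squares have nonnegative expectation, as long as the degrees stay below
  m.\<close>

definition monomial_degree :: "(nat \<Rightarrow>\<^sub>0 nat) \<Rightarrow> nat" where
  "monomial_degree a = (\<Sum>i\<in>Poly_Mapping.keys a. Poly_Mapping.lookup a i)"

definition eval_monomial :: "real vec \<Rightarrow> (nat \<Rightarrow>\<^sub>0 nat) \<Rightarrow> real" where
  "eval_monomial z a = (\<Prod>i\<in>Poly_Mapping.keys a. (z $ i) ^ Poly_Mapping.lookup a i)"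

lemma monomial_degree_superset:
  assumes "finite A" "Poly_Mapping.keys a \<subseteq> A"
  shows "monomial_degree a = (\<Sum>i\<in>A. Poly_Mapping.lookup a i)"
  unfolding monomial_degree_def
  by (rule sum.mono_neutral_left) (use assms in \<open>auto simp: in_keys_iff\<close>)

lemma eval_monomial_superset:
  assumes "finite A" "Poly_Mapping.keys a \<subseteq> A"
  shows "eval_monomial z a = (\<Prod>i\<in>A. (z $ i) ^ Poly_Mapping.lookup a i)"
  unfolding eval_monomial_def
  by (rule prod.mono_neutral_left) (use assms in \<open>auto simp: in_keys_iff\<close>)

lemma monomial_degree_add: "monomial_degree (a + b) = monomial_degree a + monomial_degree b"
proof -
  let ?A = "Poly_Mapping.keys a \<union> Poly_Mapping.keys b"
  have "Poly_Mapping.keys (a + b) \<subseteq> ?A" by (rule keys_add)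
  then show ?thesis
    by (simp add: monomial_degree_superset[of ?A] lookup_add sum.distrib)
qed

lemma eval_monomial_add: "eval_monomial z (a + b) = eval_monomial z a * eval_monomial z b"
proof -
  let ?A = "Poly_Mapping.keys a \<union> Poly_Mapping.keys b"
  have "Poly_Mapping.keys (a + b) \<subseteq> ?A" by (rule keys_add)
  then show ?thesis
    by (simp add: eval_monomial_superset[of ?A] lookup_add power_add prod.distrib)
qed

lemma eval_mpoly_altdef:
  "eval_mpoly z p = (\<Sum>a\<in>Poly_Mapping.keys p. Poly_Mapping.lookup p a * eval_monomial z a)"
  by (simp add: eval_mpoly_def eval_monomial_def)

lemma eval_mpoly_superset:
  assumes "finite A" "Poly_Mapping.keys p \<subseteq> A"
  shows "eval_mpoly z p = (\<Sum>a\<in>A. Poly_Mapping.lookup p a * eval_monomial z a)"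
  unfolding eval_mpoly_altdef
  by (rule sum.mono_neutral_left) (use assms in \<open>auto simp: in_keys_iff\<close>)

lemma eval_mpoly_zero [simp]: "eval_mpoly z 0 = 0"
  by (simp add: eval_mpoly_def)

lemma eval_mpoly_single [simp]: "eval_mpoly z (Poly_Mapping.single a c) = c * eval_monomial z a"
  by (simp add: eval_mpoly_superset[of "{a}"])

lemma eval_mpoly_one [simp]: "eval_mpoly z 1 = 1"
  by (simp add: eval_mpoly_altdef eval_monomial_def lookup_one)

lemma eval_mpoly_add [simp]: "eval_mpoly z (p + q) = eval_mpoly z p + eval_mpoly z q"
proof -
  let ?A = "Poly_Mapping.keys p \<union> Poly_Mapping.keys q"
  have "Poly_Mapping.keys (p + q) \<subseteq> ?A" by (rule keys_add)
  then show ?thesis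
    by (simp add: eval_mpoly_superset[of ?A] lookup_add ring_distribs sum.distrib)
qed

lemma eval_mpoly_minus [simp]: "eval_mpoly z (- p) = - eval_mpoly z p"
  using eval_mpoly_add[of z p "- p"] by simp

lemma eval_mpoly_diff [simp]: "eval_mpoly z (p - q) = eval_mpoly z p - eval_mpoly z q"
  using eval_mpoly_add[of z p "- q"] by simp

lemma eval_mpoly_sum [simp]: "eval_mpoly z (sum f A) = (\<Sum>i\<in>A. eval_mpoly z (f i))"
  by (induction A rule: infinite_finite_induct) auto

lemma mpoly_expansion:
  "(p :: real_mpoly) = (\<Sum>a\<in>Poly_Mapping.keys p. Poly_Mapping.single a (Poly_Mapping.lookup p a))"
proof (rule poly_mapping_eqI)
  fix k
  show "Poly_Mapping.lookup p k = Poly_Mapping.lookup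
    (\<Sum>a\<in>Poly_Mapping.keys p. Poly_Mapping.single a (Poly_Mapping.lookup p a)) k"
    by (cases "k \<in> Poly_Mapping.keys p")
      (auto simp: lookup_sum lookup_single when_def in_keys_iff sum.delta)
qed

lemma mpoly_mult_expansion:
  "(p :: real_mpoly) * q = (\<Sum>a\<in>Poly_Mapping.keys p. \<Sum>b\<in>Poly_Mapping.keys q.
     Poly_Mapping.single (a + b) (Poly_Mapping.lookup p a * Poly_Mapping.lookup q b))"
  by (subst mpoly_expansion[of p], subst mpoly_expansion[of q])
     (simp add: sum_product mult_single)

lemma eval_mpoly_mult [simp]: "eval_mpoly z (p * q) = eval_mpoly z p * eval_mpoly z q"
proof -
  have "eval_mpoly z (p * q) = (\<Sum>a\<in>Poly_Mapping.keys p. \<Sum>b\<in>Poly_Mapping.keys q.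
     (Poly_Mapping.lookup p a * eval_monomial z a) * (Poly_Mapping.lookup q b * eval_monomial z b))"
    unfolding mpoly_mult_expansion by (simp add: eval_monomial_add mult_ac)
  also have "\<dots> = eval_mpoly z p * eval_mpoly z q"
    unfolding eval_mpoly_altdef by (rule sum_product[symmetric])
  finally show ?thesis .
qed

lemma eval_mpoly_power [simp]: "eval_mpoly z (p ^ k) = eval_mpoly z p ^ k"
  by (induction k) auto

lemma eval_mpoly_mvar [simp]: "eval_mpoly z (mvar i) = z $ i"
  by (simp add: mvar_def eval_monomial_def)

lemma eval_mpoly_mconst [simp]: "eval_mpoly z (mconst c) = c"
  by (simp add: mconst_def eval_monomial_def)

lemma total_degree_le_iff:
  "total_degree p \<le> d \<longleftrightarrow> (\<forall>a\<in>Poly_Mapping.keys p. monomial_degree a \<le> d)"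
  by (simp add: total_degree_def monomial_degree_def)

lemma monomial_degree_le_total_degree:
  "a \<in> Poly_Mapping.keys p \<Longrightarrow> monomial_degree a \<le> total_degree p"
  using total_degree_le_iff by blast

lemma total_degree_attained:
  assumes "p \<noteq> 0"
  shows "\<exists>a\<in>Poly_Mapping.keys p. monomial_degree a = total_degree p"
proof (rule ccontr)
  assume *: "\<not> ?thesis"
  have "Poly_Mapping.keys p \<noteq> {}" using assms by (metis lookup_not_eq_zero_eq_in_keys empty_iff poly_mapping_eqI lookup_zero)
  then obtain a where a: "a \<in> Poly_Mapping.keys p" by blast
  have lt: "monomial_degree b < total_degree p" if "b \<in> Poly_Mapping.keys p" for b
    using * monomial_degree_le_total_degree[OF that] that by (metis le_neq_implies_less)
  have "total_degree p \<le> total_degree p - 1"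
    unfolding total_degree_le_iff[of p "total_degree p - 1"] using lt by fastforce
  with lt[OF a] show False by simp
qed

text \<open>Among the monomials of maximal degree, the largest one in the monomial order of each factor
  multiplies to a monomial that cannot cancel in the product.\<close>

lemma total_degree_mult_ge:
  assumes "p \<noteq> 0" "q \<noteq> 0"
  shows "total_degree p + total_degree q \<le> total_degree (p * q)"
proof -
  let ?P = "{a\<in>Poly_Mapping.keys p. monomial_degree a = total_degree p}"
  let ?Q = "{a\<in>Poly_Mapping.keys q. monomial_degree a = total_degree q}"
  have ne: "?P \<noteq> {}" "?Q \<noteq> {}" using total_degree_attained assms by blast+
  have fin: "finite ?P" "finite ?Q" by auto
  define k l where "k = Max ?P" and "l = Max ?Q"
  have k: "k \<in> ?P" and l: "l \<in> ?Q"
    using Max_in[OF fin(1) ne(1)] Max_in[OF fin(2) ne(2)] by (auto simp: k_def l_def)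
  have uniq: "a = k \<and> b = l" if ab: "a \<in> Poly_Mapping.keys p" "b \<in> Poly_Mapping.keys q" "a + b = k + l" for a b
  proof -
    have "monomial_degree a + monomial_degree b = total_degree p + total_degree q"
      using ab(3) k l by (metis (mono_tags, lifting) mem_Collect_eq monomial_degree_add)
    moreover have "monomial_degree a \<le> total_degree p" "monomial_degree b \<le> total_degree q"
      using ab monomial_degree_le_total_degree by auto
    ultimately have "a \<in> ?P" "b \<in> ?Q" using ab by auto
    then have le: "a \<le> k" "b \<le> l" using fin by (auto simp: k_def l_def)
    show ?thesis
      using le ab(3) by (metis add_less_le_mono add_le_less_mono order_less_irrefl le_less)
  qed
  have "Poly_Mapping.lookup (p * q) (k + l) =
    (\<Sum>a\<in>Poly_Mapping.keys p. \<Sum>b\<in>Poly_Mapping.keys q.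
       if a = k \<and> b = l then Poly_Mapping.lookup p k * Poly_Mapping.lookup q l else 0)"
    unfolding mpoly_mult_expansion lookup_sum
    by (intro sum.cong refl) (auto simp: lookup_single when_def dest: uniq)
  also have "\<dots> = (\<Sum>a\<in>Poly_Mapping.keys p. if a = k then Poly_Mapping.lookup p k * Poly_Mapping.lookup q l else 0)"
    using l by (intro sum.cong refl) (auto simp: sum.delta)
  also have "\<dots> = Poly_Mapping.lookup p k * Poly_Mapping.lookup q l"
    using k by (simp add: sum.delta)
  also have "\<dots> \<noteq> 0" using k l by (simp add: in_keys_iff)
  finally have "k + l \<in> Poly_Mapping.keys (p * q)" by (simp add: in_keys_iff)
  from monomial_degree_le_total_degree[OF this] show ?thesis
    using k l by (simp add: monomial_degree_add)
qed

text \<open>The constraints bound the degree of the product p^2 h, whereas positivity on the cube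
  needs a bound on p alone. Leading terms do not cancel, so the bound passes to p once h is
  nonzero.\<close>

lemma degree_of_multiplier:
  assumes "total_degree (p ^ 2 * h) \<le> d" "h \<noteq> 0"
  shows "2 * total_degree p \<le> d"
proof (cases "p = 0")
  case True
  then show ?thesis by (simp add: total_degree_def)
next
  case False
  have "2 * total_degree p \<le> total_degree (p * p)"
    using total_degree_mult_ge[OF False False] by simp
  also have "\<dots> \<le> total_degree (p * p * h)"
    using total_degree_mult_ge[of "p * p" h] False assms(2) by simp
  finally show ?thesis using assms(1) by (simp add: power2_eq_square)
qed

section \<open>Fourier analysis on the cube\<close>

text \<open>A subset \<open>T\<close> stands for the sign vector that is \<open>-1\<close> exactly on \<open>T\<close>.\<close>

definition character :: "nat set \<Rightarrow> nat set \<Rightarrow> real" where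
  "character S T = (-1) ^ card (S \<inter> T)"

lemma character_empty [simp]: "character {} T = 1"
  by (simp add: character_def)

lemma character_prod:
  assumes "finite S"
  shows "character S T = (\<Prod>i\<in>S. if i \<in> T then -1 else 1)"
proof -
  have "(\<Prod>i\<in>S. if i \<in> T then -1 else 1 :: real) = (\<Prod>i\<in>S \<inter> T. -1)"
    using assms by (simp add: prod.If_cases)
  then show ?thesis by (simp add: character_def)
qed

lemma character_single: "character {i} T = (if i \<in> T then -1 else 1)"
  by (subst character_prod) auto

lemma character_commute: "character S T = character T S"
  by (simp add: character_def Int_commute)

lemma character_mult:
  assumes "finite S" "finite S'"
  shows "character S T * character S' T = character (sym_diff S S') T"
proof -
  have fin: "finite (S - S')" "finite (S' - S)" "finite (S \<inter> S')" using assms by auto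
  have 1: "character S T = character (S - S') T * character (S \<inter> S') T"
    using assms by (simp add: character_prod prod.union_disjoint[symmetric] Un_Diff_Int)
      (subst prod.union_disjoint[symmetric], auto simp: Un_Diff_Int)
  have 2: "character S' T = character (S' - S) T * character (S \<inter> S') T"
  proof -
    have "S' = (S' - S) \<union> (S \<inter> S')" by blast
    then show ?thesis using assms
      by (metis (no_types, lifting) character_prod fin prod.union_disjoint Diff_disjoint Int_Diff Int_commute inf_bot_right inf_left_commute)
  qed
  have 3: "character (sym_diff S S') T = character (S - S') T * character (S' - S) T"
    using assms by (simp add: character_prod) (subst prod.union_disjoint, auto)
  have 4: "character (S \<inter> S') T * character (S \<inter> S') T = 1"
    by (simp add: character_def power_mult_distrib[symmetric])
  show ?thesis unfolding 1 2 3 using 4 by (metis (no_types, lifting) mult.assoc mult.commute mult.right_neutral)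
qed

text \<open>Orthogonality of characters: the sum factorises over the coordinates, and each
  coordinate in \<open>A\<close> contributes the factor -1 + 1.\<close>

lemma sum_character:
  assumes "finite I" "A \<subseteq> I"
  shows "(\<Sum>T\<in>Pow I. character A T) = (if A = {} then 2 ^ card I else 0)"
proof -
  have finA: "finite A" using assms finite_subset by blast
  have "(\<Sum>T\<in>Pow I. character A T) = (\<Sum>T\<in>Pow I. (\<Prod>i\<in>T. if i \<in> A then -1 else 1) * (\<Prod>i\<in>I - T. 1))"
    using assms(1) by (intro sum.cong refl) (simp add: character_commute[of A] character_prod finite_subset)
  also have "\<dots> = (\<Prod>i\<in>I. (if i \<in> A then -1 else 1) + (1::real))"
    by (rule prod_add[OF assms(1), symmetric])
  also have "\<dots> = (if A = {} then 2 ^ card I else 0)"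
    using assms by auto
  finally show ?thesis .
qed

text \<open>Gram-Schmidt, giving the orthogonal projection onto the span of the \<open>v R\<close>.
  The vectors may be dependent: if the residual \<open>u\<close> of the new vector vanishes on
  \<open>P\<close>, every coefficient \<open>a\<close> works.\<close>

lemma orthogonal_residual_exists:
  fixes v :: "'k \<Rightarrow> 'p \<Rightarrow> real"
  assumes "finite K" "finite P"
  shows "\<exists>\<phi>. \<forall>R\<in>K. (\<Sum>T\<in>P. (c T - (\<Sum>R'\<in>K. \<phi> R' * v R' T)) * v R T) = 0"
  using assms(1)
proof (induction K arbitrary: c rule: finite_induct)
  case empty
  then show ?case by simp
next
  case (insert R0 K)
  obtain \<phi> where \<phi>: "\<forall>R\<in>K. (\<Sum>T\<in>P. (c T - (\<Sum>R'\<in>K. \<phi> R' * v R' T)) * v R T) = 0"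
    using insert.IH by blast
  obtain \<psi> where \<psi>: "\<forall>R\<in>K. (\<Sum>T\<in>P. (v R0 T - (\<Sum>R'\<in>K. \<psi> R' * v R' T)) * v R T) = 0"
    using insert.IH by blast
  define r where "r T = c T - (\<Sum>R'\<in>K. \<phi> R' * v R' T)" for T
  define u where "u T = v R0 T - (\<Sum>R'\<in>K. \<psi> R' * v R' T)" for T
  have r0: "(\<Sum>T\<in>P. r T * v R T) = 0" if "R \<in> K" for R using \<phi> that by (simp add: r_def)
  have u0: "(\<Sum>T\<in>P. u T * v R T) = 0" if "R \<in> K" for R using \<psi> that by (simp add: u_def)
  have orth: "(\<Sum>T\<in>P. f T * v R0 T) = (\<Sum>T\<in>P. f T * u T)"
    if "\<And>R. R \<in> K \<Longrightarrow> (\<Sum>T\<in>P. f T * v R T) = 0" for f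
  proof -
    have "(\<Sum>T\<in>P. f T * (\<Sum>R'\<in>K. \<psi> R' * v R' T)) = (\<Sum>R'\<in>K. \<psi> R' * (\<Sum>T\<in>P. f T * v R' T))"
      by (simp add: sum_distrib_left mult_ac) (rule sum.swap)
    also have "\<dots> = 0" using that by simp
    finally show ?thesis by (simp add: u_def right_diff_distrib sum_subtractf)
  qed
  define a where "a = (\<Sum>T\<in>P. r T * u T) / (\<Sum>T\<in>P. u T * u T)"
  have a: "(\<Sum>T\<in>P. (r T - a * u T) * u T) = 0"
  proof (cases "(\<Sum>T\<in>P. u T * u T) = 0")
    case True
    then have "\<forall>T\<in>P. u T * u T = 0" by (subst (asm) sum_nonneg_eq_0_iff) (auto simp: assms(2))
    then show ?thesis by simp
  next
    case False
    then show ?thesis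
      by (simp only: left_diff_distrib sum_subtractf mult.assoc sum_distrib_left[symmetric]) (simp add: a_def)
  qed
  define \<chi> where "\<chi> R = (if R = R0 then a else \<phi> R - a * \<psi> R)" for R
  have res: "c T - (\<Sum>R'\<in>insert R0 K. \<chi> R' * v R' T) = r T - a * u T" for T
  proof -
    have "(\<Sum>R'\<in>K. \<chi> R' * v R' T) = (\<Sum>R'\<in>K. (\<phi> R' - a * \<psi> R') * v R' T)"
      using insert.hyps by (intro sum.cong) (auto simp: \<chi>_def)
    then show ?thesis using insert.hyps
      by (simp add: r_def u_def \<chi>_def left_diff_distrib sum_subtractf sum_distrib_left algebra_simps)
  qed
  have K0: "(\<Sum>T\<in>P. (r T - a * u T) * v R T) = 0" if "R \<in> K" for R
    using r0[OF that] u0[OF that]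
    by (simp add: left_diff_distrib sum_subtractf mult.assoc sum_distrib_left[symmetric])
  have "(\<Sum>T\<in>P. (r T - a * u T) * v R T) = 0" if "R \<in> insert R0 K" for R
  proof (cases "R \<in> K")
    case True then show ?thesis by (rule K0)
  next
    case False
    with that have "R = R0" by blast
    then show ?thesis using orth[of "\<lambda>T. r T - a * u T"] K0 a by simp
  qed
  then show ?case by (intro exI[of _ \<chi>]) (simp only: res, blast)
qed

section \<open>The knapsack pseudo-expectation on the cube\<close>

text \<open>The moment of a product of \<open>j\<close> distinct signs, as forced by symmetry and the constraint that the
  \<open>m\<close> signs sum to 0.\<close>

fun knapsack_moment :: "nat \<Rightarrow> nat \<Rightarrow> real" where
  "knapsack_moment m 0 = 1"
| "knapsack_moment m (Suc 0) = 0"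
| "knapsack_moment m (Suc (Suc j)) = - (real (Suc j) / real (m - Suc j)) * knapsack_moment m j"

lemma knapsack_moment_odd: "odd j \<Longrightarrow> knapsack_moment m j = 0"
  by (induction m j rule: knapsack_moment.induct) auto

text \<open>Each step of the recursion multiplies by a number that is at most 0 (equal to 0 once the
  truncated subtraction leaves a zero denominator), so the signs alternate. Positivity on harmonic
  functions rests on this pattern.\<close>

lemma knapsack_moment_even: "0 \<le> (-1) ^ t * knapsack_moment m (2 * t)"
proof (induction t)
  case (Suc t)
  have "(-1) ^ Suc t * knapsack_moment m (2 * Suc t) =
    real (Suc (2 * t)) / real (m - Suc (2 * t)) * ((-1) ^ t * knapsack_moment m (2 * t))"
    by simp
  also have "\<dots> \<ge> 0" by (rule mult_nonneg_nonneg[OF _ Suc]) simp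
  finally show ?case .
qed simp

text \<open>This is the expectation of the sign sum times a character of size \<open>j\<close>:
  multiplying by one of its \<open>j\<close> signs shortens the character, by one of the other
  \<open>m - j\<close> lengthens it.\<close>

lemma knapsack_moment_recurrence:
  assumes "odd m" "0 < j" "j < m"
  shows "real j * knapsack_moment m (j - 1) + real (m - j) * knapsack_moment m (Suc j) = 0"
proof -
  obtain i where i: "j = Suc i" using assms(2) by (metis gr0_implies_Suc)
  then show ?thesis using assms by (simp add: field_simps)
qed

text \<open>Inverse Fourier transform of the moments.\<close>

definition knapsack_weight :: "nat \<Rightarrow> nat set \<Rightarrow> real" where
  "knapsack_weight m T = (\<Sum>S\<in>Pow {..<m}. knapsack_moment m (card S) * character S T) / 2 ^ m"

definition knapsack_expectation :: "nat \<Rightarrow> (nat set \<Rightarrow> real) \<Rightarrow> real" where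
  "knapsack_expectation m f = (\<Sum>T\<in>Pow {..<m}. knapsack_weight m T * f T)"

lemma knapsack_expectation_add:
  "knapsack_expectation m (\<lambda>T. f T + g T) = knapsack_expectation m f + knapsack_expectation m g"
  by (simp add: knapsack_expectation_def ring_distribs sum.distrib)

lemma knapsack_expectation_scale:
  "knapsack_expectation m (\<lambda>T. c * f T) = c * knapsack_expectation m f"
  by (simp add: knapsack_expectation_def sum_distrib_left mult_ac)

lemma knapsack_expectation_sum:
  "knapsack_expectation m (\<lambda>T. \<Sum>i\<in>A. f i T) = (\<Sum>i\<in>A. knapsack_expectation m (f i))"
  unfolding knapsack_expectation_def sum_distrib_left by (rule sum.swap)

lemma knapsack_expectation_cong:
  "(\<And>T. T \<subseteq> {..<m} \<Longrightarrow> f T = g T) \<Longrightarrow> knapsack_expectation m f = knapsack_expectation m g"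
  by (simp add: knapsack_expectation_def)

lemma knapsack_expectation_character:
  assumes "S \<subseteq> {..<m}"
  shows "knapsack_expectation m (character S) = knapsack_moment m (card S)"
proof -
  have "knapsack_expectation m (character S) =
      (\<Sum>T\<in>Pow {..<m}. \<Sum>S'\<in>Pow {..<m}. knapsack_moment m (card S') / 2 ^ m * (character S' T * character S T))"
    unfolding knapsack_expectation_def knapsack_weight_def sum_divide_distrib sum_distrib_right
    by (intro sum.cong refl) simp
  also have "\<dots> = (\<Sum>S'\<in>Pow {..<m}. knapsack_moment m (card S') / 2 ^ m * (\<Sum>T\<in>Pow {..<m}. character S' T * character S T))"
    by (subst sum.swap) (simp add: sum_distrib_left)
  also have "\<dots> = (\<Sum>S'\<in>Pow {..<m}. if S' = S then knapsack_moment m (card S) else 0)"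
  proof (intro sum.cong refl)
    fix S' assume "S' \<in> Pow {..<m}"
    then have fin: "finite S'" "finite S" "sym_diff S' S \<subseteq> {..<m}"
      using assms finite_subset[of _ "{..<m}"] by auto
    have "(\<Sum>T\<in>Pow {..<m}. character S' T * character S T) = (\<Sum>T\<in>Pow {..<m}. character (sym_diff S' S) T)"
      using fin by (simp add: character_mult)
    also have "\<dots> = (if S' = S then 2 ^ m else 0)"
      using sum_character[of "{..<m}" "sym_diff S' S"] fin(3) by auto
    finally show "knapsack_moment m (card S') / 2 ^ m * (\<Sum>T\<in>Pow {..<m}. character S' T * character S T)
      = (if S' = S then knapsack_moment m (card S) else 0)" by simp
  qed
  also have "\<dots> = knapsack_moment m (card S)"
    using assms by (simp add: sum.delta)
  finally show ?thesis .
qed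

section \<open>Functions of bounded degree on the cube, and the sign-sum constraint\<close>

text \<open>These are the multilinear polynomials of degree at most \<open>D\<close> in the signs.
  Values at sets outside \<open>{..<m}\<close> are left free, as they never enter an
  expectation.\<close>

definition cube_polys :: "nat \<Rightarrow> nat \<Rightarrow> (nat set \<Rightarrow> real) set" where
  "cube_polys m D = {f. \<exists>c. \<forall>T\<subseteq>{..<m}. f T = (\<Sum>S | S \<subseteq> {..<m} \<and> card S \<le> D. c S * character S T)}"

lemma finite_bounded_subsets [simp]: "finite {S. S \<subseteq> {..<m::nat} \<and> Q S}"
  by (rule finite_subset[of _ "Pow {..<m}"]) auto

lemma cube_polys_add:
  assumes "f \<in> cube_polys m D" "g \<in> cube_polys m D"
  shows "(\<lambda>T. f T + g T) \<in> cube_polys m D"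
proof -
  from assms obtain c c' where
    "\<forall>T\<subseteq>{..<m}. f T = (\<Sum>S | S \<subseteq> {..<m} \<and> card S \<le> D. c S * character S T)"
    "\<forall>T\<subseteq>{..<m}. g T = (\<Sum>S | S \<subseteq> {..<m} \<and> card S \<le> D. c' S * character S T)"
    unfolding cube_polys_def by blast
  then show ?thesis unfolding cube_polys_def
    by (intro CollectI exI[of _ "\<lambda>S. c S + c' S"]) (simp add: ring_distribs sum.distrib)
qed

lemma cube_polys_scale:
  assumes "f \<in> cube_polys m D"
  shows "(\<lambda>T. a * f T) \<in> cube_polys m D"
proof -
  from assms obtain c where
    "\<forall>T\<subseteq>{..<m}. f T = (\<Sum>S | S \<subseteq> {..<m} \<and> card S \<le> D. c S * character S T)"
    unfolding cube_polys_def by blast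
  then show ?thesis unfolding cube_polys_def
    by (intro CollectI exI[of _ "\<lambda>S. a * c S"]) (simp add: mult.assoc sum_distrib_left)
qed

lemma cube_polys_character:
  assumes "S \<subseteq> {..<m}" "card S \<le> D"
  shows "character S \<in> cube_polys m D"
  unfolding cube_polys_def
  using assms by (intro CollectI exI[of _ "\<lambda>S'. if S' = S then 1 else 0"])
    (auto simp: if_distrib[of "\<lambda>x. x * _"] sum.delta cong: if_cong)

lemma cube_polys_const: "(\<lambda>T. a) \<in> cube_polys m D"
  using cube_polys_scale[OF cube_polys_character[of "{}" m D], of a] by simp

lemma cube_polys_sum:
  assumes "\<And>i. i \<in> A \<Longrightarrow> f i \<in> cube_polys m D"
  shows "(\<lambda>T. \<Sum>i\<in>A. f i T) \<in> cube_polys m D"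
  using assms
  by (induction A rule: infinite_finite_induct) (auto intro: cube_polys_const cube_polys_add)

lemma cube_polys_cong:
  "f \<in> cube_polys m D \<Longrightarrow> (\<And>T. T \<subseteq> {..<m} \<Longrightarrow> f T = g T) \<Longrightarrow> g \<in> cube_polys m D"
  unfolding cube_polys_def by auto

lemma cube_polys_mono:
  assumes "f \<in> cube_polys m D" "D \<le> D'"
  shows "f \<in> cube_polys m D'"
proof -
  from assms(1) obtain c where
    c: "\<And>T. T \<subseteq> {..<m} \<Longrightarrow> f T = (\<Sum>S | S \<subseteq> {..<m} \<and> card S \<le> D. c S * character S T)"
    unfolding cube_polys_def by blast
  have "(\<lambda>T. \<Sum>S | S \<subseteq> {..<m} \<and> card S \<le> D. c S * character S T) \<in> cube_polys m D'"
    using assms(2) by (intro cube_polys_sum cube_polys_scale cube_polys_character) auto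
  then show ?thesis by (rule cube_polys_cong) (simp add: c)
qed

lemma card_sym_diff_le:
  assumes "finite S" "finite S'"
  shows "card (sym_diff S S') \<le> card S + card S'"
  using assms by (meson card_Un_le card_mono Diff_subset add_mono le_trans)

lemma cube_polys_mult:
  assumes "f \<in> cube_polys m D" "g \<in> cube_polys m D'"
  shows "(\<lambda>T. f T * g T) \<in> cube_polys m (D + D')"
proof -
  from assms obtain c c' where
    c: "\<And>T. T \<subseteq> {..<m} \<Longrightarrow> f T = (\<Sum>S | S \<subseteq> {..<m} \<and> card S \<le> D. c S * character S T)" and
    c': "\<And>T. T \<subseteq> {..<m} \<Longrightarrow> g T = (\<Sum>S | S \<subseteq> {..<m} \<and> card S \<le> D'. c' S * character S T)"
    unfolding cube_polys_def by blast
  have "(\<lambda>T. \<Sum>S | S \<subseteq> {..<m} \<and> card S \<le> D. \<Sum>S' | S' \<subseteq> {..<m} \<and> card S' \<le> D'.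
      (c S * c' S') * character (sym_diff S S') T) \<in> cube_polys m (D + D')"
  proof (intro cube_polys_sum cube_polys_scale cube_polys_character)
    fix S S' assume "S \<in> {S. S \<subseteq> {..<m} \<and> card S \<le> D}" "S' \<in> {S'. S' \<subseteq> {..<m} \<and> card S' \<le> D'}"
    then show "sym_diff S S' \<subseteq> {..<m}" "card (sym_diff S S') \<le> D + D'"
      using card_sym_diff_le[of S S'] finite_subset[of _ "{..<m}"] by auto
  qed
  then show ?thesis
  proof (rule cube_polys_cong)
    fix T assume T: "T \<subseteq> {..<m}"
    show "(\<Sum>S | S \<subseteq> {..<m} \<and> card S \<le> D. \<Sum>S' | S' \<subseteq> {..<m} \<and> card S' \<le> D'.
      (c S * c' S') * character (sym_diff S S') T) = f T * g T"
      unfolding c[OF T] c'[OF T] sum_product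
    proof (intro sum.cong refl)
      fix S S' assume "S \<in> {S. S \<subseteq> {..<m} \<and> card S \<le> D}" "S' \<in> {S'. S' \<subseteq> {..<m} \<and> card S' \<le> D'}"
      then have "finite S" "finite S'" using finite_subset[of _ "{..<m}"] by auto
      from character_mult[OF this, of T]
      show "(c S * c' S') * character (sym_diff S S') T = c S * character S T * (c' S' * character S' T)"
        by (metis mult.assoc mult.left_commute)
    qed
  qed
qed

lemma cube_polys_power:
  "f \<in> cube_polys m D \<Longrightarrow> (\<lambda>T. f T ^ k) \<in> cube_polys m (k * D)"
  by (induction k) (auto intro: cube_polys_const cube_polys_mult)

lemma cube_polys_prod:
  assumes "finite A" "\<And>i. i \<in> A \<Longrightarrow> f i \<in> cube_polys m (D i)"
  shows "(\<lambda>T. \<Prod>i\<in>A. f i T) \<in> cube_polys m (\<Sum>i\<in>A. D i)"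
  using assms by (induction A rule: finite_induct) (auto intro: cube_polys_const cube_polys_mult)

definition sign_sum :: "nat \<Rightarrow> nat set \<Rightarrow> real" where
  "sign_sum m T = (\<Sum>i<m. character {i} T)"

text \<open>Multiplying by the sign of \<open>i\<close> toggles the membership of \<open>i\<close>
  in \<open>S\<close>. So the sign sum acts on characters as the down operator plus the up operator
  of the Boolean lattice.\<close>

lemma sign_sum_character:
  assumes "S \<subseteq> {..<m}" "T \<subseteq> {..<m}"
  shows "sign_sum m T * character S T =
    (\<Sum>i\<in>S. character (S - {i}) T) + (\<Sum>i\<in>{..<m} - S. character (insert i S) T)"
proof -
  have fin: "finite S" using assms finite_subset by blast
  have "sign_sum m T * character S T = (\<Sum>i<m. character (sym_diff {i} S) T)"
    unfolding sign_sum_def sum_distrib_right using fin by (simp add: character_mult)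
  also have "\<dots> = (\<Sum>i\<in>S. character (sym_diff {i} S) T) + (\<Sum>i\<in>{..<m} - S. character (sym_diff {i} S) T)"
    using assms(1) by (simp add: sum.subset_diff add.commute)
  also have "(\<Sum>i\<in>S. character (sym_diff {i} S) T) = (\<Sum>i\<in>S. character (S - {i}) T)"
    by (intro sum.cong refl arg_cong2[of _ _ _ _ character]) auto
  also have "(\<Sum>i\<in>{..<m} - S. character (sym_diff {i} S) T) = (\<Sum>i\<in>{..<m} - S. character (insert i S) T)"
    by (intro sum.cong refl arg_cong2[of _ _ _ _ character]) auto
  finally show ?thesis .
qed

text \<open>By linearity \<open>f\<close> may be taken to be a character. The moments depend only on
  the size, so its product with the sign sum has exactly the expectation that the recurrence makes
  vanish; \<open>D < m\<close> keeps \<open>S\<close> below the full set.\<close>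

lemma knapsack_constraint:
  assumes "odd m" "f \<in> cube_polys m D" "D < m"
  shows "knapsack_expectation m (\<lambda>T. sign_sum m T * f T) = 0"
proof -
  from assms(2) obtain c where
    c: "\<And>T. T \<subseteq> {..<m} \<Longrightarrow> f T = (\<Sum>S | S \<subseteq> {..<m} \<and> card S \<le> D. c S * character S T)"
    unfolding cube_polys_def by blast
  have "knapsack_expectation m (\<lambda>T. sign_sum m T * f T) =
    knapsack_expectation m (\<lambda>T. \<Sum>S | S \<subseteq> {..<m} \<and> card S \<le> D. c S * (sign_sum m T * character S T))"
    by (intro knapsack_expectation_cong) (simp add: c sum_distrib_left mult_ac)
  also have "\<dots> = (\<Sum>S | S \<subseteq> {..<m} \<and> card S \<le> D. c S * knapsack_expectation m (\<lambda>T. sign_sum m T * character S T))"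
    by (simp add: knapsack_expectation_sum knapsack_expectation_scale)
  also have "\<dots> = 0"
  proof (intro sum.neutral ballI)
    fix S assume "S \<in> {S. S \<subseteq> {..<m} \<and> card S \<le> D}"
    then have S: "S \<subseteq> {..<m}" "card S \<le> D" "finite S" using finite_subset[of _ "{..<m}"] by auto
    have "knapsack_expectation m (\<lambda>T. sign_sum m T * character S T) =
      knapsack_expectation m (\<lambda>T. (\<Sum>i\<in>S. character (S - {i}) T) + (\<Sum>i\<in>{..<m} - S. character (insert i S) T))"
      using S by (intro knapsack_expectation_cong) (simp add: sign_sum_character)
    also have "\<dots> = (\<Sum>i\<in>S. knapsack_expectation m (character (S - {i})))
      + (\<Sum>i\<in>{..<m} - S. knapsack_expectation m (character (insert i S)))"
      by (simp add: knapsack_expectation_add knapsack_expectation_sum)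
    also have "(\<Sum>i\<in>S. knapsack_expectation m (character (S - {i}))) =
        (\<Sum>i\<in>S. knapsack_moment m (card S - 1))"
      using S by (intro sum.cong refl) (subst knapsack_expectation_character, auto)
    also have "(\<Sum>i\<in>{..<m} - S. knapsack_expectation m (character (insert i S))) =
        (\<Sum>i\<in>{..<m} - S. knapsack_moment m (Suc (card S)))"
      using S by (intro sum.cong refl) (subst knapsack_expectation_character, auto)
    also have "(\<Sum>i\<in>S. knapsack_moment m (card S - 1)) + (\<Sum>i\<in>{..<m} - S. knapsack_moment m (Suc (card S)))
      = real (card S) * knapsack_moment m (card S - 1) + real (m - card S) * knapsack_moment m (Suc (card S))"
      using S by (simp add: card_Diff_subset)
    \<comment> \<open>The recurrence starts at size 1. For empty \<open>S\<close> only the moment of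
      a single sign remains, and it is 0.\<close>
    also have "\<dots> = 0"
    proof (cases "card S = 0")
      case False
      then show ?thesis using knapsack_moment_recurrence[of m "card S"] assms S(2) by simp
    qed (use knapsack_moment_odd[of 1 m] in simp)
    finally show "c S * knapsack_expectation m (\<lambda>T. sign_sum m T * character S T) = 0" by simp
  qed
  finally show ?thesis .
qed

section \<open>Levels of the Boolean lattice and positivity on harmonic functions\<close>

definition level :: "nat \<Rightarrow> nat \<Rightarrow> nat set set" where
  "level m j = {T. T \<subseteq> {..<m} \<and> card T = j}"

lemma finite_level [simp]: "finite (level m j)"
  by (simp add: level_def)

lemma level_finite_member: "T \<in> level m j \<Longrightarrow> finite T"
  by (auto simp: level_def intro: finite_subset)

lemma levelD: "T \<in> level m j \<Longrightarrow> finite T \<and> T \<subseteq> {..<m} \<and> card T = j"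
  using level_finite_member[of T m j] by (simp add: level_def)

definition level_sum :: "nat \<Rightarrow> nat \<Rightarrow> (nat set \<Rightarrow> real) \<Rightarrow> nat set \<Rightarrow> real" where
  "level_sum m j h X = (\<Sum>T\<in>level m j. h T * character T X)"

lemma level_sum_cube_polys: "level_sum m j h \<in> cube_polys m j"
  unfolding level_sum_def level_def
  by (intro cube_polys_sum cube_polys_scale cube_polys_character) auto

text \<open>Written with the 0/1 inclusion matrix between two levels, harmonicity becomes
  orthogonality to the rows of that matrix, which a projection can achieve.\<close>

lemma sum_insert_supersets:
  assumes "R \<in> level m j"
  shows "(\<Sum>i\<in>{..<m} - R. G (insert i R)) = (\<Sum>T\<in>level m (Suc j). G T * (if R \<subseteq> T then 1 else 0 :: real))"
proof -
  have R: "R \<subseteq> {..<m}" "card R = j" "finite R" using levelD[OF assms] by auto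
  have eq: "{T \<in> level m (Suc j). R \<subseteq> T} = (\<lambda>i. insert i R) ` ({..<m} - R)"
  proof (intro equalityI subsetI)
    fix T assume "T \<in> {T \<in> level m (Suc j). R \<subseteq> T}"
    then have T: "T \<subseteq> {..<m}" "card T = Suc j" "R \<subseteq> T" by (auto simp: level_def)
    have "card (T - R) = 1" using T R by (simp add: card_Diff_subset)
    then obtain i where "T - R = {i}" by (rule card_1_singletonE)
    then have "T = insert i R" "i \<in> {..<m} - R" using T by blast+
    then show "T \<in> (\<lambda>i. insert i R) ` ({..<m} - R)" by blast
  next
    fix T assume "T \<in> (\<lambda>i. insert i R) ` ({..<m} - R)"
    then obtain i where "T = insert i R" "i < m" "i \<notin> R" by blast
    then show "T \<in> {T \<in> level m (Suc j). R \<subseteq> T}" using R by (simp add: level_def subset_insertI)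
  qed
  have inj: "inj_on (\<lambda>i. insert i R) ({..<m} - R)"
  proof (rule inj_onI)
    fix i i' assume *: "i \<in> {..<m} - R" "insert i R = insert i' R"
    then have "i \<in> insert i' R" by (metis insertI1)
    then show "i = i'" using *(1) by blast
  qed
  have "(\<Sum>T\<in>level m (Suc j). G T * (if R \<subseteq> T then 1 else 0)) = (\<Sum>T | T \<in> level m (Suc j) \<and> R \<subseteq> T. G T)"
    by (simp add: sum.inter_filter if_distrib cong: if_cong)
  also have "\<dots> = (\<Sum>i\<in>{..<m} - R. G (insert i R))"
    unfolding eq by (simp add: sum.reindex[OF inj])
  finally show ?thesis by simp
qed

text \<open>On level \<open>j\<close> this is the kernel of the down operator; for
  \<open>2 * j \<le> m\<close> it is the irreducible module of the symmetric group that is new at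
  this level. Writing \<open>Suc (card R) = j\<close> makes the condition vacuous for
  \<open>j = 0\<close>.\<close>

definition harmonic :: "nat \<Rightarrow> nat \<Rightarrow> (nat set \<Rightarrow> real) \<Rightarrow> bool" where
  "harmonic m j h \<longleftrightarrow> (\<forall>R\<subseteq>{..<m}. Suc (card R) = j \<longrightarrow> (\<Sum>i\<in>{..<m} - R. h (insert i R)) = 0)"

definition overlap_sum :: "nat \<Rightarrow> nat \<Rightarrow> (nat set \<Rightarrow> real) \<Rightarrow> nat set \<Rightarrow> nat \<Rightarrow> real" where
  "overlap_sum m j h S t = (\<Sum>T | T \<in> level m j \<and> card (T \<inter> S) = t. h T)"

text \<open>Sum the harmonicity relations over all \<open>R\<close> of size \<open>j - 1\<close> that meet \<open>S\<close> in \<open>t\<close> points.\<close>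

lemma overlap_sum_recurrence:
  assumes "harmonic m j h" "t < j"
  shows "real (Suc t) * overlap_sum m j h S (Suc t) + real (j - t) * overlap_sum m j h S t = 0"
proof -
  let ?P = "SIGMA R:{R \<in> level m (j - 1). card (R \<inter> S) = t}. {..<m} - R"
  let ?Q = "SIGMA T:level m j. {i \<in> T. card ((T - {i}) \<inter> S) = t}"
  have "0 = (\<Sum>R\<in>{R \<in> level m (j - 1). card (R \<inter> S) = t}. \<Sum>i\<in>{..<m} - R. h (insert i R))"
    using assms by (intro sum.neutral[symmetric]) (auto simp: harmonic_def level_def)
  also have "\<dots> = (\<Sum>(R, i)\<in>?P. h (insert i R))"
    by (subst sum.Sigma) auto
  \<comment> \<open>Double counting with \<open>T = insert i R\<close>. For fixed \<open>T\<close>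
    the removable points are those of \<open>T \<inter> S\<close> if the overlap is
    \<open>Suc t\<close>, and those of \<open>T - S\<close> if it is \<open>t\<close>.\<close>
  also have "\<dots> = (\<Sum>(T, i)\<in>?Q. h T)"
  proof (rule sum.reindex_bij_witness[of _ "\<lambda>(T, i). (T - {i}, i)" "\<lambda>(R, i). (insert i R, i)"])
    fix a assume "a \<in> ?P"
    then obtain R i where a: "a = (R, i)" "R \<subseteq> {..<m}" "card R = j - 1" "card (R \<inter> S) = t" "i < m" "i \<notin> R"
      by (auto simp: level_def)
    then have "finite R" using finite_subset by blast
    moreover have "insert i R - {i} = R" using a(6) by blast
    ultimately show "(\<lambda>(T, i). (T - {i}, i)) ((\<lambda>(R, i). (insert i R, i)) a) = a"
      and "(\<lambda>(R, i). (insert i R, i)) a \<in> ?Q"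
      and "(case (\<lambda>(R, i). (insert i R, i)) a of (T, i) \<Rightarrow> h T) = (case a of (R, i) \<Rightarrow> h (insert i R))"
      using a assms(2) by (simp_all add: level_def)
  next
    fix b assume "b \<in> ?Q"
    then obtain T i where b: "b = (T, i)" "T \<subseteq> {..<m}" "card T = j" "card ((T - {i}) \<inter> S) = t" "i \<in> T"
      by (auto simp: level_def)
    then have "finite T" "insert i T = T" using finite_subset by blast+
    then show "(\<lambda>(R, i). (insert i R, i)) ((\<lambda>(T, i). (T - {i}, i)) b) = b"
      and "(\<lambda>(T, i). (T - {i}, i)) b \<in> ?P"
      using b by (auto simp: level_def)
  qed
  also have "\<dots> = (\<Sum>T\<in>level m j. \<Sum>i | i \<in> T \<and> card ((T - {i}) \<inter> S) = t. h T)"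
    by (subst sum.Sigma) (auto intro: rev_finite_subset[OF level_finite_member])
  also have "\<dots> = (\<Sum>T\<in>level m j. (if card (T \<inter> S) = Suc t then real (Suc t) * h T else 0)
      + (if card (T \<inter> S) = t then real (j - t) * h T else 0))"
  proof (intro sum.cong refl)
    fix T assume "T \<in> level m j"
    then have T: "finite T" "card T = j" by (auto dest: levelD)
    have c1: "card ((T - {i}) \<inter> S) = card (T \<inter> S) - 1 \<and> card (T \<inter> S) > 0" if "i \<in> T \<inter> S" for i
    proof -
      have "(T - {i}) \<inter> S = (T \<inter> S) - {i}" by blast
      then show ?thesis using that T by (auto simp: card_gt_0_iff)
    qed
    have c2: "card ((T - {i}) \<inter> S) = card (T \<inter> S)" if "i \<in> T - S" for i
    proof -
      have "(T - {i}) \<inter> S = T \<inter> S" using that by blast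
      then show ?thesis by simp
    qed
    have c3: "card ((T - {i}) \<inter> S) = (if i \<in> S then card (T \<inter> S) - 1 else card (T \<inter> S))" if "i \<in> T" for i
      using c1[of i] c2[of i] that by simp
    have "{i \<in> T. card ((T - {i}) \<inter> S) = t} =
      (if card (T \<inter> S) = Suc t then T \<inter> S else if card (T \<inter> S) = t then T - S else {})" (is "_ = ?B")
    proof (rule Set.set_eqI)
      fix i
      show "i \<in> {i \<in> T. card ((T - {i}) \<inter> S) = t} \<longleftrightarrow> i \<in> ?B"
        using c3[of i] c1[of i] by (cases "i \<in> T"; cases "i \<in> S") auto
    qed
    moreover have "card (T - S) = j - card (T \<inter> S)"
      using T by (simp add: card_Diff_subset_Int)
    ultimately show "(\<Sum>i | i \<in> T \<and> card ((T - {i}) \<inter> S) = t. h T) =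
        (if card (T \<inter> S) = Suc t then real (Suc t) * h T else 0)
      + (if card (T \<inter> S) = t then real (j - t) * h T else 0)"
      by simp
  qed
  also have "\<dots> = real (Suc t) * overlap_sum m j h S (Suc t) + real (j - t) * overlap_sum m j h S t"
    unfolding overlap_sum_def sum.distrib
    by (simp add: sum.inter_filter sum_distrib_left if_distrib[of "(*) (real (Suc t))"]
        if_distrib[of "(*) (real (j - t))"] cong: if_cong del: of_nat_Suc)
  finally show ?thesis by simp
qed

text \<open>A set of size below \<open>j\<close> cannot meet any \<open>T\<close> in
  \<open>j\<close> points, and the recurrence carries this zero down from \<open>t = j\<close>
  because its coefficient \<open>j - t\<close> is positive.\<close>

lemma overlap_sum_below:
  assumes "harmonic m j h" "finite S" "card S < j" "t \<le> j"
  shows "overlap_sum m j h S t = 0"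
proof -
  have top: "overlap_sum m j h S j = 0"
  proof -
    have "card (T \<inter> S) \<noteq> j" for T
      using card_mono[OF assms(2), of "T \<inter> S"] assms(3) by auto
    then have "{T. T \<in> level m j \<and> card (T \<inter> S) = j} = {}" by auto
    then show ?thesis unfolding overlap_sum_def by (simp only: sum.empty)
  qed
  from assms(4) show ?thesis
  proof (induction t rule: inc_induct)
    case (step t)
    then show ?case using overlap_sum_recurrence[OF assms(1), of t S] by simp
  qed (rule top)
qed

text \<open>For \<open>t = j\<close> only \<open>T = S\<close> remains. Descending from there, the
  ratios of the recurrence build up the signed binomial coefficients.\<close>

lemma overlap_sum_same:
  assumes "harmonic m j h" "S \<in> level m j" "u \<le> j"
  shows "overlap_sum m j h S (j - u) = (-1) ^ u * real (j choose u) * h S"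
  using assms(3)
proof (induction u)
  case 0
  have "{T. T \<in> level m j \<and> card (T \<inter> S) = j} = {S}"
  proof -
    have "T = S" if "T \<in> level m j" "card (T \<inter> S) = j" for T
    proof -
      have "finite T" "finite S" "card T = j" "card S = j"
        using levelD[OF that(1)] levelD[OF assms(2)] by auto
      then have "T \<inter> S = T" "T \<inter> S = S"
        using card_subset_eq[of T "T \<inter> S"] card_subset_eq[of S "T \<inter> S"] that(2) by auto
      then show ?thesis by simp
    qed
    then show ?thesis using assms(2) by (auto simp: level_def)
  qed
  then show ?case unfolding overlap_sum_def by simp
next
  case (Suc u)
  have r: "real (j - u) * overlap_sum m j h S (j - u) + real (Suc u) * overlap_sum m j h S (j - Suc u) = 0"
    using overlap_sum_recurrence[OF assms(1), of "j - Suc u" S] Suc.prems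
    by (simp add: Suc_diff_Suc)
  have b: "real (Suc u) * real (j choose Suc u) = real (j - u) * real (j choose u)"
    using binomial_absorption[of u j] binomial_absorb_comp[of j u] by (metis of_nat_mult)
  have "real (Suc u) * overlap_sum m j h S (j - Suc u) = - (real (j - u) * ((-1) ^ u * real (j choose u) * h S))"
    using r Suc by simp
  also have "\<dots> = (-1) ^ Suc u * (real (j - u) * real (j choose u)) * h S" by simp
  also have "\<dots> = real (Suc u) * ((-1) ^ Suc u * real (j choose Suc u) * h S)"
    unfolding b[symmetric] by simp
  finally show ?case by (metis mult_left_cancel of_nat_Suc of_nat_neq_0)
qed

text \<open>The moment of a product of two characters depends only on the size of the symmetric
  difference, hence on the overlap, by which the sum is grouped. Overlaps above
  \<open>card S\<close> are empty sums, so the truncated subtraction does no harm.\<close>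

lemma expectation_character_level_sum:
  assumes "S \<subseteq> {..<m}"
  shows "knapsack_expectation m (\<lambda>X. character S X * level_sum m j h X) =
    (\<Sum>t\<le>j. knapsack_moment m (card S + j - 2 * t) * overlap_sum m j h S t)"
proof -
  have finS: "finite S" using assms finite_subset by blast
  have "knapsack_expectation m (\<lambda>X. character S X * level_sum m j h X) =
    knapsack_expectation m (\<lambda>X. \<Sum>T\<in>level m j. h T * character (sym_diff S T) X)"
  proof (intro knapsack_expectation_cong)
    fix X
    show "character S X * level_sum m j h X = (\<Sum>T\<in>level m j. h T * character (sym_diff S T) X)"
      unfolding level_sum_def sum_distrib_left
    proof (intro sum.cong refl)
      fix T assume "T \<in> level m j"
      then have "character S X * character T X = character (sym_diff S T) X"
        using character_mult[OF finS level_finite_member] by blast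
      then show "character S X * (h T * character T X) = h T * character (sym_diff S T) X"
        by (metis mult.left_commute)
    qed
  qed
  also have "\<dots> = (\<Sum>T\<in>level m j. h T * knapsack_moment m (card (sym_diff S T)))"
    using assms unfolding knapsack_expectation_sum knapsack_expectation_scale
    by (intro sum.cong refl) (subst knapsack_expectation_character, auto simp: level_def)
  also have "\<dots> = (\<Sum>T\<in>level m j. h T * knapsack_moment m (card S + j - 2 * card (T \<inter> S)))"
  proof (intro sum.cong refl)
    fix T assume "T \<in> level m j"
    then have T: "finite T" "card T = j" by (auto dest: levelD)
    have "card (sym_diff S T) = card (S - T) + card (T - S)"
      using T finS by (intro card_Un_disjoint) auto
    also have "\<dots> = (card S - card (T \<inter> S)) + (j - card (T \<inter> S))"
      using T finS by (simp add: card_Diff_subset_Int Int_commute)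
    also have "\<dots> = card S + j - 2 * card (T \<inter> S)"
      using card_mono[of S "T \<inter> S"] card_mono[of T "T \<inter> S"] finS T by simp
    finally show "h T * knapsack_moment m (card (sym_diff S T)) =
      h T * knapsack_moment m (card S + j - 2 * card (T \<inter> S))" by simp
  qed
  also have "\<dots> = (\<Sum>t\<in>{..j}. \<Sum>T | T \<in> level m j \<and> card (T \<inter> S) = t.
      h T * knapsack_moment m (card S + j - 2 * card (T \<inter> S)))"
  proof (rule sum.group[symmetric])
    show "(\<lambda>T. card (T \<inter> S)) ` level m j \<subseteq> {..j}"
    proof
      fix t assume "t \<in> (\<lambda>T. card (T \<inter> S)) ` level m j"
      then obtain T where T: "T \<in> level m j" "t = card (T \<inter> S)" by blast
      then show "t \<in> {..j}" using card_mono[OF level_finite_member[OF T(1)], of "T \<inter> S"]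
        by (auto simp: level_def)
    qed
  qed auto
  also have "\<dots> = (\<Sum>t\<le>j. knapsack_moment m (card S + j - 2 * t) * overlap_sum m j h S t)"
    by (simp add: overlap_sum_def sum_distrib_left mult_ac)
  finally show ?thesis .
qed

text \<open>Orthogonality here is with respect to the pseudo-expectation, not the plain inner
  product on the level: against a smaller character all overlap sums vanish.\<close>

lemma harmonic_orthogonal_below:
  assumes "harmonic m j h" "g \<in> cube_polys m D" "D < j"
  shows "knapsack_expectation m (\<lambda>X. g X * level_sum m j h X) = 0"
proof -
  from assms(2) obtain c where
    c: "\<And>T. T \<subseteq> {..<m} \<Longrightarrow> g T = (\<Sum>S | S \<subseteq> {..<m} \<and> card S \<le> D. c S * character S T)"
    unfolding cube_polys_def by blast
  have "knapsack_expectation m (\<lambda>X. g X * level_sum m j h X) =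
    knapsack_expectation m (\<lambda>X. \<Sum>S | S \<subseteq> {..<m} \<and> card S \<le> D. c S * (character S X * level_sum m j h X))"
    by (intro knapsack_expectation_cong) (simp only: c sum_distrib_right mult.assoc)
  also have "\<dots> = (\<Sum>S | S \<subseteq> {..<m} \<and> card S \<le> D.
      c S * knapsack_expectation m (\<lambda>X. character S X * level_sum m j h X))"
    by (simp add: knapsack_expectation_sum knapsack_expectation_scale)
  also have "\<dots> = 0"
  proof (intro sum.neutral ballI)
    fix S assume "S \<in> {S. S \<subseteq> {..<m} \<and> card S \<le> D}"
    then have S: "S \<subseteq> {..<m}" "card S < j" "finite S"
      using assms(3) finite_subset[of _ "{..<m}"] by auto
    show "c S * knapsack_expectation m (\<lambda>X. character S X * level_sum m j h X) = 0"
      using overlap_sum_below[OF assms(1) S(3,2)] by (simp add: expectation_character_level_sum[OF S(1)])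
  qed
  finally show ?thesis .
qed

text \<open>An explicit Schur lemma: the overlap sums with \<open>S\<close> are multiples of
  \<open>h S\<close>, so the moment form acts on harmonic functions as the scalar \<open>l\<close>.
  In \<open>l\<close> the sign of each overlap sum meets the alternating sign of the moments, and
  every term is at least 0.\<close>

lemma harmonic_square_nonneg:
  assumes "harmonic m j h"
  shows "knapsack_expectation m (\<lambda>X. (level_sum m j h X)\<^sup>2) \<ge> 0"
proof -
  define l where "l = (\<Sum>u\<le>j. real (j choose u) * ((-1) ^ u * knapsack_moment m (2 * u)))"
  have l: "l \<ge> 0" unfolding l_def by (intro sum_nonneg mult_nonneg_nonneg knapsack_moment_even) auto
  have "knapsack_expectation m (\<lambda>X. (level_sum m j h X)\<^sup>2) =
    knapsack_expectation m (\<lambda>X. \<Sum>S\<in>level m j. h S * (character S X * level_sum m j h X))"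
    by (intro knapsack_expectation_cong)
      (simp add: power2_eq_square level_sum_def[of m j h] sum_distrib_right mult_ac)
  also have "\<dots> = (\<Sum>S\<in>level m j. h S * knapsack_expectation m (\<lambda>X. character S X * level_sum m j h X))"
    by (simp add: knapsack_expectation_sum knapsack_expectation_scale)
  also have "\<dots> = (\<Sum>S\<in>level m j. l * (h S)\<^sup>2)"
  proof (intro sum.cong refl)
    fix S assume S: "S \<in> level m j"
    then have S': "S \<subseteq> {..<m}" "card S = j" by (auto simp: level_def)
    have "knapsack_expectation m (\<lambda>X. character S X * level_sum m j h X) =
      (\<Sum>t\<le>j. knapsack_moment m (j + j - 2 * t) * overlap_sum m j h S t)"
      using expectation_character_level_sum[OF S'(1)] S'(2) by simp
    also have "\<dots> = (\<Sum>u\<le>j. knapsack_moment m (j + j - 2 * (j - u)) * overlap_sum m j h S (j - u))"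
      by (rule sum.reindex_bij_witness[of _ "\<lambda>u. j - u" "\<lambda>u. j - u"]) auto
    also have "\<dots> = (\<Sum>u\<le>j. real (j choose u) * ((-1) ^ u * knapsack_moment m (2 * u)) * h S)"
    proof (intro sum.cong refl)
      fix u assume "u \<in> {..j}"
      then have u: "u \<le> j" by simp
      then have "j + j - 2 * (j - u) = 2 * u" by simp
      then show "knapsack_moment m (j + j - 2 * (j - u)) * overlap_sum m j h S (j - u) =
        real (j choose u) * ((-1) ^ u * knapsack_moment m (2 * u)) * h S"
        using overlap_sum_same[OF assms S u] by simp
    qed
    also have "\<dots> = l * h S" by (simp add: l_def sum_distrib_right)
    finally show "h S * knapsack_expectation m (\<lambda>X. character S X * level_sum m j h X) = l * (h S)\<^sup>2"
      by (simp add: power2_eq_square)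
  qed
  also have "\<dots> \<ge> 0" using l by (intro sum_nonneg mult_nonneg_nonneg) auto
  finally show ?thesis .
qed

text \<open>The top level of \<open>f\<close> is projected away from the image of the inclusion
  matrix, which leaves a harmonic residual. The projected part is the up part of the sign sum times
  a level-\<open>D\<close> function; trading it for the whole product costs only the down part
  \<open>drop\<close>, of lower degree.\<close>

lemma cube_polys_decomposition:
  assumes "f \<in> cube_polys m (Suc D)"
  obtains h g \<phi> where "harmonic m (Suc D) h" "g \<in> cube_polys m D" "\<phi> \<in> cube_polys m D"
    "\<And>X. X \<subseteq> {..<m} \<Longrightarrow> f X = level_sum m (Suc D) h X + g X + sign_sum m X * \<phi> X"
proof -
  from assms obtain c where
    c: "\<And>X. X \<subseteq> {..<m} \<Longrightarrow> f X = (\<Sum>S | S \<subseteq> {..<m} \<and> card S \<le> Suc D. c S * character S X)"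
    unfolding cube_polys_def by blast
  define v where "v R T = (if R \<subseteq> T then 1 else 0 :: real)" for R T :: "nat set"
  obtain \<psi> where \<psi>: "\<And>R. R \<in> level m D \<Longrightarrow>
      (\<Sum>T\<in>level m (Suc D). (c T - (\<Sum>R'\<in>level m D. \<psi> R' * v R' T)) * v R T) = 0"
    using orthogonal_residual_exists[of "level m D" "level m (Suc D)" c v] by auto
  define h where "h T = c T - (\<Sum>R'\<in>level m D. \<psi> R' * v R' T)" for T
  define low where "low X = (\<Sum>S | S \<subseteq> {..<m} \<and> card S \<le> D. c S * character S X)" for X
  define drop where "drop X = (\<Sum>R\<in>level m D. \<psi> R * (\<Sum>i\<in>R. character (R - {i}) X))" for X
  have harm: "harmonic m (Suc D) h"
    unfolding harmonic_def
    using sum_insert_supersets[of _ m D h] \<psi> by (simp add: level_def v_def h_def)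
  have low: "low \<in> cube_polys m D"
    unfolding low_def by (intro cube_polys_sum cube_polys_scale cube_polys_character) auto
  have drop: "drop \<in> cube_polys m D"
    unfolding drop_def
    by (intro cube_polys_sum cube_polys_scale cube_polys_character) (auto simp: level_def card_Diff_subset)
  have "f X = level_sum m (Suc D) h X + (low X + (-1) * drop X) + sign_sum m X * level_sum m D \<psi> X"
    if X: "X \<subseteq> {..<m}" for X
  proof -
    have sp: "{S. S \<subseteq> {..<m} \<and> card S \<le> Suc D} = {S. S \<subseteq> {..<m} \<and> card S \<le> D} \<union> level m (Suc D)"
      by (auto simp: level_def)
    have f: "f X = low X + level_sum m (Suc D) c X"
      unfolding c[OF X] sp low_def level_sum_def
      by (rule sum.union_disjoint) (auto simp: level_def)
    have "sign_sum m X * level_sum m D \<psi> X = (\<Sum>R\<in>level m D. \<psi> R * (sign_sum m X * character R X))"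
      by (simp add: level_sum_def sum_distrib_left mult_ac)
    also have "\<dots> = (\<Sum>R\<in>level m D. \<psi> R * (\<Sum>i\<in>R. character (R - {i}) X)
        + \<psi> R * (\<Sum>T\<in>level m (Suc D). character T X * v R T))"
    proof (intro sum.cong refl)
      fix R assume R: "R \<in> level m D"
      then have "R \<subseteq> {..<m}" by (simp add: level_def)
      from sign_sum_character[OF this X]
      show "\<psi> R * (sign_sum m X * character R X) = \<psi> R * (\<Sum>i\<in>R. character (R - {i}) X)
        + \<psi> R * (\<Sum>T\<in>level m (Suc D). character T X * v R T)"
        using sum_insert_supersets[OF R, of "\<lambda>T. character T X"] by (simp add: v_def distrib_left)
    qed
    also have "\<dots> = drop X + (\<Sum>R\<in>level m D. \<Sum>T\<in>level m (Suc D). \<psi> R * v R T * character T X)"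
      unfolding sum.distrib drop_def by (simp add: sum_distrib_left mult_ac)
    also have "\<dots> = drop X + (\<Sum>T\<in>level m (Suc D). (\<Sum>R\<in>level m D. \<psi> R * v R T) * character T X)"
      by (subst sum.swap) (simp add: sum_distrib_right)
    finally have s: "sign_sum m X * level_sum m D \<psi> X = \<dots>" .
    have "level_sum m (Suc D) h X = level_sum m (Suc D) c X
      - (\<Sum>T\<in>level m (Suc D). (\<Sum>R\<in>level m D. \<psi> R * v R T) * character T X)"
      by (simp add: level_sum_def h_def left_diff_distrib sum_subtractf)
    then show ?thesis using f s by simp
  qed
  then show thesis
    using harm cube_polys_add[OF low cube_polys_scale[OF drop, of "-1"]] level_sum_cube_polys[of m D \<psi>]
    by (intro that) auto
qed

lemma sign_sum_cube_polys: "sign_sum m \<in> cube_polys m 1"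
proof -
  have "(\<lambda>T. \<Sum>i<m. character {i} T) \<in> cube_polys m 1"
    by (intro cube_polys_sum cube_polys_character) auto
  then show ?thesis by (simp add: sign_sum_def[abs_def])
qed

text \<open>Modulo the sign sum, \<open>f\<close> is harmonic plus lower degree. The cross term
  vanishes, the harmonic square is nonnegative, and induction handles the rest. With degree
  \<open>Suc D\<close> for \<open>f\<close>, the cofactor of the sign sum has degree at most
  \<open>2 * D + 1\<close>, below \<open>m\<close>.\<close>

theorem knapsack_square_nonneg:
  assumes "odd m" "f \<in> cube_polys m D" "2 * D < m"
  shows "knapsack_expectation m (\<lambda>X. (f X)\<^sup>2) \<ge> 0"
  using assms(2,3)
proof (induction D arbitrary: f)
  case 0
  from 0(1) obtain c where
    c: "\<And>T. T \<subseteq> {..<m} \<Longrightarrow> f T = (\<Sum>S | S \<subseteq> {..<m} \<and> card S \<le> 0. c S * character S T)"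
    unfolding cube_polys_def by blast
  have "{S. S \<subseteq> {..<m} \<and> card S \<le> 0} = {{}}" by (auto dest: finite_subset)
  then have "f T = c {}" if "T \<subseteq> {..<m}" for T using c[OF that] by simp
  then have "knapsack_expectation m (\<lambda>X. (f X)\<^sup>2) = knapsack_expectation m (\<lambda>X. (c {})\<^sup>2 * character {} X)"
    by (intro knapsack_expectation_cong) simp
  also have "\<dots> = (c {})\<^sup>2"
    by (simp only: knapsack_expectation_scale) (simp add: knapsack_expectation_character del: character_empty)
  finally show ?case by simp
next
  case (Suc D)
  obtain h g \<phi> where h: "harmonic m (Suc D) h" and g: "g \<in> cube_polys m D" and \<phi>: "\<phi> \<in> cube_polys m D"
    and f: "\<And>X. X \<subseteq> {..<m} \<Longrightarrow> f X = level_sum m (Suc D) h X + g X + sign_sum m X * \<phi> X"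
    using cube_polys_decomposition[OF Suc.prems(1)] by blast
  let ?F = "level_sum m (Suc D) h"
  \<comment> \<open>The cofactor in the difference of squares of \<open>f\<close> and
    \<open>?F + g\<close>, so that the difference is the sign sum times
    \<open>\<phi> * r\<close>.\<close>
  define r where "r X = 2 * ?F X + 2 * g X + sign_sum m X * \<phi> X" for X
  have "r \<in> cube_polys m (Suc D)"
    unfolding r_def[abs_def]
    using cube_polys_mult[OF sign_sum_cube_polys \<phi>] cube_polys_mono[OF g, of "Suc D"]
    by (intro cube_polys_add cube_polys_scale level_sum_cube_polys) auto
  from knapsack_constraint[OF assms(1) cube_polys_mult[OF \<phi> this]] Suc.prems(2)
  have 0: "knapsack_expectation m (\<lambda>X. sign_sum m X * (\<phi> X * r X)) = 0" by simp
  have "knapsack_expectation m (\<lambda>X. (f X)\<^sup>2) =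
    knapsack_expectation m (\<lambda>X. ((?F X)\<^sup>2 + (g X)\<^sup>2) + (2 * (g X * ?F X) + sign_sum m X * (\<phi> X * r X)))"
    by (intro knapsack_expectation_cong) (simp add: f r_def power2_eq_square algebra_simps)
  also have "\<dots> = knapsack_expectation m (\<lambda>X. (?F X)\<^sup>2) + knapsack_expectation m (\<lambda>X. (g X)\<^sup>2)"
    using 0 harmonic_orthogonal_below[OF h g]
    by (simp add: knapsack_expectation_add knapsack_expectation_scale)
  also have "\<dots> \<ge> 0"
    using harmonic_square_nonneg[OF h] Suc.IH[OF g] Suc.prems(2) by simp
  finally show ?case .
qed

section \<open>Approximate equilibria of the block game\<close>

text \<open>Tripled, the values are 3, -3 and -1. An odd number of odd integers has an odd sum,
  which is at least 1 in absolute value.\<close>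

lemma odd_third_sum:
  fixes \<sigma> :: "nat \<Rightarrow> real"
  assumes "odd m" "\<And>i. i < m \<Longrightarrow> \<sigma> i \<in> {1, -1, -1/3}"
  shows "\<bar>\<Sum>i<m. \<sigma> i\<bar> \<ge> 1/3"
proof -
  have "\<forall>i\<in>{..<m}. \<exists>k::int. odd k \<and> 3 * \<sigma> i = of_int k"
  proof
    fix i assume "i \<in> {..<m}"
    with assms(2)[of i] consider "\<sigma> i = 1" | "\<sigma> i = -1" | "\<sigma> i = -1/3" by auto
    then show "\<exists>k::int. odd k \<and> 3 * \<sigma> i = of_int k"
    proof cases
      case 1 then show ?thesis by (intro exI[of _ 3]) auto
    next
      case 2 then show ?thesis by (intro exI[of _ "-3"]) auto
    next
      case 3 then show ?thesis by (intro exI[of _ "-1"]) auto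
    qed
  qed
  then obtain k :: "nat \<Rightarrow> int" where k: "\<And>i. i < m \<Longrightarrow> odd (k i)" "\<And>i. i < m \<Longrightarrow> 3 * \<sigma> i = of_int (k i)"
    by (metis lessThan_iff)
  have par: "\<lbrakk>\<And>i. i < j \<Longrightarrow> odd (k i)\<rbrakk> \<Longrightarrow> odd (\<Sum>i<j. k i) = odd j" for j
    by (induction j) auto
  have "odd (\<Sum>i<m. k i)" using par[of m] k(1) assms(1) by auto
  then have "\<bar>\<Sum>i<m. k i\<bar> \<ge> 1" by presburger
  then have "\<bar>of_int (\<Sum>i<m. k i) :: real\<bar> \<ge> 1" by linarith
  moreover have "of_int (\<Sum>i<m. k i) = 3 * (\<Sum>i<m. \<sigma> i)"
    using k(2) by (simp add: sum_distrib_left)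
  ultimately show ?thesis by simp
qed

text \<open>Either the row player is nearly indifferent, which puts the column player near the mixed
  state, or one row strategy is clearly worse and carries almost no mass. Since the block has mass
  at least \<open>1 / (2 * M)\<close>, the other row strategy dominates and forces the column player
  to a pure state.\<close>

lemma block_state:
  fixes xp xm yp ym M e :: real
  assumes nn: "xp \<ge> 0" "xm \<ge> 0" "yp \<ge> 0" "ym \<ge> 0" and M: "M \<ge> 1"
    and X: "1 / (2 * M) \<le> xp + xm"
    and e: "e \<le> 2 / (100000 * M ^ 3)"
    and br: "xm * (2 * yp - ym) \<le> e" "xp * (ym - 2 * yp) \<le> e"
            "ym * (2 * xp - xm) \<le> e" "yp * (xm - 2 * xp) \<le> e"
  shows "\<exists>\<sigma>\<in>{1, -1, -1/3}. \<bar>yp - ym - \<sigma> * (yp + ym)\<bar> \<le> 1 / (100 * M\<^sup>2)"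
proof -
  \<comment> \<open>The bound assumed on \<open>e\<close> is the product of the two thresholds used
    here.\<close>
  have small: "a \<le> 1 / (500 * M)" if "a \<ge> 0" "a * b \<le> e" "b > 1 / (100 * M\<^sup>2)" for a b
  proof (rule ccontr)
    assume "\<not> ?thesis"
    then have a: "a > 1 / (500 * M)" by simp
    moreover have "0 < 1 / (500 * M)" "0 < 1 / (100 * M\<^sup>2)" using M by auto
    ultimately have "(1 / (500 * M)) * (1 / (100 * M\<^sup>2)) < a * b"
      using that(3) by (intro mult_strict_mono) linarith+
    moreover have "(1 / (500 * M)) * (1 / (100 * M\<^sup>2)) = 2 / (100000 * M ^ 3)"
      by (simp add: power2_eq_square power3_eq_cube)
    ultimately show False using that e by linarith
  qed
  have tiny: "2 * a \<le> 1 / (100 * M\<^sup>2)" if "a \<ge> 0" "a * b \<le> e" "b \<ge> 1 / (4 * M)" for a b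
  proof (rule ccontr)
    assume "\<not> ?thesis"
    then have a: "a > 1 / (200 * M\<^sup>2)" by simp
    have "(1 / (200 * M\<^sup>2)) * (1 / (4 * M)) \<le> a * b"
      using that M a by (intro mult_mono) auto
    moreover have "(1 / (200 * M\<^sup>2)) * (1 / (4 * M)) = 1 / (800 * M ^ 3)"
      by (simp add: power2_eq_square power3_eq_cube)
    moreover have "2 / (100000 * M ^ 3) < 1 / (800 * M ^ 3)" using M by (simp add: field_simps)
    ultimately show False using that e by linarith
  qed
  have M4: "1 / (2 * M) - 3 / (500 * M) \<ge> 1 / (4 * M)"
    using M by (simp add: field_simps)
  consider "\<bar>2 * yp - ym\<bar> \<le> 1 / (100 * M\<^sup>2)" | "2 * yp - ym > 1 / (100 * M\<^sup>2)" | "ym - 2 * yp > 1 / (100 * M\<^sup>2)"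
    by linarith
  then show ?thesis
  proof cases
    case 1
    have eq: "yp - ym - (-1/3) * (yp + ym) = 2 / 3 * (2 * yp - ym)" by (simp add: field_simps)
    have gen: "2 / 3 * a \<le> c" if "0 \<le> a" "a \<le> c" for a c :: real using that by simp
    have "\<bar>2 / 3 * (2 * yp - ym)\<bar> = 2 / 3 * \<bar>2 * yp - ym\<bar>" by (subst abs_mult) simp
    with gen[OF abs_ge_zero 1] have "\<bar>yp - ym - (-1/3) * (yp + ym)\<bar> \<le> 1 / (100 * M\<^sup>2)"
      by (simp only: eq)
    then show ?thesis by (intro bexI[of _ "-1/3"]) auto
  next
    case 2
    have "xm \<le> 1 / (500 * M)" using small[OF nn(2) br(1) 2] .
    then have "2 * xp - xm \<ge> 1 / (4 * M)" using X M4 nn by linarith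
    then have "2 * ym \<le> 1 / (100 * M\<^sup>2)" using tiny[OF nn(4) br(3)] by blast
    then have "\<bar>yp - ym - 1 * (yp + ym)\<bar> \<le> 1 / (100 * M\<^sup>2)" using nn by simp
    then show ?thesis by (intro bexI[of _ 1]) auto
  next
    case 3
    have "xp \<le> 1 / (500 * M)" using small[OF nn(1) br(2) 3] .
    then have "xm - 2 * xp \<ge> 1 / (4 * M)" using X M4 by linarith
    then have "2 * yp \<le> 1 / (100 * M\<^sup>2)" using tiny[OF nn(3) br(4)] by blast
    then have "\<bar>yp - ym - (-1) * (yp + ym)\<bar> \<le> 1 / (100 * M\<^sup>2)" using nn by simp
    then show ?thesis by (intro bexI[of _ "-1"]) auto
  qed
qed

text \<open>The approximate equilibria of the block game: every block has nearly mass \<open>1/m\<close>, and within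
  a block the column player is nearly at one of the three equilibria of the two-by-two game, whose
  signed masses are \<open>1\<close>, \<open>-1\<close> and \<open>-1/3\<close>.
  An odd number of these never cancels.\<close>

lemma block_game_imbalance:
  fixes xp xm yp ym rp rm cp cm :: "nat \<Rightarrow> real" and m :: nat and e \<kappa> V W :: real
  assumes m: "odd m"
    and nn: "\<And>i. i < m \<Longrightarrow> xp i \<ge> 0" "\<And>i. i < m \<Longrightarrow> xm i \<ge> 0"
            "\<And>i. i < m \<Longrightarrow> yp i \<ge> 0" "\<And>i. i < m \<Longrightarrow> ym i \<ge> 0"
    and sX: "(\<Sum>i<m. xp i + xm i) = 1" and sY: "(\<Sum>i<m. yp i + ym i) = 1"
    and \<kappa>: "\<kappa> = 1 / (200 * real m)"
    and e: "e \<ge> 0" "e \<le> 1 / (10 ^ 7 * real m ^ 4)"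
    and rp: "\<And>i. rp i = (yp i + ym i) / 2 + \<kappa> * yp i"
    and rm: "\<And>i. rm i = (yp i + ym i) / 2 + \<kappa> * (ym i - yp i)"
    and cp: "\<And>i. cp i = - (xp i + xm i) / 2 + \<kappa> * xp i"
    and cm: "\<And>i. cm i = - (xp i + xm i) / 2 + \<kappa> * (xm i - xp i)"
    and V: "V = (\<Sum>i<m. xp i * rp i + xm i * rm i)"
    and W: "W = (\<Sum>i<m. yp i * cp i + ym i * cm i)"
    and br: "\<And>i. i < m \<Longrightarrow> rp i \<le> V + e" "\<And>i. i < m \<Longrightarrow> rm i \<le> V + e"
            "\<And>i. i < m \<Longrightarrow> cp i \<le> W + e" "\<And>i. i < m \<Longrightarrow> cm i \<le> W + e"
  shows "V + 1 / (50 * real m) \<le> (1/2 + \<kappa>) / real m + \<bar>\<Sum>i<m. yp i - ym i\<bar> / 4"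
proof -
  define M where "M = real m"
  have M1: "M \<ge> 1" using m by (cases m) (auto simp: M_def)
  have \<kappa>M: "\<kappa> * M = 1 / 200" and \<kappa>0: "\<kappa> > 0" and \<kappa>s: "\<kappa> \<le> 1 / 200"
    using M1 unfolding \<kappa> M_def[symmetric] by (auto simp: field_simps)
  have \<kappa>\<kappa>: "\<kappa> * \<kappa> \<le> \<kappa> / 200" using \<kappa>s \<kappa>0 mult_left_mono[of \<kappa> "1/200" \<kappa>] by simp
  define f where "f = M * e"
  have M3: "M ^ 3 \<ge> 1" "M ^ 3 \<ge> M" using M1 by (auto simp: one_le_power self_le_power)
  have f0: "f \<ge> 0" using e M1 by (simp add: f_def)
  have "f \<le> M * (1 / (10 ^ 7 * M ^ 4))"
    unfolding f_def using e(2) M1 by (intro mult_left_mono) (auto simp: M_def)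
  also have "\<dots> = 1 / (10 ^ 7 * M ^ 3)" using M1 by (simp add: field_simps power_numeral_reduce)
  also have "\<dots> \<le> 1 / (10 ^ 7 * M)" using M1 M3 by (intro divide_left_mono) auto
  also have "\<dots> = 200 / 10 ^ 7 * \<kappa>" unfolding \<kappa> M_def[symmetric] by simp
  finally have f\<kappa>: "f \<le> \<kappa> / 50000" by simp
  \<comment> \<open>\<open>Q\<close> is the probability that both players choose the same block. Up
    to a relative error of order \<open>\<kappa>\<close>, the row value is \<open>Q / 2\<close> and
    the column value \<open>- Q / 2\<close>.\<close>
  define X Y where "X i = xp i + xm i" and "Y i = yp i + ym i" for i
  define Q where "Q = (\<Sum>i<m. X i * Y i)"
  have Q0: "Q \<ge> 0" unfolding Q_def X_def Y_def by (intro sum_nonneg) (auto intro!: mult_nonneg_nonneg add_nonneg_nonneg nn)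
  have VQ: "V \<le> (1/2 + \<kappa>) * Q"
  proof -
    have "xp i * rp i + xm i * rm i \<le> (1/2 + \<kappa>) * (X i * Y i)" if "i < m" for i
    proof -
      have "(1/2 + \<kappa>) * (X i * Y i) - (xp i * rp i + xm i * rm i) = \<kappa> * (xp i * ym i + 2 * (xm i * yp i))"
        by (simp add: rp rm X_def Y_def field_simps)
      also have "\<dots> \<ge> 0" using nn[OF that] \<kappa>0 by simp
      finally show ?thesis by simp
    qed
    then show ?thesis unfolding V Q_def sum_distrib_left by (intro sum_mono) auto
  qed
  have WQ: "(1/2 - \<kappa>) * Q \<le> - W"
  proof -
    have "yp i * cp i + ym i * cm i \<le> - (1/2 - \<kappa>) * (X i * Y i)" if "i < m" for i
    proof -
      have "- (1/2 - \<kappa>) * (X i * Y i) - (yp i * cp i + ym i * cm i) = \<kappa> * (xm i * yp i + 2 * (xp i * ym i))"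
        by (simp add: cp cm X_def Y_def field_simps)
      also have "\<dots> \<ge> 0" using nn[OF that] \<kappa>0 by simp
      finally show ?thesis by simp
    qed
    then have "W \<le> - (1/2 - \<kappa>) * Q" unfolding W Q_def sum_distrib_left by (intro sum_mono) auto
    then show ?thesis by (simp only: mult_minus_left)
  qed
  have half_bound: "a \<le> 2 * c" if "a / 2 + b \<le> c" "0 \<le> b" for a b c :: real using that by simp
  have Yle: "Y i \<le> 2 * (V + e)" if "i < m" for i
    using br(1)[OF that] mult_nonneg_nonneg[OF less_imp_le[OF \<kappa>0] nn(3)[OF that]] half_bound[of "Y i" "\<kappa> * yp i"] unfolding rp Y_def by blast
  have Xge: "X i \<ge> 2 * (- W - e)" if "i < m" for i
    using br(3)[OF that] mult_nonneg_nonneg[OF less_imp_le[OF \<kappa>0] nn(1)[OF that]] half_bound[of "- X i" "\<kappa> * xp i" "W + e"] unfolding cp X_def by simp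
  define q where "q = M * Q"
  have q0: "q \<ge> 0" using Q0 M1 by (simp add: q_def)
  \<comment> \<open>Averaged over the blocks, the row best responses bound \<open>Q\<close> from
    below and the column best responses bound it from above, so \<open>q\<close> is 1 up to order
    \<open>\<kappa>\<close>.\<close>
  have "1 \<le> M * (2 * (V + e))"
    using sum_bounded_above[of "{..<m}" Y "2 * (V + e)"] Yle sY by (simp add: M_def Y_def)
  also have "\<dots> \<le> M * (2 * ((1/2 + \<kappa>) * Q + e))" using VQ M1 by (intro mult_left_mono) auto
  also have "\<dots> = (1 + 2 * \<kappa>) * q + 2 * f" by (simp add: q_def f_def algebra_simps)
  finally have q_lower: "1 - 2 * f \<le> (1 + 2 * \<kappa>) * q" by simp
  have "M * (2 * (- W - e)) \<le> 1"
    using sum_bounded_below[of "{..<m}" "2 * (- W - e)" X] Xge sX by (simp add: M_def X_def)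
  moreover have "M * (2 * ((1/2 - \<kappa>) * Q - e)) \<le> M * (2 * (- W - e))"
    using WQ M1 by (intro mult_left_mono) auto
  moreover have "M * (2 * ((1/2 - \<kappa>) * Q - e)) = (1 - 2 * \<kappa>) * q - 2 * f"
    by (simp add: q_def f_def algebra_simps)
  ultimately have q_upper: "(1 - 2 * \<kappa>) * q \<le> 1 + 2 * f" by simp
  \<comment> \<open>To first order the bound is \<open>1 + 2 * \<kappa>\<close>; the extra tenth of
    \<open>\<kappa>\<close> absorbs \<open>f\<close> and the quadratic term.\<close>
  have q2: "q \<le> 1 + 21/10 * \<kappa>"
  proof (rule ccontr)
    assume "\<not> ?thesis"
    then have "(1 - 2 * \<kappa>) * (1 + 21/10 * \<kappa>) < (1 - 2 * \<kappa>) * q"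
      using \<kappa>s by (intro mult_strict_left_mono) auto
    moreover have "(1 - 2 * \<kappa>) * (1 + 21/10 * \<kappa>) = 1 + \<kappa> / 10 - 42/10 * (\<kappa> * \<kappa>)" by (simp add: field_simps)
    ultimately show False using q_upper f\<kappa> \<kappa>0 \<kappa>\<kappa> by linarith
  qed
  have q1: "q \<ge> 98/100"
  proof (rule ccontr)
    assume "\<not> ?thesis"
    then have "(1 + 2 * \<kappa>) * q < (1 + 1/100) * (98/100)"
      using \<kappa>s \<kappa>0 q0 by (intro mult_le_less_imp_less) auto
    then show False using q_lower f\<kappa> \<kappa>s by simp
  qed
  \<comment> \<open>This is \<open>44/10 * \<kappa> / M\<close>: the product of
    \<open>1 + 2 * \<kappa>\<close> and \<open>1 + 21/10 * \<kappa>\<close> exceeds 1 by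
    \<open>41/10 * \<kappa>\<close> to first order, and the rest is margin.\<close>
  define \<beta> where "\<beta> = 22 / 1000 / M\<^sup>2"
  have Yub: "Y i \<le> 1 / M + \<beta>" if "i < m" for i
  proof -
    have "M * Y i \<le> M * (2 * (V + e))" using Yle[OF that] M1 by (intro mult_left_mono) auto
    also have "\<dots> \<le> M * (2 * ((1/2 + \<kappa>) * Q + e))" using VQ M1 by (intro mult_left_mono) auto
    also have "\<dots> = (1 + 2 * \<kappa>) * q + 2 * f" by (simp add: q_def f_def algebra_simps)
    also have "\<dots> \<le> (1 + 2 * \<kappa>) * (1 + 21/10 * \<kappa>) + 2 * f"
      using q2 \<kappa>0 by (intro add_right_mono mult_left_mono) auto
    also have "\<dots> = 1 + 41/10 * \<kappa> + 42/10 * (\<kappa> * \<kappa>) + 2 * f" by (simp add: field_simps)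
    also have "\<dots> \<le> 1 + 44/10 * \<kappa>"
      using \<kappa>\<kappa> \<kappa>0 f\<kappa> by linarith
    also have "\<dots> = M * (1 / M + \<beta>)"
      using M1 unfolding \<kappa> M_def[symmetric] \<beta>_def by (simp add: field_simps power2_eq_square)
    finally show ?thesis using M1 by simp
  qed
  \<comment> \<open>Only upper bounds on the block masses are known, but the masses sum to 1, so the
    total shortfall is controlled by the total excess.\<close>
  have dev: "(\<Sum>i<m. \<bar>Y i - 1 / M\<bar>) \<le> 44 / 1000 / M"
  proof -
    have "(\<Sum>i<m. \<bar>Y i - 1 / M\<bar>) \<le> (\<Sum>i<m. (1 / M + \<beta> - Y i) + \<beta>)"
    proof (intro sum_mono)
      fix i assume "i \<in> {..<m}"
      moreover have "\<beta> \<ge> 0" using M1 by (simp add: \<beta>_def)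
      ultimately show "\<bar>Y i - 1 / M\<bar> \<le> (1 / M + \<beta> - Y i) + \<beta>" using Yub[of i] by auto
    qed
    also have "\<dots> = M * (1 / M + 2 * \<beta>) - (\<Sum>i<m. Y i)"
      by (simp add: sum.distrib sum_subtractf M_def algebra_simps)
    also have "\<dots> = 2 * M * \<beta>" using sY M1 by (simp add: Y_def algebra_simps)
    also have "\<dots> = 44 / 1000 / M" using M1 by (simp add: \<beta>_def power2_eq_square)
    finally show ?thesis .
  qed
  have Xlb: "X i \<ge> 1 / (2 * M)" if "i < m" for i
  proof -
    have "(1 - 2 * \<kappa>) * q - 2 * f = M * (2 * ((1/2 - \<kappa>) * Q - e))" by (simp add: q_def f_def algebra_simps)
    also have "\<dots> \<le> M * X i" using WQ Xge[OF that] M1 by (intro mult_left_mono) auto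
    finally have 1: "(1 - 2 * \<kappa>) * q - 2 * f \<le> M * X i" .
    have "(99/100) * (98/100) \<le> (1 - 2 * \<kappa>) * q" using \<kappa>s q1 by (intro mult_mono) auto
    then have "1 / 2 \<le> M * X i" using 1 f\<kappa> \<kappa>s by simp
    then show ?thesis using M1 by (simp add: field_simps)
  qed
  \<comment> \<open>The terms \<open>V + e - rp i\<close> and \<open>V + e - rm i\<close> are
    nonnegative and average to \<open>e\<close> under the row strategy, so each weighted term is at
    most \<open>e\<close> on its own.\<close>
  have slackR: "(\<Sum>i<m. xp i * (V + e - rp i) + xm i * (V + e - rm i)) = e"
  proof -
    have "(\<Sum>i<m. xp i * (V + e - rp i) + xm i * (V + e - rm i)) =
      (V + e) * (\<Sum>i<m. xp i + xm i) - (\<Sum>i<m. xp i * rp i + xm i * rm i)"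
      by (simp add: sum_distrib_left sum_subtractf[symmetric] algebra_simps)
    then show ?thesis using sX V by simp
  qed
  have slackC: "(\<Sum>i<m. yp i * (W + e - cp i) + ym i * (W + e - cm i)) = e"
  proof -
    have "(\<Sum>i<m. yp i * (W + e - cp i) + ym i * (W + e - cm i)) =
      (W + e) * (\<Sum>i<m. yp i + ym i) - (\<Sum>i<m. yp i * cp i + ym i * cm i)"
      by (simp add: sum_distrib_left sum_subtractf[symmetric] algebra_simps)
    then show ?thesis using sY W by simp
  qed
  \<comment> \<open>The two strategies of a block differ in payoff by a multiple of
    \<open>\<kappa>\<close>, so regrets have to be read at that scale.\<close>
  define e2 where "e2 = e / \<kappa>"
  have e2: "e2 \<le> 2 / (100000 * M ^ 3)"
  proof -
    have "e2 \<le> (1 / (10 ^ 7 * M ^ 4)) / \<kappa>" unfolding e2_def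
      using e \<kappa>0 by (intro divide_right_mono) (auto simp: M_def)
    also have "\<dots> = 2 / (100000 * M ^ 3)" using M1 unfolding \<kappa> M_def[symmetric]
      by (simp add: field_simps power_numeral_reduce)
    finally show ?thesis .
  qed
  have "\<exists>\<sigma>\<in>{1, -1, -1/3}. \<bar>yp i - ym i - \<sigma> * (yp i + ym i)\<bar> \<le> 1 / (100 * M\<^sup>2)" if i: "i < m" for i
  proof (rule block_state[OF nn(1)[OF i] nn(2)[OF i] nn(3)[OF i] nn(4)[OF i] M1 _ e2])
    show "1 / (2 * M) \<le> xp i + xm i" using Xlb[OF i] by (simp add: X_def)
    have nnR: "\<And>i. i \<in> {..<m} \<Longrightarrow> 0 \<le> xp i * (V + e - rp i) + xm i * (V + e - rm i)"
      using nn br by (auto intro!: add_nonneg_nonneg mult_nonneg_nonneg)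
    have R: "xp i * (V + e - rp i) + xm i * (V + e - rm i) \<le> e"
      using member_le_sum[of i "{..<m}" "\<lambda>i. xp i * (V + e - rp i) + xm i * (V + e - rm i)"] i nnR slackR by auto
    have nnC: "\<And>i. i \<in> {..<m} \<Longrightarrow> 0 \<le> yp i * (W + e - cp i) + ym i * (W + e - cm i)"
      using nn br by (auto intro!: add_nonneg_nonneg mult_nonneg_nonneg)
    have C: "yp i * (W + e - cp i) + ym i * (W + e - cm i) \<le> e"
      using member_le_sum[of i "{..<m}" "\<lambda>i. yp i * (W + e - cp i) + ym i * (W + e - cm i)"] i nnC slackC by auto
    have p1: "xp i * (V + e - rp i) \<ge> 0" "xm i * (V + e - rm i) \<ge> 0"
      "yp i * (W + e - cp i) \<ge> 0" "ym i * (W + e - cm i) \<ge> 0"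
      using nn[OF i] br[OF i] by auto
    have dr: "rp i - rm i = \<kappa> * (2 * yp i - ym i)" by (simp add: rp rm algebra_simps)
    have dc: "cp i - cm i = \<kappa> * (2 * xp i - xm i)" by (simp add: cp cm algebra_simps)
    have "xm i * (rp i - rm i) \<le> xm i * (V + e - rm i)" using nn(2)[OF i] br(1)[OF i] by (intro mult_left_mono) auto
    then have "\<kappa> * (xm i * (2 * yp i - ym i)) \<le> e" using R p1 unfolding dr by (simp add: mult_ac)
    then show "xm i * (2 * yp i - ym i) \<le> e2" using \<kappa>0 by (simp add: e2_def pos_le_divide_eq mult_ac)
    have "xp i * (rm i - rp i) \<le> xp i * (V + e - rp i)" using nn(1)[OF i] br(2)[OF i] by (intro mult_left_mono) auto
    moreover have "rm i - rp i = \<kappa> * (ym i - 2 * yp i)" using dr by (simp add: algebra_simps)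
    ultimately have "\<kappa> * (xp i * (ym i - 2 * yp i)) \<le> e" using R p1 by (simp add: mult_ac)
    then show "xp i * (ym i - 2 * yp i) \<le> e2" using \<kappa>0 by (simp add: e2_def pos_le_divide_eq mult_ac)
    have "ym i * (cp i - cm i) \<le> ym i * (W + e - cm i)" using nn(4)[OF i] br(3)[OF i] by (intro mult_left_mono) auto
    then have "\<kappa> * (ym i * (2 * xp i - xm i)) \<le> e" using C p1 unfolding dc by (simp add: mult_ac)
    then show "ym i * (2 * xp i - xm i) \<le> e2" using \<kappa>0 by (simp add: e2_def pos_le_divide_eq mult_ac)
    have "yp i * (cm i - cp i) \<le> yp i * (W + e - cp i)" using nn(3)[OF i] br(4)[OF i] by (intro mult_left_mono) auto
    moreover have "cm i - cp i = \<kappa> * (xm i - 2 * xp i)" using dc by (simp add: algebra_simps)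
    ultimately have "\<kappa> * (yp i * (xm i - 2 * xp i)) \<le> e" using C p1 by (simp add: mult_ac)
    then show "yp i * (xm i - 2 * xp i) \<le> e2" using \<kappa>0 by (simp add: e2_def pos_le_divide_eq mult_ac)
  qed
  then obtain \<sigma> where \<sigma>: "\<And>i. i < m \<Longrightarrow> \<sigma> i \<in> {1, -1, -1/3}"
    "\<And>i. i < m \<Longrightarrow> \<bar>yp i - ym i - \<sigma> i * (yp i + ym i)\<bar> \<le> 1 / (100 * M\<^sup>2)"
    by metis
  have "\<bar>(\<Sum>i<m. yp i - ym i) - (\<Sum>i<m. \<sigma> i) / M\<bar> = \<bar>\<Sum>i<m. (yp i - ym i) - \<sigma> i / M\<bar>"
    by (simp add: sum_subtractf sum_divide_distrib)
  also have "\<dots> \<le> (\<Sum>i<m. \<bar>(yp i - ym i) - \<sigma> i / M\<bar>)" by (rule sum_abs)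
  also have "\<dots> \<le> (\<Sum>i<m. 1 / (100 * M\<^sup>2) + \<bar>Y i - 1 / M\<bar>)"
  proof (intro sum_mono)
    fix i assume "i \<in> {..<m}"
    then have i: "i < m" by simp
    have "(yp i - ym i) - \<sigma> i / M = (yp i - ym i - \<sigma> i * (yp i + ym i)) + \<sigma> i * (Y i - 1 / M)"
      by (simp add: Y_def algebra_simps)
    also have "\<bar>\<dots>\<bar> \<le> \<bar>yp i - ym i - \<sigma> i * (yp i + ym i)\<bar> + \<bar>\<sigma> i * (Y i - 1 / M)\<bar>" by (rule abs_triangle_ineq)
    also have "\<bar>\<sigma> i * (Y i - 1 / M)\<bar> \<le> \<bar>Y i - 1 / M\<bar>"
      using \<sigma>(1)[OF i] by (auto simp: abs_mult)
    finally show "\<bar>(yp i - ym i) - \<sigma> i / M\<bar> \<le> 1 / (100 * M\<^sup>2) + \<bar>Y i - 1 / M\<bar>"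
      using \<sigma>(2)[OF i] by linarith
  qed
  also have "\<dots> = M * (1 / (100 * M\<^sup>2)) + (\<Sum>i<m. \<bar>Y i - 1 / M\<bar>)"
    by (simp add: sum.distrib M_def)
  also have "M * (1 / (100 * M\<^sup>2)) = 1 / 100 / M" using M1 by (simp add: power2_eq_square)
  finally have "\<bar>(\<Sum>i<m. yp i - ym i) - (\<Sum>i<m. \<sigma> i) / M\<bar> \<le> 54 / 1000 / M" using dev by simp
  moreover have "\<bar>(\<Sum>i<m. \<sigma> i) / M\<bar> \<ge> 1 / 3 / M"
  proof -
    have "1 / 3 \<le> \<bar>\<Sum>i<m. \<sigma> i\<bar>" by (rule odd_third_sum[OF m \<sigma>(1)])
    then have "1 / 3 / M \<le> \<bar>\<Sum>i<m. \<sigma> i\<bar> / M" using M1 by (intro divide_right_mono) auto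
    then show ?thesis using M1 by simp
  qed
  ultimately have T: "\<bar>\<Sum>i<m. yp i - ym i\<bar> \<ge> 1 / 3 / M - 54 / 1000 / M" by linarith
  have Vub: "V \<le> (1/2 + \<kappa>) / M + 1 / 100 / M"
  proof -
    have "M * V \<le> M * ((1/2 + \<kappa>) * Q)" using VQ M1 by (intro mult_left_mono) auto
    also have "\<dots> = (1/2 + \<kappa>) * q" by (simp add: q_def)
    also have "\<dots> \<le> (1/2 + \<kappa>) * (1 + 21/10 * \<kappa>)" using q2 \<kappa>0 by (intro mult_left_mono) auto
    also have "\<dots> = (1/2 + \<kappa>) + 105/100 * \<kappa> + 21/10 * (\<kappa> * \<kappa>)" by (simp add: field_simps)
    also have "\<dots> \<le> (1/2 + \<kappa>) + 1 / 100"
      using \<kappa>\<kappa> \<kappa>s \<kappa>0 by linarith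
    also have "\<dots> = M * ((1/2 + \<kappa>) / M + 1 / 100 / M)" using M1 by (simp add: field_simps)
    finally show ?thesis using M1 by simp
  qed
  \<comment> \<open>In units of \<open>1 / M\<close>, a quarter of \<open>1/3 - 54/1000\<close> has
    to exceed \<open>1/100 + 1/50\<close>.\<close>
  have "1 / 3 / M = (1 / 3) * (1 / M)" "54 / 1000 / M = (54 / 1000) * (1 / M)" "1 / 100 / M = (1 / 100) * (1 / M)"
    "1 / (50 * M) = (1 / 50) * (1 / M)" by simp_all
  moreover have "1 / M \<ge> 0" using M1 by simp
  ultimately show ?thesis using T Vub unfolding M_def[symmetric] by linarith
qed

section \<open>The hard games\<close>

text \<open>The first argument is the strategy of the player being paid, so
  \<open>col_matrix\<close> swaps the two. Indifference requires the opponent to play odd twice as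
  often as even, whence the signed mass -1/3.\<close>

definition coordination :: "nat \<Rightarrow> nat \<Rightarrow> real" where
  "coordination r c = (if even r = even c then 1 else if even r then 0 else -1)"

definition weight :: "nat set \<Rightarrow> nat \<Rightarrow> real" where
  "weight S r = (if r \<in> S then 1/2 else 1)"

lemma weight_bounds: "1/2 \<le> weight S r" "weight S r \<le> 1" "0 < weight S r"
  by (auto simp: weight_def)

locale hard_game_family =
  fixes n m :: nat
  assumes m_odd: "odd m" and size: "2 * m + 2 \<le> n"
begin

definition coupling :: real where
  "coupling = 1 / (200 * real m)"

text \<open>The row payoff at every support point of the pseudo-distribution. With this offset the
  gain against a tail row becomes a pure multiple of the sign sum.\<close>

definition base_value :: real where
  "base_value = (1/2 + coupling) / real m"

lemma m_ge_1: "real m \<ge> 1"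
  using m_odd by (cases m) auto

lemma coupling_bounds: "0 < coupling" "coupling \<le> 1/200"
  using m_ge_1 by (auto simp: coupling_def field_simps)

lemma base_value_bounds: "0 < base_value" "base_value \<le> 3/4"
proof -
  show "0 < base_value" using m_ge_1 coupling_bounds by (simp add: base_value_def)
  have "base_value \<le> (1/2 + coupling) / 1"
    unfolding base_value_def using m_ge_1 coupling_bounds by (intro divide_left_mono) auto
  then show "base_value \<le> 3/4" using coupling_bounds by simp
qed

text \<open>For \<open>i < m\<close> the strategies \<open>2 * i\<close> and \<open>2 * i + 1\<close> form block \<open>i\<close> and carry the signs \<open>1\<close> and
  \<open>-1\<close>.\<close>

definition row_matrix :: "nat set \<Rightarrow> real mat" where
  "row_matrix S = mat n n (\<lambda>(r, c).
     if r < 2 * m then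
       if c < 2 * m then if r div 2 = c div 2 then 1/2 + coupling * coordination r c else 0
       else -1
     else
       if c < 2 * m then base_value + (if even r = even c then 1/4 else -1/4)
       else if r = c then weight S r else 0)"

text \<open>Against a row player in the tail, block columns lose 1 while the factor 1/2 limits the
  loss of a tail column to 1/2. This gap makes the column player follow the row player into the
  tail.\<close>

definition col_matrix :: "nat set \<Rightarrow> real mat" where
  "col_matrix S = mat n n (\<lambda>(r, c).
     if r < 2 * m \<and> c < 2 * m then
       if r div 2 = c div 2 then -1/2 + coupling * coordination c r else 0
     else if r < 2 * m \<or> c < 2 * m then -1
     else if r = c then - weight S r / 2 else 0)"

definition game :: "nat set \<Rightarrow> game" where
  "game S = (row_matrix S, col_matrix S)"

lemma is_game: "is_game n (game S)"
  by (simp add: is_game_def game_def row_matrix_def col_matrix_def)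

lemma payoffs_in_unit: "payoffs_in_unit n (game S)"
proof -
  have 1: "- (1/200) \<le> coupling * coordination r c" "coupling * coordination r c \<le> 1/200" for r c
    using coupling_bounds by (auto simp: coordination_def)
  have 2: "1/2 + coupling * coordination r c \<in> {-1..1}" "-1/2 + coupling * coordination r c \<in> {-1..1}" for r c
    using 1[of r c] by auto
  show ?thesis
    using base_value_bounds 2
    unfolding payoffs_in_unit_def game_def row_matrix_def col_matrix_def
    by (auto simp: weight_def)
qed

abbreviation paired_sum :: "(nat \<Rightarrow> real) \<Rightarrow> real" where
  "paired_sum f \<equiv> (\<Sum>i<m. f (2 * i) + f (2 * i + 1))"

abbreviation tail_sum :: "(nat \<Rightarrow> real) \<Rightarrow> real" where
  "tail_sum f \<equiv> (\<Sum>b=2*m..<n. f b)"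

lemma sum_split: "(\<Sum>l<n. f l :: real) = paired_sum f + tail_sum f"
proof -
  have "(\<Sum>l<2 * k. f l) = (\<Sum>i<k. f (2 * i) + f (2 * i + 1))" for k
    by (induction k) (auto simp: algebra_simps)
  moreover have "(\<Sum>l<n. f l) = (\<Sum>l<2 * m. f l) + tail_sum f"
    using size by (simp add: sum.atLeastLessThan_concat lessThan_atLeast0)
  ultimately show ?thesis by simp
qed

section \<open>Payoffs of pure strategies in terms of blocks and tail\<close>

lemma row_value_even:
  assumes "i < m"
  shows "(\<Sum>l<n. row_matrix S $$ (2 * i, l) * y l) =
    (y (2 * i) + y (2 * i + 1)) / 2 + coupling * y (2 * i) - tail_sum y"
proof -
  have "paired_sum (\<lambda>l. row_matrix S $$ (2 * i, l) * y l) =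
    (\<Sum>j<m. if j = i then (1/2 + coupling) * y (2 * i) + 1/2 * y (2 * i + 1) else 0)"
    using assms size by (intro sum.cong refl) (auto simp: row_matrix_def coordination_def)
  moreover have "tail_sum (\<lambda>l. row_matrix S $$ (2 * i, l) * y l) = tail_sum (\<lambda>l. - y l)"
    using assms size by (intro sum.cong refl) (auto simp: row_matrix_def)
  ultimately show ?thesis using assms by (simp add: sum_split sum_negf field_simps)
qed

lemma row_value_odd:
  assumes "i < m"
  shows "(\<Sum>l<n. row_matrix S $$ (2 * i + 1, l) * y l) =
    (y (2 * i) + y (2 * i + 1)) / 2 + coupling * (y (2 * i + 1) - y (2 * i)) - tail_sum y"
proof -
  have "paired_sum (\<lambda>l. row_matrix S $$ (2 * i + 1, l) * y l) =
    (\<Sum>j<m. if j = i then (1/2 - coupling) * y (2 * i) + (1/2 + coupling) * y (2 * i + 1) else 0)"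
    using assms size by (intro sum.cong refl) (auto simp: row_matrix_def coordination_def)
  moreover have "tail_sum (\<lambda>l. row_matrix S $$ (2 * i + 1, l) * y l) = tail_sum (\<lambda>l. - y l)"
    using assms size by (intro sum.cong refl) (auto simp: row_matrix_def)
  ultimately show ?thesis using assms by (simp add: sum_split sum_negf field_simps)
qed

lemma row_value_tail:
  assumes "b \<in> {2*m..<n}"
  shows "(\<Sum>l<n. row_matrix S $$ (b, l) * y l) =
    base_value * paired_sum y + (if even b then 1/4 else -1/4) * (\<Sum>j<m. y (2 * j) - y (2 * j + 1))
    + weight S b * y b"
proof -
  have "paired_sum (\<lambda>l. row_matrix S $$ (b, l) * y l) =
    (\<Sum>j<m. base_value * (y (2 * j) + y (2 * j + 1)) + (if even b then 1/4 else -1/4) * (y (2 * j) - y (2 * j + 1)))"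
    using assms size by (intro sum.cong refl) (auto simp: row_matrix_def algebra_simps)
  also have "\<dots> = base_value * paired_sum y + (if even b then 1/4 else -1/4) * (\<Sum>j<m. y (2 * j) - y (2 * j + 1))"
    by (subst sum.distrib) (simp only: sum_distrib_left)
  finally have "paired_sum (\<lambda>l. row_matrix S $$ (b, l) * y l) = \<dots>" .
  moreover have "tail_sum (\<lambda>l. row_matrix S $$ (b, l) * y l) = tail_sum (\<lambda>l. if l = b then weight S b * y b else 0)"
    using assms size by (intro sum.cong refl) (auto simp: row_matrix_def)
  ultimately show ?thesis using assms by (simp add: sum_split)
qed

lemma col_value_even:
  assumes "i < m"
  shows "(\<Sum>k<n. x k * col_matrix S $$ (k, 2 * i)) =
    - (x (2 * i) + x (2 * i + 1)) / 2 + coupling * x (2 * i) - tail_sum x"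
proof -
  have "paired_sum (\<lambda>k. x k * col_matrix S $$ (k, 2 * i)) =
    (\<Sum>j<m. if j = i then (-1/2 + coupling) * x (2 * i) - 1/2 * x (2 * i + 1) else 0)"
    using assms size by (intro sum.cong refl) (auto simp: col_matrix_def coordination_def)
  moreover have "tail_sum (\<lambda>k. x k * col_matrix S $$ (k, 2 * i)) = tail_sum (\<lambda>l. - x l)"
    using assms size by (intro sum.cong refl) (auto simp: col_matrix_def)
  ultimately show ?thesis using assms by (simp add: sum_split sum_negf field_simps)
qed

lemma col_value_odd:
  assumes "i < m"
  shows "(\<Sum>k<n. x k * col_matrix S $$ (k, 2 * i + 1)) =
    - (x (2 * i) + x (2 * i + 1)) / 2 + coupling * (x (2 * i + 1) - x (2 * i)) - tail_sum x"
proof -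
  have "paired_sum (\<lambda>k. x k * col_matrix S $$ (k, 2 * i + 1)) =
    (\<Sum>j<m. if j = i then (-1/2 - coupling) * x (2 * i) + (-1/2 + coupling) * x (2 * i + 1) else 0)"
    using assms size by (intro sum.cong refl) (auto simp: col_matrix_def coordination_def)
  moreover have "tail_sum (\<lambda>k. x k * col_matrix S $$ (k, 2 * i + 1)) = tail_sum (\<lambda>l. - x l)"
    using assms size by (intro sum.cong refl) (auto simp: col_matrix_def)
  ultimately show ?thesis using assms by (simp add: sum_split sum_negf field_simps)
qed

lemma col_value_tail:
  assumes "b \<in> {2*m..<n}"
  shows "(\<Sum>k<n. x k * col_matrix S $$ (k, b)) = - paired_sum x - weight S b * x b / 2"
proof -
  have "paired_sum (\<lambda>k. x k * col_matrix S $$ (k, b)) = (\<Sum>j<m. - (x (2 * j) + x (2 * j + 1)))"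
    using assms size by (intro sum.cong refl) (auto simp: col_matrix_def)
  also have "\<dots> = - paired_sum x" by (rule sum_negf)
  finally have "paired_sum (\<lambda>k. x k * col_matrix S $$ (k, b)) = \<dots>" .
  moreover have "tail_sum (\<lambda>k. x k * col_matrix S $$ (k, b)) = tail_sum (\<lambda>k. if k = b then - weight S b * x b / 2 else 0)"
    using assms size by (intro sum.cong refl) (auto simp: col_matrix_def)
  ultimately show ?thesis using assms by (simp add: sum_split)
qed

end

lemma payoff_by_rows:
  assumes "M \<in> carrier_mat n n" "x \<in> carrier_vec n" "y \<in> carrier_vec n"
  shows "payoff M x y = (\<Sum>k<n. x $ k * (\<Sum>l<n. M $$ (k, l) * y $ l))"
  using assms by (auto simp: payoff_def scalar_prod_def lessThan_atLeast0 intro!: sum.cong)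

lemma payoff_by_cols:
  assumes "M \<in> carrier_mat n n" "x \<in> carrier_vec n" "y \<in> carrier_vec n"
  shows "payoff M x y = (\<Sum>l<n. (\<Sum>k<n. x $ k * M $$ (k, l)) * y $ l)"
  unfolding payoff_by_rows[OF assms] sum_distrib_left sum_distrib_right
  by (subst sum.swap) (simp add: mult_ac)

lemma payoff_unit_row:
  assumes "M \<in> carrier_mat n n" "y \<in> carrier_vec n" "i < n"
  shows "payoff M (unit_vec n i) y = (\<Sum>l<n. M $$ (i, l) * y $ l)"
  using assms by (simp add: payoff_by_rows[of M n] if_distrib[of "\<lambda>x. x * _"] sum.delta cong: if_cong)

lemma payoff_unit_col:
  assumes "M \<in> carrier_mat n n" "x \<in> carrier_vec n" "j < n"
  shows "payoff M x (unit_vec n j) = (\<Sum>k<n. x $ k * M $$ (k, j))"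
  using assms by (simp add: payoff_by_cols[of M n] if_distrib[of "\<lambda>x. _ * x"] sum.delta cong: if_cong)

section \<open>True equilibria reveal the game\<close>

text \<open>In exact equilibrium both strategies are proportional to \<open>1 / w\<close>. Here each
  coordinate is bounded on one side only, but the masses are nearly 1, so the one-sided errors have
  a small sum and each is small. The 38 is 34 from \<open>17 * \<epsilon> * H\<close> with
  \<open>H \<le> 2 * k\<close>, plus 4 from the missing mass.\<close>

lemma matching_pennies_rigidity:
  fixes w x y :: "nat \<Rightarrow> real" and Q \<epsilon> :: real
  assumes B: "finite B" "B \<noteq> {}"
    and w: "\<And>b. b \<in> B \<Longrightarrow> 1/2 \<le> w b \<and> w b \<le> 1"
    and ub: "\<And>b. b \<in> B \<Longrightarrow> w b * y b \<le> Q + 11 * \<epsilon>"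
    and lb: "\<And>b. b \<in> B \<Longrightarrow> Q - 6 * \<epsilon> \<le> w b * x b"
    and sx: "(\<Sum>b\<in>B. x b) \<le> 1" "1 - 2 * \<epsilon> \<le> (\<Sum>b\<in>B. x b)"
    and sy: "(\<Sum>b\<in>B. y b) \<le> 1" "1 - 4 * \<epsilon> \<le> (\<Sum>b\<in>B. y b)"
    and \<epsilon>: "0 \<le> \<epsilon>" "1000 * (real (card B))\<^sup>2 * \<epsilon> \<le> 1"
    and b: "b \<in> B"
  shows "Q - 6 * \<epsilon> \<le> w b * x b" "w b * x b \<le> Q - 6 * \<epsilon> + 38 * card B * \<epsilon>"
    and "w b * y b \<le> Q + 11 * \<epsilon>" "Q + 11 * \<epsilon> - 38 * card B * \<epsilon> \<le> w b * y b"
    and "160 * card B * \<epsilon> < Q"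
proof -
  define H where "H = (\<Sum>b\<in>B. 1 / w b)"
  define k where "k = real (card B)"
  have k1: "k \<ge> 1" using B by (simp add: k_def Suc_leI card_gt_0_iff)
  have iw: "1 \<le> 1 / w b" "1 / w b \<le> 2" "w b > 0" if "b \<in> B" for b
    using w[OF that] by (auto simp: field_simps)
  have H: "k \<le> H" "H \<le> 2 * k"
    using sum_bounded_below[of B 1 "\<lambda>b. 1 / w b"] sum_bounded_above[of B "\<lambda>b. 1 / w b" 2] iw
    by (auto simp: H_def k_def)
  have ub': "y b \<le> (Q + 11 * \<epsilon>) * (1 / w b)" if "b \<in> B" for b
    using ub[OF that] iw(3)[OF that] by (simp add: field_simps)
  have lb': "(Q - 6 * \<epsilon>) * (1 / w b) \<le> x b" if "b \<in> B" for b
    using lb[OF that] iw(3)[OF that] by (simp add: field_simps)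
  have Hy: "1 - 4 * \<epsilon> \<le> (Q + 11 * \<epsilon>) * H"
    using sum_mono[of B y "\<lambda>b. (Q + 11 * \<epsilon>) * (1 / w b)"] ub' sy(2) unfolding H_def sum_distrib_left by fastforce
  have Hx: "(Q - 6 * \<epsilon>) * H \<le> 1"
    using sum_mono[of B "\<lambda>b. (Q - 6 * \<epsilon>) * (1 / w b)" x] lb' sx(1) unfolding H_def sum_distrib_left by fastforce
  have eH: "17 * \<epsilon> * H \<le> 34 * k * \<epsilon>"
    using mult_left_mono[OF H(2), of "17 * \<epsilon>"] \<epsilon> by (simp add: mult_ac)
  have ke: "\<epsilon> \<le> k * \<epsilon>" using k1 \<epsilon>(1) mult_right_mono[of 1 k \<epsilon>] by simp
  have eqH: "(Q + 11 * \<epsilon>) * H - (Q - 6 * \<epsilon>) * H = 17 * \<epsilon> * H" by (simp add: algebra_simps)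
  have excess: "x b - (Q - 6 * \<epsilon>) * (1 / w b) \<le> 38 * k * \<epsilon>"
  proof -
    have "x b - (Q - 6 * \<epsilon>) * (1 / w b) \<le> (\<Sum>b\<in>B. x b - (Q - 6 * \<epsilon>) * (1 / w b))"
      using lb' B b by (intro member_le_sum[of b B "\<lambda>b. x b - (Q - 6 * \<epsilon>) * (1 / w b)"]) auto
    also have "\<dots> = (\<Sum>b\<in>B. x b) - (Q - 6 * \<epsilon>) * H"
      unfolding H_def sum_distrib_left by (simp add: sum_subtractf)
    also have "\<dots> \<le> 38 * k * \<epsilon>" using sx Hy eqH eH ke by linarith
    finally show ?thesis .
  qed
  have deficit: "(Q + 11 * \<epsilon>) * (1 / w b) - y b \<le> 38 * k * \<epsilon>"
  proof -
    have "(Q + 11 * \<epsilon>) * (1 / w b) - y b \<le> (\<Sum>b\<in>B. (Q + 11 * \<epsilon>) * (1 / w b) - y b)"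
      using ub' B b by (intro member_le_sum[of b B "\<lambda>b. (Q + 11 * \<epsilon>) * (1 / w b) - y b"]) auto
    also have "\<dots> = (Q + 11 * \<epsilon>) * H - (\<Sum>b\<in>B. y b)"
      unfolding H_def sum_distrib_left by (simp add: sum_subtractf)
    also have "\<dots> \<le> 38 * k * \<epsilon>" using sy Hx eqH eH ke by linarith
    finally show ?thesis .
  qed
  have scale: "w b * a \<le> 38 * k * \<epsilon>" if "a \<le> 38 * k * \<epsilon>" for a
  proof -
    have "w b * a \<le> w b * (38 * k * \<epsilon>)" using that iw(3)[OF b] by (intro mult_left_mono) auto
    also have "\<dots> \<le> 1 * (38 * k * \<epsilon>)" using w[OF b] k1 \<epsilon>(1) by (intro mult_right_mono) auto
    finally show ?thesis by simp
  qed
  have wx: "w b * (x b - (Q - 6 * \<epsilon>) * (1 / w b)) = w b * x b - (Q - 6 * \<epsilon>)"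
    and wy: "w b * ((Q + 11 * \<epsilon>) * (1 / w b) - y b) = (Q + 11 * \<epsilon>) - w b * y b"
    using iw(3)[OF b] by (simp_all add: field_simps)
  show "Q - 6 * \<epsilon> \<le> w b * x b" "w b * y b \<le> Q + 11 * \<epsilon>" using lb ub b by auto
  show "w b * x b \<le> Q - 6 * \<epsilon> + 38 * card B * \<epsilon>"
    using scale[OF excess] unfolding wx k_def by linarith
  show "Q + 11 * \<epsilon> - 38 * card B * \<epsilon> \<le> w b * y b"
    using scale[OF deficit] unfolding wy k_def by linarith
  \<comment> \<open>Almost all mass lies in \<open>B\<close>, so \<open>Q * H\<close> is nearly 1
    and \<open>Q\<close> is at least about \<open>1 / (2 * k)\<close>, far above
    \<open>k * \<epsilon>\<close>.\<close>
  show "160 * card B * \<epsilon> < Q"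
  proof (rule ccontr)
    assume "\<not> ?thesis"
    then have Q: "Q \<le> 160 * k * \<epsilon>" by (simp add: k_def)
    then have "Q + 11 * \<epsilon> \<le> 171 * k * \<epsilon>" using ke by linarith
    then have "(Q + 11 * \<epsilon>) * H \<le> (171 * k * \<epsilon>) * H" using H k1 by (intro mult_right_mono) auto
    also have "\<dots> \<le> (171 * k * \<epsilon>) * (2 * k)" using H \<epsilon>(1) k1 by (intro mult_left_mono) auto
    also have "\<dots> = 342 * (k\<^sup>2 * \<epsilon>)" by (simp add: power2_eq_square)
    finally have 1: "1 - 4 * \<epsilon> \<le> 342 * (k\<^sup>2 * \<epsilon>)" using Hy by linarith
    have "1 \<le> k\<^sup>2" using k1 by (simp add: one_le_power)
    then have "\<epsilon> \<le> k\<^sup>2 * \<epsilon>" using \<epsilon>(1) mult_right_mono[of 1 "k\<^sup>2" \<epsilon>] by simp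
    moreover have "1000 * (k\<^sup>2 * \<epsilon>) \<le> 1" using \<epsilon>(2) by (simp add: k_def mult_ac)
    ultimately show False using 1 by linarith
  qed
qed

context hard_game_family begin

text \<open>The common value of \<open>weight S b * x b\<close> is unknown, so it is read off at
  strategy \<open>2*m\<close>, which is never in \<open>S\<close> and has weight 1. Were the weight
  of some \<open>b\<close> both 1/2 and 1, this value would be at most
  \<open>3 * \<delta>\<close>.\<close>

definition pins :: "real \<Rightarrow> nat set \<Rightarrow> (nat \<Rightarrow> real) \<Rightarrow> bool" where
  "pins \<delta> S x \<longleftrightarrow> 3 * \<delta> < x (2*m) \<and> (\<forall>b\<in>{2*m..<n}. \<bar>weight S b * x b - x (2*m)\<bar> \<le> \<delta>)"

lemma pins_unique:
  assumes "S \<subseteq> {2*m<..<n}" "S' \<subseteq> {2*m<..<n}" "pins \<delta> S x" "pins \<delta> S' x"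
  shows "S = S'"
proof -
  have "b \<in> S'" if S: "S \<subseteq> {2*m<..<n}" and p: "pins \<delta> S x" "pins \<delta> S' x" and b: "b \<in> S" for S S' b
  proof (rule ccontr)
    assume b': "b \<notin> S'"
    have "b \<in> {2*m..<n}" using S b by auto
    then have *: "\<bar>weight S b * x b - x (2*m)\<bar> \<le> \<delta>" "\<bar>weight S' b * x b - x (2*m)\<bar> \<le> \<delta>" "3 * \<delta> < x (2*m)"
      using p unfolding pins_def by blast+
    have w: "weight S b = 1/2" "weight S' b = 1" using b b' by (simp_all add: weight_def)
    show False using * unfolding w by linarith
  qed
  then show ?thesis using assms by blast
qed

text \<open>If both players kept mass 1/8 on the blocks, renormalising would give an approximate
  equilibrium of the block game, whose imbalance makes a tail row profitable. So one player nearly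
  leaves the blocks, the penalties of 1 make the other follow, and what remains is weighted matching
  pennies on the tail.\<close>

lemma best_responses_pin:
  fixes x y rv cv :: "nat \<Rightarrow> real"
  assumes S: "S \<subseteq> {2*m<..<n}"
    and x: "\<And>k. k < n \<Longrightarrow> x k \<ge> 0" "(\<Sum>k<n. x k) = 1"
    and y: "\<And>k. k < n \<Longrightarrow> y k \<ge> 0" "(\<Sum>k<n. y k) = 1"
    and rv: "\<And>r. rv r = (\<Sum>l<n. row_matrix S $$ (r, l) * y l)"
    and cv: "\<And>c. cv c = (\<Sum>k<n. x k * col_matrix S $$ (k, c))"
    and V: "V = (\<Sum>k<n. x k * rv k)" and W: "W = (\<Sum>l<n. cv l * y l)"
    and br: "\<And>r. r < n \<Longrightarrow> rv r \<le> V + \<epsilon>" "\<And>c. c < n \<Longrightarrow> cv c \<le> W + \<epsilon>"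
    and \<epsilon>: "0 \<le> \<epsilon>" "\<epsilon> \<le> 1 / (10 ^ 8 * real n ^ 4)"
  defines "\<delta> \<equiv> 38 * real (n - 2 * m) * \<epsilon>"
  shows "pins \<delta> S x \<and> pins \<delta> S y"
proof -
  have ix: "2 * i < n" "2 * i + 1 < n" if "i < m" for i using that size by auto
  have inn: "2 * m < n" "2 * m + 1 < n" using size by auto
  have n1: "real n \<ge> 2 * real m" "real n \<ge> 1" "real n \<ge> real (n - 2 * m)" using size by auto
  have n4: "real n ^ 4 \<ge> 16 * real m ^ 4" "real n ^ 4 \<ge> (real (n - 2 * m))\<^sup>2" "real n ^ 4 \<ge> 1"
  proof -
    have "(2 * real m) ^ 4 \<le> real n ^ 4" using n1 by (intro power_mono) auto
    then show "real n ^ 4 \<ge> 16 * real m ^ 4" by (simp add: power_mult_distrib)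
    have "(real (n - 2 * m))\<^sup>2 \<le> real n ^ 2" using n1 by (intro power_mono) auto
    also have "\<dots> \<le> real n ^ 4" using n1 by (intro power_increasing) auto
    finally show "real n ^ 4 \<ge> (real (n - 2 * m))\<^sup>2" .
    show "real n ^ 4 \<ge> 1" using n1 by (simp add: one_le_power)
  qed
  have m4: "real m ^ 4 \<ge> 1" "real m ^ 4 \<ge> real m" using m_ge_1 by (auto simp: one_le_power self_le_power)
  have "0 < 10 ^ 8 * real n ^ 4" using n1 by simp
  then have \<epsilon>n: "10 ^ 8 * (real n ^ 4 * \<epsilon>) \<le> 1" using \<epsilon>(2) by (simp only: pos_le_divide_eq mult_ac)
  have \<epsilon>k: "1000 * (real (n - 2 * m))\<^sup>2 * \<epsilon> \<le> 1"
    using mult_right_mono[OF n4(2) \<epsilon>(1)] \<epsilon>n \<epsilon>(1) by simp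
  \<comment> \<open>Since \<open>n \<ge> 2 * m\<close> gains a factor 16, the loss of 64 from
    renormalising is only a factor 4, within the 10 between \<open>10 ^ 8\<close> and
    \<open>10 ^ 7\<close>.\<close>
  have "64 * \<epsilon> * (10 ^ 7 * real m ^ 4) \<le> 1"
    using mult_right_mono[OF n4(1) \<epsilon>(1)] \<epsilon>n by (simp add: mult_ac)
  moreover have "0 < 10 ^ 7 * real m ^ 4" using m_ge_1 by simp
  ultimately have \<epsilon>m: "64 * \<epsilon> \<le> 1 / (10 ^ 7 * real m ^ 4)" by (simp only: pos_le_divide_eq)
  have \<epsilon>s: "\<epsilon> \<le> 1 / 1000" using mult_right_mono[OF n4(3) \<epsilon>(1)] \<epsilon>n by simp
  define XA YA where "XA = paired_sum x" and "YA = paired_sum y"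
  have XB: "tail_sum x = 1 - XA" and YB: "tail_sum y = 1 - YA"
    using x(2) y(2) by (simp_all add: sum_split XA_def YA_def)
  have nnA: "x (2 * i) \<ge> 0" "x (2 * i + 1) \<ge> 0" "y (2 * i) \<ge> 0" "y (2 * i + 1) \<ge> 0" if "i < m" for i
    using x(1) y(1) ix[OF that] by auto
  have A0: "XA \<ge> 0" "YA \<ge> 0" unfolding XA_def YA_def using nnA by (auto intro!: sum_nonneg add_nonneg_nonneg)
  have B0: "tail_sum x \<ge> 0" "tail_sum y \<ge> 0" using x(1) y(1) by (auto intro!: sum_nonneg)
  then have A1: "XA \<le> 1" "YA \<le> 1" using XB YB by auto
  have blockle: "x (2 * i) + x (2 * i + 1) \<le> XA" "y (2 * i) + y (2 * i + 1) \<le> YA" if "i < m" for i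
    unfolding XA_def YA_def
    using member_le_sum[of i "{..<m}" "\<lambda>i. x (2 * i) + x (2 * i + 1)"]
      member_le_sum[of i "{..<m}" "\<lambda>i. y (2 * i) + y (2 * i + 1)"] that nnA by auto
  note re = row_value_even[of _ S y, folded rv] and ro = row_value_odd[of _ S y, folded rv]
    and rt = row_value_tail[of _ S y, folded rv] and ce = col_value_even[of _ x S, folded cv]
    and co = col_value_odd[of _ x S, folded cv] and ct = col_value_tail[of _ x S, folded cv]
  have slackR: "paired_sum (\<lambda>k. x k * (V + \<epsilon> - rv k)) \<le> \<epsilon>"
  proof -
    have "(\<Sum>k<n. x k * (V + \<epsilon> - rv k)) = (\<Sum>k<n. x k) * (V + \<epsilon>) - (\<Sum>k<n. x k * rv k)"
      by (simp only: right_diff_distrib sum_subtractf sum_distrib_right)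
    then have "(\<Sum>k<n. x k * (V + \<epsilon> - rv k)) = \<epsilon>" unfolding V[symmetric] x(2) by simp
    moreover have "tail_sum (\<lambda>k. x k * (V + \<epsilon> - rv k)) \<ge> 0"
      using x(1) br(1) by (intro sum_nonneg mult_nonneg_nonneg) auto
    ultimately show ?thesis unfolding sum_split by linarith
  qed
  have slackC: "paired_sum (\<lambda>k. y k * (W + \<epsilon> - cv k)) \<le> \<epsilon>"
  proof -
    have "(\<Sum>k<n. y k * (W + \<epsilon> - cv k)) = (\<Sum>k<n. y k) * (W + \<epsilon>) - (\<Sum>k<n. cv k * y k)"
      by (simp only: right_diff_distrib sum_subtractf sum_distrib_right) (simp add: mult.commute)
    then have "(\<Sum>k<n. y k * (W + \<epsilon> - cv k)) = \<epsilon>" unfolding W[symmetric] y(2) by simp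
    moreover have "tail_sum (\<lambda>k. y k * (W + \<epsilon> - cv k)) \<ge> 0"
      using y(1) br(2) by (intro sum_nonneg mult_nonneg_nonneg) auto
    ultimately show ?thesis unfolding sum_split by linarith
  qed
  have half: "coupling * a \<le> 1/2 * a" if "0 \<le> a" for a
    using coupling_bounds by (intro mult_right_mono that) simp
  have rA: "rv (2 * i) \<le> YA - tail_sum y" "rv (2 * i + 1) \<le> YA - tail_sum y" if i: "i < m" for i
  proof -
    have "coupling * y (2 * i) \<le> 1/2 * y (2 * i)" "coupling * y (2 * i + 1) \<le> 1/2 * y (2 * i + 1)"
      "0 \<le> coupling * y (2 * i)"
      using half[OF nnA(3)[OF i]] half[OF nnA(4)[OF i]] coupling_bounds(1) nnA(3)[OF i] by simp_all
    then show "rv (2 * i) \<le> YA - tail_sum y" "rv (2 * i + 1) \<le> YA - tail_sum y"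
      using blockle(2)[OF i] nnA[OF i] unfolding re[OF i] ro[OF i] right_diff_distrib add_divide_distrib by simp_all
  qed
  have cA: "cv (2 * i) \<le> - tail_sum x" "cv (2 * i + 1) \<le> - tail_sum x" if i: "i < m" for i
  proof -
    have "coupling * x (2 * i) \<le> 1/2 * x (2 * i)" "coupling * x (2 * i + 1) \<le> 1/2 * x (2 * i + 1)"
      "0 \<le> coupling * x (2 * i)"
      using half[OF nnA(1)[OF i]] half[OF nnA(2)[OF i]] coupling_bounds(1) nnA(1)[OF i] by simp_all
    then show "cv (2 * i) \<le> - tail_sum x" "cv (2 * i + 1) \<le> - tail_sum x"
      using nnA[OF i] unfolding ce[OF i] co[OF i] right_diff_distrib minus_add_distrib add_divide_distrib by simp_all
  qed
  define t where "t = (\<Sum>j<m. y (2 * j) - y (2 * j + 1))"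
  have tYA: "\<bar>t\<bar> \<le> YA"
  proof -
    have "\<bar>t\<bar> \<le> (\<Sum>j<m. \<bar>y (2 * j) - y (2 * j + 1)\<bar>)" unfolding t_def by (rule sum_abs)
    also have "\<dots> \<le> YA" unfolding YA_def
    proof (rule sum_mono)
      fix j assume "j \<in> {..<m}"
      then show "\<bar>y (2 * j) - y (2 * j + 1)\<bar> \<le> y (2 * j) + y (2 * j + 1)" using nnA(3,4)[of j] by auto
    qed
    finally show ?thesis .
  qed
  have bvYA: "0 \<le> base_value * YA" "base_value * YA \<le> 3/4 * YA"
    using base_value_bounds A0 mult_right_mono[OF base_value_bounds(2) A0(2)] by simp_all
  have rB: "rv b = base_value * YA + (if even b then t / 4 else - t / 4) + weight S b * y b" if "b \<in> {2*m..<n}" for b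
    using rt[OF that] by (simp add: YA_def t_def)
  have cB: "cv b = - XA - weight S b * x b / 2" if "b \<in> {2*m..<n}" for b
    using ct[OF that] by (simp add: XA_def)
  have wnn: "0 \<le> weight S b * x b" "0 \<le> weight S b * y b" "weight S b * x b \<le> x b" "weight S b * y b \<le> y b"
    if "b \<in> {2*m..<n}" for b
    using weight_bounds[of S b] x(1)[of b] y(1)[of b] that by (auto intro: mult_left_le_one_le)
  \<comment> \<open>Row \<open>2*m\<close> earns at least \<open>- YA\<close> and a block row at
    most \<open>2 * YA - 1\<close>, so block rows lag by at least 1/2.\<close>
  have pull_row: "XA \<le> 2 * \<epsilon>" if "YA < 1/8"
  proof -
    have "V + \<epsilon> \<ge> rv (2*m)" using br(1) inn by auto
    moreover have "rv (2*m) \<ge> - YA" using rB[of "2*m"] wnn(2)[of "2*m"] bvYA tYA inn by auto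
    ultimately have gap: "1/2 \<le> V + \<epsilon> - rv (2 * i)" "1/2 \<le> V + \<epsilon> - rv (2 * i + 1)" if "i < m" for i
      using rA[OF that] YB \<open>YA < 1/8\<close> by auto
    have "1/2 * XA \<le> paired_sum (\<lambda>k. x k * (V + \<epsilon> - rv k))"
      unfolding XA_def sum_distrib_left
    proof (rule sum_mono)
      fix i assume "i \<in> {..<m}"
      then have i: "i < m" by simp
      show "1/2 * (x (2 * i) + x (2 * i + 1)) \<le> x (2 * i) * (V + \<epsilon> - rv (2 * i)) + x (2 * i + 1) * (V + \<epsilon> - rv (2 * i + 1))"
        using add_mono[OF mult_left_mono[OF gap(1)[OF i] nnA(1)[OF i]] mult_left_mono[OF gap(2)[OF i] nnA(2)[OF i]]]
        by (simp only: distrib_left mult.commute[of "1/2"])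
    qed
    then show ?thesis using slackR by linarith
  qed
  \<comment> \<open>Column \<open>2*m\<close> loses at most \<open>XA\<close> plus half the tail
    mass of \<open>x\<close>, a block column at least that whole tail mass.\<close>
  have pull_col: "YA \<le> 4 * \<epsilon>" if "XA < 1/8"
  proof -
    have "W + \<epsilon> \<ge> cv (2*m)" using br(2) inn by auto
    moreover have "x (2*m) \<le> tail_sum x" using x(1) inn by (intro member_le_sum) auto
    then have "cv (2*m) \<ge> - XA - 1/2 * tail_sum x" using cB[of "2*m"] wnn(3)[of "2*m"] inn by auto
    ultimately have gap: "1/4 \<le> W + \<epsilon> - cv (2 * i)" "1/4 \<le> W + \<epsilon> - cv (2 * i + 1)" if "i < m" for i
      using cA[OF that] XB \<open>XA < 1/8\<close> by linarith+
    have "1/4 * YA \<le> paired_sum (\<lambda>k. y k * (W + \<epsilon> - cv k))"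
      unfolding YA_def sum_distrib_left
    proof (rule sum_mono)
      fix i assume "i \<in> {..<m}"
      then have i: "i < m" by simp
      show "1/4 * (y (2 * i) + y (2 * i + 1)) \<le> y (2 * i) * (W + \<epsilon> - cv (2 * i)) + y (2 * i + 1) * (W + \<epsilon> - cv (2 * i + 1))"
        using add_mono[OF mult_left_mono[OF gap(1)[OF i] nnA(3)[OF i]] mult_left_mono[OF gap(2)[OF i] nnA(4)[OF i]]]
        by (simp only: distrib_left mult.commute[of "1/4"])
    qed
    then show ?thesis using slackC by linarith
  qed
  have "\<not> (XA \<ge> 1/8 \<and> YA \<ge> 1/8)"
  proof
    assume *: "XA \<ge> 1/8 \<and> YA \<ge> 1/8"
    then have pos: "XA > 0" "YA > 0" by auto
    have prod: "1 / 64 \<le> XA * YA" using * mult_mono[of "1/8" XA "1/8" YA] by simp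
    define xp xm yp ym where "xp i = x (2 * i) / XA" and "xm i = x (2 * i + 1) / XA"
      and "yp i = y (2 * i) / YA" and "ym i = y (2 * i + 1) / YA" for i
    note defs = xp_def xm_def yp_def ym_def
    define rp rm cp cm where "rp i = (yp i + ym i) / 2 + coupling * yp i"
      and "rm i = (yp i + ym i) / 2 + coupling * (ym i - yp i)"
      and "cp i = - (xp i + xm i) / 2 + coupling * xp i"
      and "cm i = - (xp i + xm i) / 2 + coupling * (xm i - xp i)" for i
    define V' W' where "V' = (\<Sum>i<m. xp i * rp i + xm i * rm i)" and "W' = (\<Sum>i<m. yp i * cp i + ym i * cm i)"
    have xx: "x (2 * i) = XA * xp i" "x (2 * i + 1) = XA * xm i" "y (2 * i) = YA * yp i" "y (2 * i + 1) = YA * ym i" for i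
      using pos by (simp_all add: defs)
    have r: "rv (2 * i) = YA * rp i - tail_sum y" "rv (2 * i + 1) = YA * rm i - tail_sum y" if "i < m" for i
      unfolding re[OF that] ro[OF that] xx rp_def rm_def by (simp_all add: algebra_simps add_divide_distrib)
    have c: "cv (2 * i) = XA * cp i - tail_sum x" "cv (2 * i + 1) = XA * cm i - tail_sum x" if "i < m" for i
      unfolding ce[OF that] co[OF that] xx cp_def cm_def by (simp_all add: algebra_simps add_divide_distrib diff_divide_distrib)
    have sxp: "(\<Sum>i<m. xp i + xm i) = 1" "(\<Sum>i<m. yp i + ym i) = 1"
      using pos by (simp_all add: defs XA_def YA_def add_divide_distrib[symmetric] sum_divide_distrib[symmetric])
    have "paired_sum (\<lambda>k. x k * (V + \<epsilon> - rv k)) =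
        (\<Sum>i<m. XA * ((V + \<epsilon> + tail_sum y) * (xp i + xm i) - YA * (xp i * rp i + xm i * rm i)))"
      by (intro sum.cong refl) (simp only: lessThan_iff r xx, simp add: algebra_simps)
    also have "\<dots> = XA * ((V + \<epsilon> + tail_sum y) - YA * V')"
      unfolding V'_def by (simp add: sum_distrib_left[symmetric] sum_subtractf sxp)
    finally have "XA * ((V + \<epsilon> + tail_sum y) - YA * V') \<le> \<epsilon>" using slackR by simp
    then have "V + \<epsilon> + tail_sum y - YA * V' \<le> \<epsilon> / XA" using pos by (simp add: pos_le_divide_eq mult.commute)
    moreover have XA8: "\<epsilon> / XA \<le> \<epsilon> / (1/8)" using * \<epsilon> by (intro divide_left_mono) auto
    ultimately have Vb: "V + \<epsilon> + tail_sum y \<le> YA * V' + 8 * \<epsilon>" by simp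
    have "paired_sum (\<lambda>k. y k * (W + \<epsilon> - cv k)) =
        (\<Sum>i<m. YA * ((W + \<epsilon> + tail_sum x) * (yp i + ym i) - XA * (yp i * cp i + ym i * cm i)))"
      by (intro sum.cong refl) (simp only: lessThan_iff c xx, simp add: algebra_simps)
    also have "\<dots> = YA * ((W + \<epsilon> + tail_sum x) - XA * W')"
      unfolding W'_def by (simp add: sum_distrib_left[symmetric] sum_subtractf sxp)
    finally have "YA * ((W + \<epsilon> + tail_sum x) - XA * W') \<le> \<epsilon>" using slackC by simp
    then have "W + \<epsilon> + tail_sum x - XA * W' \<le> \<epsilon> / YA" using pos by (simp add: pos_le_divide_eq mult.commute)
    moreover have "\<epsilon> / YA \<le> \<epsilon> / (1/8)" using * \<epsilon> by (intro divide_left_mono) auto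
    ultimately have Wb: "W + \<epsilon> + tail_sum x \<le> XA * W' + 8 * \<epsilon>" by simp
    \<comment> \<open>One division by a mass of at least 1/8 has already turned \<epsilon> into
      \<open>8 * \<epsilon>\<close>; renormalising the opponent costs another factor 8.\<close>
    have cancelY: "a \<le> b + 64 * \<epsilon>" if "YA * a \<le> YA * b + 8 * \<epsilon>" for a b
    proof -
      have "8 * \<epsilon> \<le> YA * (64 * \<epsilon>)" using * \<epsilon> mult_right_mono[of "1/8" YA "64 * \<epsilon>"] by simp
      then have "YA * a \<le> YA * (b + 64 * \<epsilon>)" using that by (simp add: distrib_left)
      then show ?thesis using pos by simp
    qed
    have cancelX: "a \<le> b + 64 * \<epsilon>" if "XA * a \<le> XA * b + 8 * \<epsilon>" for a b
    proof -
      have "8 * \<epsilon> \<le> XA * (64 * \<epsilon>)" using * \<epsilon> mult_right_mono[of "1/8" XA "64 * \<epsilon>"] by simp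
      then have "XA * a \<le> XA * (b + 64 * \<epsilon>)" using that by (simp add: distrib_left)
      then show ?thesis using pos by simp
    qed
    have brA: "rp i \<le> V' + 64 * \<epsilon>" "rm i \<le> V' + 64 * \<epsilon>" "cp i \<le> W' + 64 * \<epsilon>" "cm i \<le> W' + 64 * \<epsilon>"
      if i: "i < m" for i
    proof -
      show "rp i \<le> V' + 64 * \<epsilon>" by (rule cancelY) (use br(1)[OF ix(1)[OF i]] Vb r[OF i] in linarith)
      show "rm i \<le> V' + 64 * \<epsilon>" by (rule cancelY) (use br(1)[OF ix(2)[OF i]] Vb r[OF i] in linarith)
      show "cp i \<le> W' + 64 * \<epsilon>" by (rule cancelX) (use br(2)[OF ix(1)[OF i]] Wb c[OF i] in linarith)
      show "cm i \<le> W' + 64 * \<epsilon>" by (rule cancelX) (use br(2)[OF ix(2)[OF i]] Wb c[OF i] in linarith)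
    qed
    have "V' + 1 / (50 * real m) \<le> (1/2 + coupling) / real m + \<bar>\<Sum>i<m. yp i - ym i\<bar> / 4"
    proof (rule block_game_imbalance[OF m_odd])
      show "0 \<le> xp i" "0 \<le> xm i" "0 \<le> yp i" "0 \<le> ym i" if "i < m" for i
        using nnA[OF that] pos by (simp_all add: defs)
      show "0 \<le> 64 * \<epsilon>" using \<epsilon> by simp
    qed (fact sxp coupling_def \<epsilon>m rp_def rm_def cp_def cm_def V'_def W'_def brA)+
    moreover have "(\<Sum>i<m. yp i - ym i) = t / YA"
      by (simp add: defs t_def sum_divide_distrib diff_divide_distrib)
    ultimately have imb: "V' + 1 / (50 * real m) \<le> base_value + \<bar>t\<bar> / YA / 4"
      using pos by (simp add: base_value_def)
    \<comment> \<open>Row \<open>2*m\<close> is even and profits from positive imbalance, row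
      \<open>2*m+1\<close> is odd and profits from negative imbalance.\<close>
    have "base_value * YA + \<bar>t\<bar> / 4 \<le> V + \<epsilon>"
    proof (cases "t \<ge> 0")
      case True
      then show ?thesis using br(1)[of "2*m"] rB[of "2*m"] wnn(2)[of "2*m"] inn by auto
    next
      case False
      then show ?thesis using br(1)[of "2*m+1"] rB[of "2*m+1"] wnn(2)[of "2*m+1"] inn by auto
    qed
    then have "base_value * YA + \<bar>t\<bar> / 4 \<le> YA * V' + 8 * \<epsilon>" using Vb B0 by linarith
    moreover have "base_value * YA + \<bar>t\<bar> / 4 = YA * (base_value + \<bar>t\<bar> / YA / 4)" using pos by (simp add: field_simps)
    ultimately have "base_value + \<bar>t\<bar> / YA / 4 \<le> V' + 64 * \<epsilon>" using cancelY by simp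
    with imb have "1 / (50 * real m) \<le> 64 * \<epsilon>" by linarith
    also have "\<dots> \<le> 1 / (10 ^ 7 * real m ^ 4)" by (rule \<epsilon>m)
    also have "\<dots> \<le> 1 / (10 ^ 7 * real m)" using m4 m_ge_1 by (intro divide_left_mono) auto
    finally show False using m_ge_1 by (simp add: field_simps)
  qed
  then have "XA < 1/8 \<or> YA < 1/8" by auto
  then have small: "XA \<le> 2 * \<epsilon>" "YA \<le> 4 * \<epsilon>" using pull_row pull_col \<epsilon>s by fastforce+
  define Q where "Q = tail_sum (\<lambda>b. weight S b * x b * y b)"
  have Vub: "V \<le> XA + YA + Q"
  proof -
    have "paired_sum (\<lambda>k. x k * rv k) \<le> XA"
      unfolding XA_def
    proof (rule sum_mono)
      fix i assume "i \<in> {..<m}"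
      then have i: "i < m" by simp
      have "rv (2 * i) \<le> 1" "rv (2 * i + 1) \<le> 1" using rA[OF i] A1 B0 by linarith+
      then show "x (2 * i) * rv (2 * i) + x (2 * i + 1) * rv (2 * i + 1) \<le> x (2 * i) + x (2 * i + 1)"
        using nnA[OF i] by (intro add_mono mult_left_le) auto
    qed
    moreover have "tail_sum (\<lambda>k. x k * rv k) \<le> tail_sum (\<lambda>k. YA * x k + weight S k * x k * y k)"
    proof (rule sum_mono)
      fix b assume b: "b \<in> {2*m..<n}"
      have "rv b \<le> YA + weight S b * y b" using rB[OF b] bvYA tYA by auto
      then show "x b * rv b \<le> YA * x b + weight S b * x b * y b"
        using mult_left_mono[of "rv b" "YA + weight S b * y b" "x b"] x(1)[of b] b by (simp add: algebra_simps)
    qed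
    moreover have "tail_sum (\<lambda>k. YA * x k + weight S k * x k * y k) = YA * tail_sum x + Q"
      by (simp add: sum.distrib sum_distrib_left Q_def)
    moreover have "YA * tail_sum x \<le> YA" using A0 XB by (intro mult_left_le) auto
    ultimately show ?thesis unfolding V sum_split by linarith
  qed
  have Wub: "W \<le> - Q / 2"
  proof -
    have "paired_sum (\<lambda>k. cv k * y k) \<le> (\<Sum>i<m. 0)"
    proof (rule sum_mono)
      fix i assume "i \<in> {..<m}"
      then have i: "i < m" by simp
      have "cv (2 * i) \<le> 0" "cv (2 * i + 1) \<le> 0" using cA[OF i] B0 by linarith+
      then show "cv (2 * i) * y (2 * i) + cv (2 * i + 1) * y (2 * i + 1) \<le> 0"
        using nnA[OF i] by (intro add_nonpos_nonpos mult_nonpos_nonneg) auto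
    qed
    moreover have "tail_sum (\<lambda>k. cv k * y k) \<le> tail_sum (\<lambda>k. (-1/2) * (weight S k * x k * y k))"
    proof (rule sum_mono)
      fix b assume b: "b \<in> {2*m..<n}"
      have "cv b \<le> - (weight S b * x b) / 2" using cB[OF b] A0 by simp
      then show "cv b * y b \<le> (-1/2) * (weight S b * x b * y b)"
        using mult_right_mono[of "cv b" "- (weight S b * x b) / 2" "y b"] y(1)[of b] b by simp
    qed
    moreover have "tail_sum (\<lambda>k. (-1/2) * (weight S k * x k * y k)) = (-1/2) * Q"
      unfolding Q_def by (rule sum_distrib_left[symmetric])
    ultimately show ?thesis unfolding W sum_split by simp
  qed
  \<comment> \<open>The 11 is 6 from \<open>XA + YA\<close> in the bound on \<open>V\<close>, 4 from
    \<open>- YA\<close> in the row payoff and 1 from the equilibrium error. In \<open>lb\<close>,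
    the 6 is twice \<open>XA\<close> plus twice \<epsilon>.\<close>
  have ub: "weight S b * y b \<le> Q + 11 * \<epsilon>" if b: "b \<in> {2*m..<n}" for b
  proof -
    have "- YA + weight S b * y b \<le> rv b" using rB[OF b] bvYA tYA by auto
    also have "\<dots> \<le> V + \<epsilon>" using br(1) b by auto
    finally show ?thesis using Vub small by linarith
  qed
  have lb: "Q - 6 * \<epsilon> \<le> weight S b * x b" if b: "b \<in> {2*m..<n}" for b
  proof -
    have "- XA - weight S b * x b / 2 \<le> W + \<epsilon>" using br(2)[of b] cB[OF b] b by auto
    then show ?thesis using Wub small by linarith
  qed
  have "card {2*m..<n} = n - 2 * m" by simp
  note rig = matching_pennies_rigidity[of "{2*m..<n}" "weight S" y Q \<epsilon> x, unfolded this, OF _ _ _ ub lb _ _ _ _ \<epsilon>(1) \<epsilon>k]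
  have rig1: "Q - 6 * \<epsilon> \<le> weight S b * x b" "weight S b * x b \<le> Q - 6 * \<epsilon> + \<delta>"
    "weight S b * y b \<le> Q + 11 * \<epsilon>" "Q + 11 * \<epsilon> - \<delta> \<le> weight S b * y b"
    "160 * real (n - 2 * m) * \<epsilon> < Q"
    if "b \<in> {2*m..<n}" for b
    unfolding \<delta>_def
    using rig[of b] that inn XB YB A0 small weight_bounds by auto
  have w0: "weight S (2*m) = 1" using S by (auto simp: weight_def)
  have b0: "2 * m \<in> {2*m..<n}" using inn by simp
  have k1: "real (n - 2 * m) \<ge> 1" using inn by linarith
  then have k\<epsilon>: "\<epsilon> \<le> real (n - 2 * m) * \<epsilon>" using \<epsilon>(1) mult_right_mono[of 1 "real (n - 2 * m)" \<epsilon>] by simp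
  have z: "Q - 6 * \<epsilon> \<le> x (2*m)" "x (2*m) \<le> Q - 6 * \<epsilon> + \<delta>" "y (2*m) \<le> Q + 11 * \<epsilon>" "Q + 11 * \<epsilon> - \<delta> \<le> y (2*m)"
    using rig1(1-4)[OF b0] w0 by auto
  have \<delta>Q: "\<delta> = 38 * (real (n - 2 * m) * \<epsilon>)" "160 * (real (n - 2 * m) * \<epsilon>) < Q"
    using rig1(5)[OF b0] by (auto simp: \<delta>_def)
  have "3 * \<delta> < x (2*m)" "3 * \<delta> < y (2*m)" using z \<delta>Q k\<epsilon> \<epsilon>(1) by linarith+
  moreover have "\<bar>weight S b * x b - x (2*m)\<bar> \<le> \<delta>" "\<bar>weight S b * y b - y (2*m)\<bar> \<le> \<delta>" if "b \<in> {2*m..<n}" for b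
    using rig1(1-4)[OF that] z by linarith+
  ultimately show ?thesis unfolding pins_def by blast
qed

lemma approx_NE_pins:
  assumes "S \<subseteq> {2*m<..<n}" "0 \<le> \<epsilon>" "\<epsilon> \<le> 1 / (10 ^ 8 * real n ^ 4)" "approx_NE n \<epsilon> (game S) (x, y)"
  shows "pins (38 * real (n - 2 * m) * \<epsilon>) S (\<lambda>k. x $ k) \<and> pins (38 * real (n - 2 * m) * \<epsilon>) S (\<lambda>k. y $ k)"
proof -
  have mats: "row_matrix S \<in> carrier_mat n n" "col_matrix S \<in> carrier_mat n n"
    by (auto simp: row_matrix_def col_matrix_def)
  have xy: "x \<in> mixed_strategies n" "y \<in> mixed_strategies n"
    and br: "\<And>i. i < n \<Longrightarrow> payoff (row_matrix S) x y \<ge> payoff (row_matrix S) (unit_vec n i) y - \<epsilon>"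
            "\<And>j. j < n \<Longrightarrow> payoff (col_matrix S) x y \<ge> payoff (col_matrix S) x (unit_vec n j) - \<epsilon>"
    using assms(4) by (auto simp: approx_NE_def game_def)
  have cx: "x \<in> carrier_vec n" "y \<in> carrier_vec n" using xy by (auto simp: mixed_strategies_def)
  show ?thesis
  proof (rule best_responses_pin[OF assms(1) _ _ _ _ refl refl _ _ _ _ assms(2,3)])
    show "payoff (row_matrix S) x y = (\<Sum>k<n. x $ k * (\<Sum>l<n. row_matrix S $$ (k, l) * y $ l))"
      by (rule payoff_by_rows[OF mats(1) cx])
    show "payoff (col_matrix S) x y = (\<Sum>l<n. (\<Sum>k<n. x $ k * col_matrix S $$ (k, l)) * y $ l)"
      by (rule payoff_by_cols[OF mats(2) cx])
    show "(\<Sum>l<n. row_matrix S $$ (r, l) * y $ l) \<le> payoff (row_matrix S) x y + \<epsilon>" if "r < n" for r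
      using br(1)[OF that] payoff_unit_row[OF mats(1) cx(2) that] by simp
    show "(\<Sum>k<n. x $ k * col_matrix S $$ (k, c)) \<le> payoff (col_matrix S) x y + \<epsilon>" if "c < n" for c
      using br(2)[OF that] payoff_unit_col[OF mats(2) cx(1) that] by simp
  qed (use xy in \<open>auto simp: mixed_strategies_def\<close>)
qed

end

section \<open>The common pseudo-equilibrium\<close>

lemma pseudo_expectation_superset:
  assumes "finite A" "Poly_Mapping.keys \<mu> \<subseteq> A"
  shows "pseudo_expectation \<mu> f = (\<Sum>z\<in>A. Poly_Mapping.lookup \<mu> z * f z)"
  unfolding pseudo_expectation_def
  by (rule sum.mono_neutral_left) (use assms in \<open>auto simp: in_keys_iff\<close>)

lemma pseudo_expectation_add:
  "pseudo_expectation (\<mu> + \<nu>) f = pseudo_expectation \<mu> f + pseudo_expectation \<nu> f"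
proof -
  let ?A = "Poly_Mapping.keys \<mu> \<union> Poly_Mapping.keys \<nu>"
  have "Poly_Mapping.keys (\<mu> + \<nu>) \<subseteq> ?A" by (rule keys_add)
  then show ?thesis
    by (simp add: pseudo_expectation_superset[of ?A] lookup_add ring_distribs sum.distrib)
qed

lemma pseudo_expectation_sum_single:
  "finite A \<Longrightarrow> pseudo_expectation (\<Sum>a\<in>A. Poly_Mapping.single (z a) (w a)) f = (\<Sum>a\<in>A. w a * f (z a))"
proof (induction A rule: finite_induct)
  case empty
  then show ?case by (simp add: pseudo_expectation_def)
next
  case (insert a A)
  have "pseudo_expectation (Poly_Mapping.single (z a) (w a)) f = w a * f (z a)"
    by (subst pseudo_expectation_superset[of "{z a}"]) auto
  then show ?case using insert by (simp add: pseudo_expectation_add)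
qed

context hard_game_family begin

definition activity :: "nat set \<Rightarrow> nat \<Rightarrow> real" where
  "activity T k = (if k < 2 * m \<and> (k div 2 \<in> T) = odd k then 1 / real m else 0)"

text \<open>Both players follow the same signs, so every block is coordinated and the payoffs are
  constant on the support.\<close>

definition point :: "nat set \<Rightarrow> real vec" where
  "point T = vec (2 * n) (\<lambda>k. activity T (if k < n then k else k - n))"

definition pseudo_measure :: signed_measure where
  "pseudo_measure = (\<Sum>T\<in>Pow {..<m}. Poly_Mapping.single (point T) (knapsack_weight m T))"

lemma pseudo_expectation_pseudo_measure:
  "pseudo_expectation pseudo_measure f = knapsack_expectation m (\<lambda>T. f (point T))"
  unfolding pseudo_measure_def knapsack_expectation_def
  by (rule pseudo_expectation_sum_single) simp

lemma point_index [simp]: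
  assumes "k < n"
  shows "point T $ k = activity T k" "point T $ (n + k) = activity T k"
  using assms by (simp_all add: point_def)

text \<open>The only values are 0 and \<open>1 / real m\<close>. This turns linear inequalities on
  the support into squares, to which positivity of the moments applies.\<close>

lemma activity_square: "activity T k = real m * (activity T k)\<^sup>2"
  using m_ge_1 by (simp add: activity_def power2_eq_square)

lemma activity_pair:
  assumes "i < m"
  shows "activity T (2 * i) + activity T (2 * i + 1) = 1 / real m"
    and "activity T (2 * i) - activity T (2 * i + 1) = character {i} T / real m"
  using assms by (auto simp: activity_def character_single)

lemma activity_tail: "k \<ge> 2 * m \<Longrightarrow> activity T k = 0"
  by (simp add: activity_def)

lemma activity_cube_polys: "(\<lambda>T. activity T k) \<in> cube_polys m 1"
proof (cases "k < 2 * m")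
  case True
  then have k: "k div 2 < m" by auto
  have "(\<lambda>T. 1 / (2 * real m) + (if even k then 1 / (2 * real m) else - 1 / (2 * real m)) * character {k div 2} T)
    \<in> cube_polys m 1"
    using k by (intro cube_polys_add cube_polys_const cube_polys_scale cube_polys_character) auto
  then show ?thesis
    by (rule cube_polys_cong) (use True in \<open>auto simp: activity_def character_single\<close>)
next
  case False
  then show ?thesis by (simp add: activity_tail cube_polys_const)
qed

lemma eval_mpoly_point_cube_polys:
  assumes "p \<in> mpolys (2 * n)"
  shows "(\<lambda>T. eval_mpoly (point T) p) \<in> cube_polys m (total_degree p)"
  unfolding eval_mpoly_altdef
proof (intro cube_polys_sum cube_polys_scale)
  fix a assume a: "a \<in> Poly_Mapping.keys p"
  have "(\<lambda>T. \<Prod>i\<in>Poly_Mapping.keys a. point T $ i ^ Poly_Mapping.lookup a i)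
    \<in> cube_polys m (\<Sum>i\<in>Poly_Mapping.keys a. Poly_Mapping.lookup a i * 1)"
  proof (intro cube_polys_prod cube_polys_power)
    fix i assume "i \<in> Poly_Mapping.keys a"
    then have "i < 2 * n" using assms a unfolding mpolys_def by auto
    then show "(\<lambda>T. point T $ i) \<in> cube_polys m 1"
      using activity_cube_polys[of "if i < n then i else i - n"] by (simp add: point_def)
  qed simp
  then have "(\<lambda>T. eval_monomial (point T) a) \<in> cube_polys m (monomial_degree a)"
    by (simp add: eval_monomial_def monomial_degree_def)
  then show "(\<lambda>T. eval_monomial (point T) a) \<in> cube_polys m (total_degree p)"
    by (rule cube_polys_mono) (rule monomial_degree_le_total_degree[OF a])
qed

text \<open>Multiplied by p^2, the first part becomes the square of a function of degree
  \<open>D + 1\<close> and the second a product with the sign sum. \<open>d + 3 \<le> m\<close>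
  makes room for the extra degree of \<open>g\<close>.\<close>

lemma satisfies_ge0_pseudo_measure:
  assumes h: "\<And>T. T \<subseteq> {..<m} \<Longrightarrow> eval_mpoly (point T) h = a * (g T)\<^sup>2 + b * sign_sum m T"
    and a: "0 \<le> a" and g: "g \<in> cube_polys m 1" and d: "d + 3 \<le> m"
  shows "satisfies_ge0 (2 * n) d pseudo_measure h"
  unfolding satisfies_ge0_def
proof (intro ballI impI)
  fix p assume p: "p \<in> mpolys (2 * n)" "total_degree (p\<^sup>2 * h) \<le> d"
  show "0 \<le> pseudo_expectation pseudo_measure (\<lambda>z. eval_mpoly z (p\<^sup>2 * h))"
  proof (cases "h = 0")
    \<comment> \<open>A zero constraint gives no bound on the degree of \<open>p\<close>, so it is
      treated apart.\<close>
    case True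
    then show ?thesis by (simp add: pseudo_expectation_def)
  next
    case False
    define D where "D = total_degree p"
    have D: "2 * D \<le> d" using degree_of_multiplier[OF p(2) False] by (simp add: D_def)
    define f where "f T = eval_mpoly (point T) p" for T
    have f: "f \<in> cube_polys m D" unfolding f_def D_def by (rule eval_mpoly_point_cube_polys[OF p(1)])
    have "knapsack_expectation m (\<lambda>T. sign_sum m T * (f T * f T)) = 0"
      using knapsack_constraint[OF m_odd cube_polys_mult[OF f f]] D d by simp
    moreover have "knapsack_expectation m (\<lambda>T. (f T * g T)\<^sup>2) \<ge> 0"
      using D d by (intro knapsack_square_nonneg[OF m_odd cube_polys_mult[OF f g]]) auto
    moreover have "pseudo_expectation pseudo_measure (\<lambda>z. eval_mpoly z (p\<^sup>2 * h)) =
      knapsack_expectation m (\<lambda>T. a * (f T * g T)\<^sup>2 + b * (sign_sum m T * (f T * f T)))"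
      unfolding pseudo_expectation_pseudo_measure
      by (intro knapsack_expectation_cong) (simp add: h f_def power2_eq_square algebra_simps)
    ultimately show ?thesis using a
      by (simp add: knapsack_expectation_add knapsack_expectation_scale)
  qed
qed

lemma satisfies_eq0_pseudo_measure:
  assumes "\<And>T. T \<subseteq> {..<m} \<Longrightarrow> eval_mpoly (point T) h = 0" "d + 3 \<le> m"
  shows "satisfies_eq0 (2 * n) d pseudo_measure h"
  unfolding satisfies_eq0_def
  using satisfies_ge0_pseudo_measure[of h 0 "\<lambda>T. 0" 0 d] satisfies_ge0_pseudo_measure[of "- h" 0 "\<lambda>T. 0" 0 d]
    assms cube_polys_const[of 0 m 1] by simp

lemma pseudo_distribution_pseudo_measure:
  assumes "d + 3 \<le> m"
  shows "pseudo_distribution (2 * n) d pseudo_measure"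
  unfolding pseudo_distribution_def
proof (intro conjI ballI impI)
  have "Poly_Mapping.keys pseudo_measure \<subseteq>
      (\<Union>T\<in>Pow {..<m}. Poly_Mapping.keys (Poly_Mapping.single (point T) (knapsack_weight m T)))"
    unfolding pseudo_measure_def by (rule keys_sum)
  also have "\<dots> \<subseteq> carrier_vec (2 * n)" by (auto simp: point_def split: if_splits)
  finally show "Poly_Mapping.keys pseudo_measure \<subseteq> carrier_vec (2 * n)" .
  have "knapsack_expectation m (character {}) = 1"
    by (subst knapsack_expectation_character) auto
  then show "pseudo_expectation pseudo_measure (\<lambda>z. 1) = 1"
    unfolding pseudo_expectation_pseudo_measure
    by (subst knapsack_expectation_cong[of m "\<lambda>T. 1" "character {}"]) auto
  fix q assume q: "q \<in> mpolys (2 * n)" "real (total_degree q) \<le> real d / 2"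
  have "2 * total_degree q < m" using q(2) assms by linarith
  then show "0 \<le> pseudo_expectation pseudo_measure (\<lambda>z. eval_mpoly z (q\<^sup>2))"
    unfolding pseudo_expectation_pseudo_measure eval_mpoly_power
    by (intro knapsack_square_nonneg[OF m_odd eval_mpoly_point_cube_polys[OF q(1)]])
qed

section \<open>Payoffs and gains at the support points\<close>

lemma activity_paired_sum: "paired_sum (activity T) = 1"
proof -
  have "paired_sum (activity T) = (\<Sum>i<m. 1 / real m)"
    by (intro sum.cong refl activity_pair(1)) simp
  then show ?thesis using m_ge_1 by simp
qed

lemma activity_tail_sum: "tail_sum (activity T) = 0"
  by (intro sum.neutral) (simp add: activity_tail)

lemma index_cases:
  assumes "k < n"
  obtains i where "i < m" "k = 2 * i" | i where "i < m" "k = 2 * i + 1" | "k \<in> {2*m..<n}"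
proof (cases "k < 2 * m")
  case True
  then show thesis using that(1)[of "k div 2"] that(2)[of "k div 2"] by (cases "even k") auto
next
  case False
  then show thesis using that(3) assms by simp
qed

lemma row_value_activity:
  "i < m \<Longrightarrow> (\<Sum>l<n. row_matrix S $$ (2 * i, l) * activity T l) =
    1 / (2 * real m) + coupling * activity T (2 * i)"
  "i < m \<Longrightarrow> (\<Sum>l<n. row_matrix S $$ (2 * i + 1, l) * activity T l) =
    1 / (2 * real m) + coupling * (activity T (2 * i + 1) - activity T (2 * i))"
  "b \<in> {2*m..<n} \<Longrightarrow> (\<Sum>l<n. row_matrix S $$ (b, l) * activity T l) =
    base_value + (if even b then 1/4 else -1/4) * (sign_sum m T / real m)"
proof -
  show "i < m \<Longrightarrow> (\<Sum>l<n. row_matrix S $$ (2 * i, l) * activity T l) =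
    1 / (2 * real m) + coupling * activity T (2 * i)"
    by (simp only: row_value_even activity_pair(1) activity_tail_sum) simp
  show "i < m \<Longrightarrow> (\<Sum>l<n. row_matrix S $$ (2 * i + 1, l) * activity T l) =
    1 / (2 * real m) + coupling * (activity T (2 * i + 1) - activity T (2 * i))"
    by (simp only: row_value_odd activity_pair(1) activity_tail_sum) simp
  have "(\<Sum>j<m. activity T (2 * j) - activity T (2 * j + 1)) = sign_sum m T / real m"
    unfolding sign_sum_def sum_divide_distrib by (intro sum.cong refl activity_pair(2)) simp
  then show "b \<in> {2*m..<n} \<Longrightarrow> (\<Sum>l<n. row_matrix S $$ (b, l) * activity T l) =
    base_value + (if even b then 1/4 else -1/4) * (sign_sum m T / real m)"
    by (simp only: row_value_tail activity_paired_sum) (simp add: activity_tail)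
qed

lemma col_value_activity:
  "i < m \<Longrightarrow> (\<Sum>k<n. activity T k * col_matrix S $$ (k, 2 * i)) =
    - 1 / (2 * real m) + coupling * activity T (2 * i)"
  "i < m \<Longrightarrow> (\<Sum>k<n. activity T k * col_matrix S $$ (k, 2 * i + 1)) =
    - 1 / (2 * real m) + coupling * (activity T (2 * i + 1) - activity T (2 * i))"
  "b \<in> {2*m..<n} \<Longrightarrow> (\<Sum>k<n. activity T k * col_matrix S $$ (k, b)) = - 1"
  subgoal by (simp only: col_value_even activity_pair(1) activity_tail_sum) simp
  subgoal by (simp only: col_value_odd activity_pair(1) activity_tail_sum) simp
  subgoal by (simp only: col_value_tail activity_paired_sum) (simp add: activity_tail)
  done

lemma activity_block_value:
  assumes "i < m"
  shows "activity T (2 * i) * (s / (2 * real m) + coupling * activity T (2 * i))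
    + activity T (2 * i + 1) * (s / (2 * real m) + coupling * (activity T (2 * i + 1) - activity T (2 * i)))
    = (s / 2 + coupling) / real m * (1 / real m)"
  using assms by (auto simp: activity_def add_divide_distrib)

lemma payoff_row_activity:
  "(\<Sum>k<n. activity T k * (\<Sum>l<n. row_matrix S $$ (k, l) * activity T l)) = base_value"
proof -
  have "paired_sum (\<lambda>k. activity T k * (\<Sum>l<n. row_matrix S $$ (k, l) * activity T l)) =
    (\<Sum>i<m. base_value * (1 / real m))"
    using activity_block_value[of _ T 1]
    by (intro sum.cong refl) (simp only: row_value_activity lessThan_iff base_value_def)
  also have "\<dots> = base_value" using m_ge_1 by simp
  finally have "paired_sum (\<lambda>k. activity T k * (\<Sum>l<n. row_matrix S $$ (k, l) * activity T l)) = base_value" .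
  moreover have "tail_sum (\<lambda>k. activity T k * (\<Sum>l<n. row_matrix S $$ (k, l) * activity T l)) = 0"
    by (intro sum.neutral) (simp add: activity_tail)
  ultimately show ?thesis by (simp only: sum_split)
qed

lemma payoff_col_activity:
  "(\<Sum>l<n. (\<Sum>k<n. activity T k * col_matrix S $$ (k, l)) * activity T l) = (-1/2 + coupling) / real m"
proof -
  have "paired_sum (\<lambda>l. (\<Sum>k<n. activity T k * col_matrix S $$ (k, l)) * activity T l) =
    (\<Sum>i<m. (-1/2 + coupling) / real m * (1 / real m))"
    using activity_block_value[of _ T "-1"]
    by (intro sum.cong refl) (simp only: col_value_activity lessThan_iff mult.commute[of _ "activity T _"])
  also have "\<dots> = (-1/2 + coupling) / real m" using m_ge_1 by simp
  finally have "paired_sum (\<lambda>l. (\<Sum>k<n. activity T k * col_matrix S $$ (k, l)) * activity T l) = (-1/2 + coupling) / real m" .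
  moreover have "tail_sum (\<lambda>l. (\<Sum>k<n. activity T k * col_matrix S $$ (k, l)) * activity T l) = 0"
    by (intro sum.neutral) (simp add: activity_tail)
  ultimately show ?thesis by (simp only: sum_split)
qed

lemma eval_row_gain:
  assumes "r < n"
  shows "eval_mpoly (point T) (row_gain n (row_matrix S) r) =
    base_value - (\<Sum>l<n. row_matrix S $$ (r, l) * activity T l)"
proof -
  have "eval_mpoly (point T) (payoff_poly n (row_matrix S)) =
      (\<Sum>k<n. activity T k * (\<Sum>l<n. row_matrix S $$ (k, l) * activity T l))"
    by (simp add: payoff_poly_def sum_distrib_left mult_ac)
  then show ?thesis by (simp add: row_gain_def payoff_row_activity)
qed

lemma eval_col_gain:
  assumes "c < n"
  shows "eval_mpoly (point T) (col_gain n (col_matrix S) c) =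
    (-1/2 + coupling) / real m - (\<Sum>k<n. activity T k * col_matrix S $$ (k, c))"
proof -
  have "eval_mpoly (point T) (payoff_poly n (col_matrix S)) =
      (\<Sum>k<n. \<Sum>l<n. activity T k * col_matrix S $$ (k, l) * activity T l)"
    by (simp add: payoff_poly_def mult_ac)
  also have "\<dots> = (\<Sum>l<n. (\<Sum>k<n. activity T k * col_matrix S $$ (k, l)) * activity T l)"
    unfolding sum_distrib_right by (rule sum.swap)
  finally have "eval_mpoly (point T) (payoff_poly n (col_matrix S)) = (-1/2 + coupling) / real m"
    by (simp only: payoff_col_activity)
  moreover have "eval_mpoly (point T) (\<Sum>k<n. mconst (col_matrix S $$ (k, c)) * mvar k) =
      (\<Sum>k<n. activity T k * col_matrix S $$ (k, c))"
    by (simp add: mult.commute)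
  ultimately show ?thesis by (simp only: col_gain_def eval_mpoly_diff)
qed

lemma base_value_alt: "base_value = 1 / (2 * real m) + coupling * (1 / real m)"
  and col_value_alt: "(-1/2 + coupling) / real m = - 1 / (2 * real m) + coupling * (1 / real m)"
  by (simp_all add: base_value_def add_divide_distrib diff_divide_distrib)

text \<open>The two activities of a block sum to \<open>1 / real m\<close>, so each loss is a
  multiple of a single activity and hence of its square.\<close>

lemma block_gain:
  assumes "i < m"
  shows "coupling * (1 / real m) - coupling * activity T (2 * i) =
      (coupling * real m) * (activity T (2 * i + 1))\<^sup>2"
    and "coupling * (1 / real m) - coupling * (activity T (2 * i + 1) - activity T (2 * i)) =
      (2 * coupling * real m) * (activity T (2 * i))\<^sup>2"
proof -
  note pair = activity_pair(1)[OF assms, of T, symmetric]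
  have "coupling * (1 / real m) - coupling * activity T (2 * i) = coupling * activity T (2 * i + 1)"
    unfolding pair by (simp add: algebra_simps)
  also have "\<dots> = (coupling * real m) * (activity T (2 * i + 1))\<^sup>2"
    by (subst activity_square) simp
  finally show "coupling * (1 / real m) - coupling * activity T (2 * i) =
      (coupling * real m) * (activity T (2 * i + 1))\<^sup>2" .
  have "coupling * (1 / real m) - coupling * (activity T (2 * i + 1) - activity T (2 * i)) =
      2 * coupling * activity T (2 * i)"
    unfolding pair by (simp add: algebra_simps)
  also have "\<dots> = (2 * coupling * real m) * (activity T (2 * i))\<^sup>2"
    by (subst activity_square) simp
  finally show "coupling * (1 / real m) - coupling * (activity T (2 * i + 1) - activity T (2 * i)) =
      (2 * coupling * real m) * (activity T (2 * i))\<^sup>2" .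
qed

lemma satisfies_row_gain:
  assumes "r < n" "d + 3 \<le> m"
  shows "satisfies_ge0 (2 * n) d pseudo_measure (row_gain n (row_matrix S) r)"
  using assms(1)
proof (cases rule: index_cases)
  case (1 i)
  show ?thesis
  proof (rule satisfies_ge0_pseudo_measure[OF _ _ activity_cube_polys assms(2)])
    fix T
    show "eval_mpoly (point T) (row_gain n (row_matrix S) r) =
      (coupling * real m) * (activity T (2 * i + 1))\<^sup>2 + 0 * sign_sum m T"
      unfolding eval_row_gain[OF assms(1)] unfolding 1 row_value_activity(1)[OF 1(1)]
      unfolding block_gain(1)[OF 1(1), symmetric] base_value_alt by simp
  qed (use coupling_bounds m_ge_1 in simp)
next
  case (2 i)
  show ?thesis
  proof (rule satisfies_ge0_pseudo_measure[OF _ _ activity_cube_polys assms(2)])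
    fix T
    show "eval_mpoly (point T) (row_gain n (row_matrix S) r) =
      (2 * coupling * real m) * (activity T (2 * i))\<^sup>2 + 0 * sign_sum m T"
      unfolding eval_row_gain[OF assms(1)] unfolding 2 row_value_activity(2)[OF 2(1)]
      unfolding block_gain(2)[OF 2(1), symmetric] base_value_alt by simp
  qed (use coupling_bounds m_ge_1 in simp)
next
  case 3
  show ?thesis
  proof (rule satisfies_ge0_pseudo_measure[OF _ order_refl activity_cube_polys assms(2)])
    fix T
    show "eval_mpoly (point T) (row_gain n (row_matrix S) r) =
      0 * (activity T 0)\<^sup>2 + (if even r then - 1 / (4 * real m) else 1 / (4 * real m)) * sign_sum m T"
      unfolding eval_row_gain[OF assms(1)] row_value_activity(3)[OF 3] by simp
  qed
qed

lemma satisfies_col_gain: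
  assumes "c < n" "d + 3 \<le> m"
  shows "satisfies_ge0 (2 * n) d pseudo_measure (col_gain n (col_matrix S) c)"
  using assms(1)
proof (cases rule: index_cases)
  case (1 i)
  show ?thesis
  proof (rule satisfies_ge0_pseudo_measure[OF _ _ activity_cube_polys assms(2)])
    fix T
    show "eval_mpoly (point T) (col_gain n (col_matrix S) c) =
      (coupling * real m) * (activity T (2 * i + 1))\<^sup>2 + 0 * sign_sum m T"
      unfolding eval_col_gain[OF assms(1)] unfolding 1 col_value_activity(1)[OF 1(1)]
      unfolding block_gain(1)[OF 1(1), symmetric] col_value_alt by simp
  qed (use coupling_bounds m_ge_1 in simp)
next
  case (2 i)
  show ?thesis
  proof (rule satisfies_ge0_pseudo_measure[OF _ _ activity_cube_polys assms(2)])
    fix T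
    show "eval_mpoly (point T) (col_gain n (col_matrix S) c) =
      (2 * coupling * real m) * (activity T (2 * i))\<^sup>2 + 0 * sign_sum m T"
      unfolding eval_col_gain[OF assms(1)] unfolding 2 col_value_activity(2)[OF 2(1)]
      unfolding block_gain(2)[OF 2(1), symmetric] col_value_alt by simp
  qed (use coupling_bounds m_ge_1 in simp)
next
  case 3
  show ?thesis
  \<comment> \<open>Against block rows a tail column earns -1, below the equilibrium value by a
    constant; the square is that of the constant 1.\<close>
  proof (rule satisfies_ge0_pseudo_measure[OF _ _ cube_polys_const assms(2)])
    fix T
    show "eval_mpoly (point T) (col_gain n (col_matrix S) c) =
      ((-1/2 + coupling) / real m + 1) * 1\<^sup>2 + 0 * sign_sum m T"
      unfolding eval_col_gain[OF assms(1)] col_value_activity(3)[OF 3] by simp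
    show "0 \<le> (-1/2 + coupling) / real m + 1"
      using coupling_bounds m_ge_1 by (simp add: field_simps)
  qed
qed

text \<open>\<open>pseudo_measure\<close> does not mention \<open>S\<close>: the weights act only
  where its points have no mass, so it is a valid input for every game of the family.\<close>

theorem pseudo_equilibrium_pseudo_measure:
  assumes "d + 3 \<le> m"
  shows "pseudo_equilibrium n d (game S) pseudo_measure"
proof -
  have total: "(\<Sum>i<n. activity T i) = 1" for T
    by (simp only: sum_split activity_paired_sum activity_tail_sum)
  have var: "satisfies_ge0 (2 * n) d pseudo_measure h"
    if "\<And>T. eval_mpoly (point T) h = activity T i" for h i
  proof (rule satisfies_ge0_pseudo_measure[OF _ _ activity_cube_polys assms])
    show "eval_mpoly (point T) h = real m * (activity T i)\<^sup>2 + 0 * sign_sum m T" for T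
      using that activity_square[of T i] by simp
  qed simp
  show ?thesis
    unfolding pseudo_equilibrium_def game_def fst_conv snd_conv
    using assms
    by (intro conjI allI impI pseudo_distribution_pseudo_measure satisfies_eq0_pseudo_measure
        satisfies_row_gain satisfies_col_gain) (auto simp: total intro: var)
qed

end

section \<open>Query complexity\<close>

text \<open>Along the all-no path every query rules out at most one member of the family.\<close>

lemma run_tree_success_card:
  assumes "finite F"
    and "\<And>a G G'. G \<in> F \<Longrightarrow> G' \<in> F \<Longrightarrow> orc G a \<Longrightarrow> orc G' a \<Longrightarrow> G = G'"
    and "\<And>r G G'. G \<in> F \<Longrightarrow> G' \<in> F \<Longrightarrow> good G r \<Longrightarrow> good G' r \<Longrightarrow> G = G'"
  shows "card {G \<in> F. good G (run_tree (orc G) T)} \<le> query_depth T + 1"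
  using assms
proof (induction T arbitrary: F)
  case (Output r)
  then show ?case by (auto simp: card_le_Suc0_iff_eq)
next
  case (Query a t f)
  let ?F = "{G \<in> F. \<not> orc G a}"
  have "card {G \<in> ?F. good G (run_tree (orc G) f)} \<le> query_depth f + 1"
    using Query.prems by (intro Query.IH(2)) auto
  moreover have "card {G \<in> F. orc G a} \<le> 1"
    using Query.prems(1,2) by (auto simp: card_le_Suc0_iff_eq)
  moreover have "card {G \<in> F. good G (run_tree (orc G) (Query a t f))} \<le>
      card ({G \<in> F. orc G a} \<union> {G \<in> ?F. good G (run_tree (orc G) f)})"
    using Query.prems(1) by (intro card_mono) auto
  moreover have "\<dots> \<le> card {G \<in> F. orc G a} + card {G \<in> ?F. good G (run_tree (orc G) f)}"
    by (rule card_Un_le)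
  ultimately show ?case by simp
qed

text \<open>Averaging as in Yao's principle: the expected number of solved games is at least 2/3 of
  the family, while no deterministic procedure solves more than \<open>N\<close>.\<close>

lemma (in prob_space) card_le_of_likely_events:
  assumes "finite F"
    and likely: "\<And>G. G \<in> F \<Longrightarrow> measure M {T \<in> space M. P G T} \<ge> 2 / 3"
    and few: "\<And>T. T \<in> space M \<Longrightarrow> card {G \<in> F. P G T} \<le> N"
  shows "2 / 3 * real (card F) \<le> real N"
proof -
  define E where "E G = {T \<in> space M. P G T}" for G
  \<comment> \<open>A non-measurable set would have measure 0, contradicting the bound 2/3.\<close>
  have E: "E G \<in> sets M" if "G \<in> F" for G
    using likely[OF that] measure_notin_sets[of "E G" M] by (force simp: E_def)
  have int: "integrable M (indicator (E G) :: _ \<Rightarrow> real)" if "G \<in> F" for G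
    using E[OF that] by (intro integrable_real_indicator) (simp_all add: emeasure_eq_measure)
  have "2 / 3 * real (card F) \<le> (\<Sum>G\<in>F. measure M (E G))"
    using sum_bounded_below[of F "2 / 3 :: real" "\<lambda>G. measure M (E G)"] likely by (simp add: E_def mult.commute)
  also have "\<dots> = (\<Sum>G\<in>F. \<integral>T. indicator (E G) T \<partial>M)"
    using E by (intro sum.cong refl) (simp add: sets.Int_space_eq2)
  also have "\<dots> = (\<integral>T. (\<Sum>G\<in>F. indicator (E G) T) \<partial>M)"
    using int by (intro Bochner_Integration.integral_sum[symmetric]) auto
  also have "\<dots> \<le> real N"
  proof (rule integral_le_const)
    show "integrable M (\<lambda>T. \<Sum>G\<in>F. indicator (E G) T :: real)"
      using int by (intro Bochner_Integration.integrable_sum) auto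
    have "(\<Sum>G\<in>F. indicator (E G) T :: real) \<le> real N" if "T \<in> space M" for T
    proof -
      have "(\<Sum>G\<in>F. indicator (E G) T :: real) = (\<Sum>G\<in>F. if P G T then 1 else 0)"
        using that by (intro sum.cong refl) (simp add: E_def)
      also have "\<dots> = real (card {G \<in> F. P G T})"
        using assms(1) by (simp add: sum.If_cases Int_def)
      finally show ?thesis using few[OF that] by simp
    qed
    then show "AE T in M. (\<Sum>G\<in>F. indicator (E G) T :: real) \<le> real N" by auto
  qed
  finally show ?thesis .
qed

context hard_game_family begin

text \<open>Each player's strategy alone pins \<open>S\<close>, so one shared strategy suffices.
  This is why the partial oracle helps no more than the full one in the counting below.\<close>

lemma approx_NE_determines_game:
  assumes "S \<subseteq> {2*m<..<n}" "S' \<subseteq> {2*m<..<n}" "0 \<le> \<epsilon>" "\<epsilon> \<le> 1 / (10 ^ 8 * real n ^ 4)"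
    and "approx_NE n \<epsilon> (game S) (x, y)" "approx_NE n \<epsilon> (game S') (x', y')" "x = x' \<or> y = y'"
  shows "S = S'"
  using approx_NE_pins[OF assms(1,3,4,5)] approx_NE_pins[OF assms(2,3,4,6)] assms(7)
    pins_unique[OF assms(1,2)] by blast

lemma query_lower_bound:
  fixes A :: "'a ov_procedure"
  assumes \<epsilon>: "0 \<le> \<epsilon>" "\<epsilon> \<le> 1 / (10 ^ 8 * real n ^ 4)" and d: "d + 3 \<le> m"
    and A: "ov_algorithm n d q A" "computes_NE n d \<epsilon> orc A"
    and uniq: "\<And>a S S'. S \<subseteq> {2*m<..<n} \<Longrightarrow> S' \<subseteq> {2*m<..<n} \<Longrightarrow>
      orc (game S) a \<Longrightarrow> orc (game S') a \<Longrightarrow> S = S'"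
  shows "2 / 3 * 2 ^ (n - 2 * m - 1) \<le> real q + 1"
proof -
  let ?M = "A pseudo_measure"
  let ?F = "Pow {2*m<..<n}"
  have pe: "pseudo_equilibrium n d (game S) pseudo_measure" for S
    by (rule pseudo_equilibrium_pseudo_measure[OF d])
  have "prob_space ?M" and depth: "\<And>T. T \<in> space ?M \<Longrightarrow> query_depth T \<le> q"
    using A(1) is_game pe unfolding ov_algorithm_def by blast+
  interpret prob_space ?M by fact
  have "2 / 3 * real (card ?F) \<le> real (q + 1)"
  proof (rule card_le_of_likely_events)
    show "2 / 3 \<le> measure ?M {T \<in> space ?M. approx_NE n \<epsilon> (game S) (run_tree (orc (game S)) T)}" for S
      using A(2) is_game pe payoffs_in_unit unfolding computes_NE_def by blast
    show "card {S \<in> ?F. approx_NE n \<epsilon> (game S) (run_tree (orc (game S)) T)} \<le> q + 1"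
      if "T \<in> space ?M" for T
    proof -
      have "card {S \<in> ?F. approx_NE n \<epsilon> (game S) (run_tree (orc (game S)) T)} \<le> query_depth T + 1"
      proof (rule run_tree_success_card)
        fix r S S' assume "S \<in> ?F" "S' \<in> ?F" "approx_NE n \<epsilon> (game S) r" "approx_NE n \<epsilon> (game S') r"
        then show "S = S'"
          using approx_NE_determines_game[OF _ _ \<epsilon>] by (cases r) blast
      next
        fix a S S' assume "S \<in> ?F" "S' \<in> ?F" "orc (game S) a" "orc (game S') a"
        then show "S = S'" by (intro uniq) auto
      qed simp
      then show ?thesis using depth[OF that] by simp
    qed
  qed simp
  then show ?thesis by (simp add: card_Pow)
qed

end

lemma exponential_query_bound:
  fixes d q :: "nat \<Rightarrow> nat" and orc :: "nat \<Rightarrow> game \<Rightarrow> 'a \<Rightarrow> bool"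
  assumes alg: "\<And>n. n \<ge> 1 \<Longrightarrow> \<exists>A :: 'a ov_procedure.
      ov_algorithm n (d n) (q n) A \<and> computes_NE n (d n) (1 / 10 ^ 8 / real n ^ 4) (orc n) A"
    and uniq: "\<And>n m a S S'. \<lbrakk>hard_game_family n m; S \<subseteq> {2*m<..<n}; S' \<subseteq> {2*m<..<n};
      orc n (hard_game_family.game n m S) a; orc n (hard_game_family.game n m S') a\<rbrakk> \<Longrightarrow> S = S'"
  shows "\<exists>c::real. c > 0 \<and> (\<forall>\<^sub>F n in sequentially.
            real (d n) \<ge> c * real n \<or> real (q n) \<ge> 2 powr (c * real n))"
proof (intro exI conjI)
  show "(0::real) < 1 / 16" by simp
  show "\<forall>\<^sub>F n in sequentially. real (d n) \<ge> 1 / 16 * real n \<or> real (q n) \<ge> 2 powr (1 / 16 * real n)"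
    unfolding eventually_sequentially
  proof (intro exI allI impI, rule ccontr)
    fix n :: nat assume n: "20 \<le> n"
    assume "\<not> (real (d n) \<ge> 1 / 16 * real n \<or> real (q n) \<ge> 2 powr (1 / 16 * real n))"
    then have d: "16 * d n < n" and q: "real (q n) < 2 powr (1 / 16 * real n)" by auto
    \<comment> \<open>An odd number near \<open>n / 4\<close>: the blocks then take about half of
      the strategies and leave about \<open>n / 2\<close> for the tail, so both the degree bound and
      the exponent of the query bound are linear in \<open>n\<close>.\<close>
    define m where "m = 2 * (n div 8) + 1"
    have m: "odd m" "2 * m + 2 \<le> n" "d n + 3 \<le> m" using n d by (auto simp: m_def)
    interpret hard_game_family n m by unfold_locales (use m in auto)
    obtain A :: "'a ov_procedure" where
      A: "ov_algorithm n (d n) (q n) A" "computes_NE n (d n) (1 / 10 ^ 8 / real n ^ 4) (orc n) A"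
      using alg[of n] n by auto
    have "2 / 3 * 2 ^ (n - 2 * m - 1) \<le> real (q n) + 1"
      by (rule query_lower_bound[OF _ _ m(3) A uniq[OF hard_game_family_axioms]]) simp_all
    also have "\<dots> < 2 powr (1 / 16 * real n) + 1" using q by simp
    also have "\<dots> \<le> 2 powr (1 / 16 * real n) + 2 powr (1 / 16 * real n)"
      by (simp add: ge_one_powr_ge_zero)
    also have "\<dots> = 2 powr (1 / 16 * real n + 1)" by (simp add: powr_add)
    finally have 1: "2 / 3 * 2 ^ (n - 2 * m - 1) < 2 powr (1 / 16 * real n + 1)" .
    have "2 powr (real (n - 2 * m - 1) - 1) = 2 ^ (n - 2 * m - 1) / (2::real)"
      by (simp add: powr_diff powr_realpow)
    also have "\<dots> \<le> 2 / 3 * 2 ^ (n - 2 * m - 1)" by simp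
    also note 1
    finally have "real (n - 2 * m - 1) - 1 < 1 / 16 * real n + 1" by simp
    moreover have "real (n - 2 * m - 1) \<ge> real n / 2 - 3"
      using n m(2) by (simp add: m_def of_nat_diff)
    ultimately show False using n by linarith
  qed
qed

theorem mainTheorem1:
  shows "\<exists>c\<^sub>0::real. c\<^sub>0 > 0 \<and>
    (let \<epsilon> = (\<lambda>n::nat. c\<^sub>0 / real n ^ 4) in
      (\<forall>d q :: nat \<Rightarrow> nat.
         (\<forall>n\<ge>1. \<exists>A :: profile ov_procedure.
            ov_algorithm n (d n) (q n) A \<and>
            computes_NE n (d n) (\<epsilon> n) (verification_oracle n (\<epsilon> n)) A) \<longrightarrow>
         (\<exists>c::real. c > 0 \<and> (\<forall>\<^sub>F n in sequentially.
            real (d n) \<ge> c * real n \<or> real (q n) \<ge> 2 powr (c * real n)))) \<and>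
      (\<forall>d q :: nat \<Rightarrow> nat.
         (\<forall>n\<ge>1. \<exists>A :: strategy ov_procedure.
            ov_algorithm n (d n) (q n) A \<and>
            computes_NE n (d n) (\<epsilon> n) (partial_verification_oracle n (\<epsilon> n)) A) \<longrightarrow>
         (\<exists>c::real. c > 0 \<and> (\<forall>\<^sub>F n in sequentially.
            real (d n) \<ge> c * real n \<or> real (q n) \<ge> 2 powr (c * real n)))))"
proof (intro exI[of _ "1 / 10 ^ 8"] conjI, simp, unfold Let_def, intro conjI allI impI)
  fix d q :: "nat \<Rightarrow> nat"
  assume "\<forall>n\<ge>1. \<exists>A :: profile ov_procedure. ov_algorithm n (d n) (q n) A \<and>
    computes_NE n (d n) (1 / 10 ^ 8 / real n ^ 4) (verification_oracle n (1 / 10 ^ 8 / real n ^ 4)) A"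
  then show "\<exists>c::real. c > 0 \<and> (\<forall>\<^sub>F n in sequentially.
            real (d n) \<ge> c * real n \<or> real (q n) \<ge> 2 powr (c * real n))"
  proof (intro exponential_query_bound[of d q "\<lambda>n. verification_oracle n (1 / 10 ^ 8 / real n ^ 4)"])
    fix n m S S' and a :: profile
    assume *: "hard_game_family n m" "S \<subseteq> {2*m<..<n}" "S' \<subseteq> {2*m<..<n}"
      "verification_oracle n (1 / 10 ^ 8 / real n ^ 4) (hard_game_family.game n m S) a"
      "verification_oracle n (1 / 10 ^ 8 / real n ^ 4) (hard_game_family.game n m S') a"
    show "S = S'"
      using hard_game_family.approx_NE_determines_game[OF *(1-3), of "1 / 10 ^ 8 / real n ^ 4"] *(4,5)
      by (cases a) (simp add: verification_oracle_def)
  qed simp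
next
  fix d q :: "nat \<Rightarrow> nat"
  assume "\<forall>n\<ge>1. \<exists>A :: strategy ov_procedure. ov_algorithm n (d n) (q n) A \<and>
    computes_NE n (d n) (1 / 10 ^ 8 / real n ^ 4) (partial_verification_oracle n (1 / 10 ^ 8 / real n ^ 4)) A"
  then show "\<exists>c::real. c > 0 \<and> (\<forall>\<^sub>F n in sequentially.
            real (d n) \<ge> c * real n \<or> real (q n) \<ge> 2 powr (c * real n))"
  proof (intro exponential_query_bound[of d q "\<lambda>n. partial_verification_oracle n (1 / 10 ^ 8 / real n ^ 4)"])
    fix n m S S' and a :: strategy
    assume *: "hard_game_family n m" "S \<subseteq> {2*m<..<n}" "S' \<subseteq> {2*m<..<n}"
      "partial_verification_oracle n (1 / 10 ^ 8 / real n ^ 4) (hard_game_family.game n m S) a"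
      "partial_verification_oracle n (1 / 10 ^ 8 / real n ^ 4) (hard_game_family.game n m S') a"
    \<comment> \<open>Two yes answers yield equilibria sharing the queried strategy; the opponents'
      strategies may differ.\<close>
    show "S = S'"
      using hard_game_family.approx_NE_determines_game[OF *(1-3), of "1 / 10 ^ 8 / real n ^ 4"] *(4,5)
      by (cases a) (auto simp: partial_verification_oracle_def)
  qed simp
qed

end
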